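(* Let $N\ge1$, $S_N=\mathbb Z\cap[-N,N]$, and let $(p,q)$ satisfy $(\frac1q,\frac1p)\in(A,B]$, where $A=(0,\frac12)$, $B=(1,0)$ and $(A,B]$ is the line segment from $A$ to $B$ excluding $A$ and including $B$ (equivalently $\frac2p+\frac1q=1$ with $1\le q<\infty$). Let $\beta\le\frac{2q}{q+1}$, $\lambda=(\lambda_j)_{j\ge1}\in\ell^\beta$ and $(f_j)_{j\ge1}$ an orthonormal system in $L^2(\mathbf T)$. Then, with $C$ independent of $N$, $\lambda$, $(f_j)$, $$\Big\|\sum_{j=1}^\infty\lambda_j|\mathscr D_Nf_j|^2\Big\|_{L_t^pL_x^q(\mathbf T\times\mathbf T)}\le CN^{1/p}\|\lambda\|_{\ell^\beta}.$$
   Context: $\mathbf T=[0,2\pi)$, $\mathscr F_xf(k)=\frac1{2\pi}\int_{\mathbf T}e^{-ixk}f(x)\,dx$. For $f\in L^2(\mathbf T)$, $\mathscr D_Nf(t,x)=e^{it\sqrt{\partial_x^4-\partial_x^2}}P_{\le N}f=\frac1{2\pi}\sum_{n\in S_N}\mathscr F_xf(n)e^{i(xn+t\sqrt{n^2+n^4})}$. The norm $L^p_tL^q_x$ is the $L^p$ norm in $t\in\mathbf T$ of the $L^q$ norm in $x\in\mathbf T$. *)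

theory Defs
  imports "HOL-Analysis.Analysis" "HOL-Probability.Essential_Supremum"
begin

text \<open>The torus T = [0, 2 pi), with (unnormalised) Lebesgue measure.\<close>
definition torus :: "real set" where
  "torus = {0..<2*pi}"

definition fourier_coeff :: "(real \<Rightarrow> complex) \<Rightarrow> int \<Rightarrow> complex" where
  "fourier_coeff f k = complex_of_real (1/(2*pi)) *
     (LINT x:torus|lborel. cis (- (x * of_int k)) * f x)"

definition DN :: "nat \<Rightarrow> (real \<Rightarrow> complex) \<Rightarrow> real \<Rightarrow> real \<Rightarrow> complex" where
  "DN N f t x = complex_of_real (1/(2*pi)) *
     (\<Sum>n\<in>{- int N..int N}. fourier_coeff f n *
        cis (x * of_int n + t * sqrt (of_int n ^ 2 + of_int n ^ 4)))"

definition L2T :: "(real \<Rightarrow> complex) \<Rightarrow> bool" where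
  "L2T f \<longleftrightarrow> set_borel_measurable lborel torus f \<and>
              set_integrable lborel torus (\<lambda>x. (cmod (f x))\<^sup>2)"

definition L2T_inner :: "(real \<Rightarrow> complex) \<Rightarrow> (real \<Rightarrow> complex) \<Rightarrow> complex" where
  "L2T_inner f g = (LINT x:torus|lborel. f x * cnj (g x))"

definition orthonormal_system :: "(nat \<Rightarrow> real \<Rightarrow> complex) \<Rightarrow> bool" where
  "orthonormal_system f \<longleftrightarrow> (\<forall>j. L2T (f j)) \<and>
     (\<forall>j k. L2T_inner (f j) (f k) = (if j = k then 1 else 0))"

definition in_lbeta :: "real \<Rightarrow> (nat \<Rightarrow> complex) \<Rightarrow> bool" where
  "in_lbeta \<beta> lam \<longleftrightarrow> summable (\<lambda>j. cmod (lam j) powr \<beta>)"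

definition lbeta_norm :: "real \<Rightarrow> (nat \<Rightarrow> complex) \<Rightarrow> real" where
  "lbeta_norm \<beta> lam = (\<Sum>j. cmod (lam j) powr \<beta>) powr (1/\<beta>)"

text \<open>Real powers of extended nonnegative reals (for positive exponents).\<close>
definition enn_powr :: "ennreal \<Rightarrow> real \<Rightarrow> ennreal" where
  "enn_powr a r = (if a = \<infinity> then \<infinity> else ennreal (enn2real a powr r))"

definition Lq_x :: "real \<Rightarrow> (real \<Rightarrow> real \<Rightarrow> complex) \<Rightarrow> real \<Rightarrow> ennreal" where
  "Lq_x q F t = enn_powr (\<integral>\<^sup>+ x\<in>torus. ennreal (cmod (F t x) powr q) \<partial>lborel) (1/q)"

definition mixed_norm :: "ereal \<Rightarrow> real \<Rightarrow> (real \<Rightarrow> real \<Rightarrow> complex) \<Rightarrow> ennreal" where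
  "mixed_norm p q F =
     (if p = \<infinity> then esssup (restrict_space lborel torus) (Lq_x q F)
      else enn_powr (\<integral>\<^sup>+ t\<in>torus. enn_powr (Lq_x q F t) (real_of_ereal p) \<partial>lborel)
                    (1 / real_of_ereal p))"

definition DN_density :: "nat \<Rightarrow> (nat \<Rightarrow> complex) \<Rightarrow> (nat \<Rightarrow> real \<Rightarrow> complex) \<Rightarrow> real \<Rightarrow> real \<Rightarrow> complex" where
  "DN_density N lam f t x = (\<Sum>j. lam j * complex_of_real ((cmod (DN N (f j) t x))\<^sup>2))"

end

theory Submission
  imports Defs "HOL-Complex_Analysis.Complex_Analysis"
begin

text \<open>
  On a time slab of length \<open>1/N\<close> the propagator has a kernel bounded by \<open>C \<bar>t\<bar>\<^sup>-\<^sup>1\<^sup>/\<^sup>2\<close> (Kuzmin--Landau and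
  van der Corput, since the phase \<open>n \<mapsto> (n\<^sup>2 + n\<^sup>4)\<^sup>1\<^sup>/\<^sup>2\<close> stays within \<open>1/2\<close> of \<open>n\<^sup>2\<close>). The torus in time
  is covered by \<open>7 N\<close> slabs, which is where the factor \<open>N\<^sup>1\<^sup>/\<^sup>p\<close> comes from, so everything reduces to a bound
  without loss on one slab.

  By duality the slab bound says that the Gram matrix \<open>\<Gamma>\<close> of the waves with respect to a weight \<open>V\<close> has
  Schatten norm of order \<open>2/\<tau>\<close>, \<open>\<tau> = 1 - 1/q\<close>, at most \<open>C\<close> times the norm of \<open>V\<close> in the dual mixed space.
  Its eigenvalues are also those of the operator with kernel \<open>W(X) K(X - Y) W(Y)\<close>, \<open>W = V\<^sup>1\<^sup>/\<^sup>2\<close>, into which a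
  factor \<open>\<bar>t - s\<bar>\<^sup>z\<close> can be inserted. Write \<open>v(t)\<close> for the spatial norm of \<open>V(t, \<cdot>)\<close>. Replacing \<open>V\<close> by
  \<open>v (V/v)\<^sup>\<zeta>\<^sup>/\<^sup>\<tau>\<close> and inserting \<open>\<bar>t - s\<bar>\<close> to the power \<open>(\<zeta> - \<tau>)/2\<close> makes the line \<open>Re \<zeta> = 0\<close> an operator-norm
  bound, the line \<open>Re \<zeta> = 1\<close> a Hilbert--Schmidt bound using dispersion, and both follow from the
  Hardy--Littlewood--Sobolev inequality with the same norm of \<open>v\<close>; the point \<open>\<zeta> = \<tau>\<close> is the claim.
\<close>

section \<open>Complex interpolation on a strip\<close>

text \<open>The slab length keeps the increments of the phase within 2 of the first one, less than a
  period, so at most one multiple of \<open>2 * pi\<close> is nearly stationary and the kernel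
  decays as on the line. Interpolation needs powers of the weight and of the time distance that are
  entire in the exponent and bounded on the strip. Hence weights are pinched between positive
  constants and the time distance is truncated at \<open>1 / N^2\<close>; no final constant depends
  on the pinching or the truncation, and the shift by \<open>\<eta>\<close> that secures the
  pinching is sent to 0. The Hardy--Littlewood--Sobolev exponents are \<open>\<tau> / 2\<close> and
  \<open>\<tau>\<close>; the second constant blows up as \<open>\<tau>\<close> tends to 1, that is
  \<open>q\<close> to infinity, the excluded endpoint. At the included endpoint \<open>q = 1\<close>
  one has \<open>\<tau> = 0\<close>, and conservation of mass replaces the whole argument. Only
  \<open>2 * N + 1\<close> waves occur, so Schatten norms are power sums of eigenvalues of one
  Hermitian matrix, and trace duality is the choice of weights \<open>d\<close> in a finite
  sum.\<close>

lemma strip_maximum_principle: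
  fixes F :: "complex \<Rightarrow> complex"
  assumes hol: "F holomorphic_on UNIV"
    and bdd: "\<And>z. 0 \<le> Re z \<Longrightarrow> Re z \<le> 1 \<Longrightarrow> norm (F z) \<le> B"
    and left: "\<And>z. Re z = 0 \<Longrightarrow> norm (F z) \<le> M"
    and right: "\<And>z. Re z = 1 \<Longrightarrow> norm (F z) \<le> M"
    and M: "0 < M"
    and z: "0 \<le> Re z" "Re z \<le> 1"
  shows "norm (F z) \<le> M"
proof -
  have B0: "0 \<le> B" using bdd[OF z] norm_ge_zero[of "F z"] by linarith
  \<comment> \<open>The factor \<open>exp (e * (w^2 - 1))\<close> decays like a Gaussian in
    \<open>Im w\<close>; the \<open>- 1\<close> keeps its modulus at most 1 on the strip. It
    confines the problem to a rectangle and disappears as \<open>e\<close> tends to 0.\<close>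
  have main: "norm (F z) * exp (e * ((Re z)\<^sup>2 - (Im z)\<^sup>2 - 1)) \<le> M" if e: "e > 0" for e
  proof -
    define H where "H = (\<lambda>w. F w * exp (of_real e * (w\<^sup>2 - 1)))"
    have normH: "norm (H w) = norm (F w) * exp (e * ((Re w)\<^sup>2 - (Im w)\<^sup>2 - 1))" for w
      by (simp add: H_def norm_mult power2_eq_square)
    have holH: "H holomorphic_on UNIV"
      unfolding H_def by (intro holomorphic_intros hol)
    have dec: "exp (e * ((Re w)\<^sup>2 - (Im w)\<^sup>2 - 1)) \<le> exp (- e * (Im w)\<^sup>2)" if "0 \<le> Re w" "Re w \<le> 1" for w
    proof -
      have "(Re w)\<^sup>2 \<le> 1" using that by (simp add: power_le_one)
      then have "e * ((Re w)\<^sup>2 - (Im w)\<^sup>2 - 1) \<le> e * (- (Im w)\<^sup>2)" using e by (intro mult_left_mono) auto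
      then show ?thesis by simp
    qed
    have "((\<lambda>R::real. B * exp (- e * R\<^sup>2)) \<longlongrightarrow> 0) at_top" using e by real_asymp
    then have "eventually (\<lambda>R::real. B * exp (- e * R\<^sup>2) < M) at_top"
      using M by (rule order_tendstoD(2))
    then have "eventually (\<lambda>R::real. B * exp (- e * R\<^sup>2) < M \<and> R > \<bar>Im z\<bar>) at_top"
      using eventually_gt_at_top eventually_conj by blast
    \<comment> \<open>With this height the horizontal sides are controlled by the crude bound
      \<open>B\<close> alone; the vertical sides use \<open>left\<close> and
      \<open>right\<close>.\<close>
    then obtain R where R: "B * exp (- e * R\<^sup>2) < M" "R > \<bar>Im z\<bar>"
      by (auto simp: eventually_at_top_linorder)
    have "norm (H z) \<le> M"
    proof (rule maximum_modulus_frontier[of H "cbox (Complex 0 (-R)) (Complex 1 R)"])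
      show "H holomorphic_on interior (cbox (Complex 0 (-R)) (Complex 1 R))"
        using holH holomorphic_on_subset by blast
      show "continuous_on (closure (cbox (Complex 0 (-R)) (Complex 1 R))) H"
        using holH holomorphic_on_imp_continuous_on continuous_on_subset by blast
      show "z \<in> cbox (Complex 0 (-R)) (Complex 1 R)"
        using z R by (auto simp: in_cbox_complex_iff)
      fix w assume "w \<in> frontier (cbox (Complex 0 (-R)) (Complex 1 R))"
      then have w: "0 \<le> Re w" "Re w \<le> 1" "Re w = 0 \<or> Re w = 1 \<or> Im w = R \<or> Im w = -R"
        by (auto simp: frontier_cbox in_cbox_complex_iff in_box_complex_iff)
      have "exp (- e * (Im w)\<^sup>2) \<le> 1" using e by simp
      then have le1: "exp (e * ((Re w)\<^sup>2 - (Im w)\<^sup>2 - 1)) \<le> 1" using dec[OF w(1,2)] by linarith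
      show "norm (H w) \<le> M"
      proof (cases "Re w = 0 \<or> Re w = 1")
        case True
        then have "norm (F w) \<le> M" using left right by blast
        then have "norm (F w) * exp (e * ((Re w)\<^sup>2 - (Im w)\<^sup>2 - 1)) \<le> M * 1"
          using le1 M by (intro mult_mono) auto
        then show ?thesis by (simp add: normH)
      next
        case False
        then have "(Im w)\<^sup>2 = R\<^sup>2" using w by auto
        then have "exp (e * ((Re w)\<^sup>2 - (Im w)\<^sup>2 - 1)) \<le> exp (- e * R\<^sup>2)"
          using dec[OF w(1,2)] by simp
        then have "norm (H w) \<le> B * exp (- e * R\<^sup>2)"
          unfolding normH using bdd[OF w(1,2)] B0 by (intro mult_mono) auto
        then show ?thesis using R by simp
      qed
    qed simp
    then show ?thesis by (simp add: normH)
  qed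
  have "((\<lambda>e. norm (F z) * exp (e * ((Re z)\<^sup>2 - (Im z)\<^sup>2 - 1))) \<longlongrightarrow> norm (F z) * exp (0 * ((Re z)\<^sup>2 - (Im z)\<^sup>2 - 1))) (at_right 0)"
    by (intro tendsto_intros)
  then have "norm (F z) * exp (0 * ((Re z)\<^sup>2 - (Im z)\<^sup>2 - 1)) \<le> M"
    by (rule tendsto_upperbound) (auto simp: eventually_at_right_less intro!: eventually_at_rightI[of 0 1] main)
  then show ?thesis by simp
qed

text \<open>The quadratic factor is what makes the error of the difference quotient vanish when
  differentiating under the integral.\<close>

lemma norm_exp_diff_bound:
  fixes w :: complex
  shows "norm (exp w - 1 - w) \<le> (norm w)\<^sup>2 * exp (norm w)"
proof -
  have "norm (exp w - (\<Sum>k\<le>1. w ^ k / fact k)) \<le> exp \<bar>Re w\<bar> * (norm w) ^ Suc 1 / fact 1"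
    by (rule Taylor_exp)
  moreover have "exp \<bar>Re w\<bar> \<le> exp (norm w)" using abs_Re_le_cmod by simp
  ultimately have "norm (exp w - 1 - w) \<le> exp \<bar>Re w\<bar> * (norm w)\<^sup>2"
    by (simp add: algebra_simps power2_eq_square)
  also have "\<dots> \<le> exp (norm w) * (norm w)\<^sup>2"
    by (intro mult_right_mono) (use abs_Re_le_cmod in auto)
  finally show ?thesis by (simp add: mult.commute)
qed

text \<open>Since \<open>L\<close> is bounded, exponential and second-order remainder are dominated
  by multiples of \<open>norm (A x)\<close>, uniformly for small increments, so the derivative may
  be taken under the integral. It will be applied with \<open>L = phase\<close>.\<close>

lemma holomorphic_exp_integral:
  fixes A :: "'a \<Rightarrow> complex" and L :: "'a \<Rightarrow> real"
  assumes A: "integrable M A" and L[measurable]: "L \<in> borel_measurable M"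
    and LB: "\<And>x. x \<in> space M \<Longrightarrow> \<bar>L x\<bar> \<le> B"
  shows "(\<lambda>z. \<integral>x. exp (z * of_real (L x)) * A x \<partial>M) holomorphic_on UNIV"
    and "integrable M (\<lambda>x. exp (z * of_real (L x)) * A x)"
    and "norm (\<integral>x. exp (z * of_real (L x)) * A x \<partial>M) \<le> exp (\<bar>Re z\<bar> * B) * (\<integral>x. norm (A x) \<partial>M)"
proof -
  have Am[measurable]: "A \<in> borel_measurable M" using A by auto
  have bnd: "norm (exp (z * of_real (L x)) * w) \<le> exp (\<bar>Re z\<bar> * B) * norm w" if "x \<in> space M" for z x w
  proof -
    have "Re z * L x \<le> \<bar>Re z\<bar> * B"
      using mult_left_mono[OF LB[OF that], of "\<bar>Re z\<bar>"] abs_ge_self[of "Re z * L x"] by (simp add: abs_mult)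
    then show ?thesis by (simp add: norm_mult mult_right_mono)
  qed
  have int': "integrable M (\<lambda>x. exp (z * of_real (L x)) * A' x)" if A': "integrable M A'" for z and A' :: "'a \<Rightarrow> complex"
  proof (rule Bochner_Integration.integrable_bound[of M "\<lambda>x. exp (\<bar>Re z\<bar> * B) * norm (A' x)"])
    show "(\<lambda>x. exp (z * of_real (L x)) * A' x) \<in> borel_measurable M" using A' by measurable
  qed (use A' bnd in auto)
  note int = int'[OF A]
  show "integrable M (\<lambda>x. exp (z * of_real (L x)) * A x)" by (rule int)
  have intL: "integrable M (\<lambda>x. exp (z * of_real (L x)) * (of_real (L x) * A x))" for z
  proof (rule int', rule Bochner_Integration.integrable_bound[of M "\<lambda>x. B * norm (A x)"])
    show "AE x in M. norm (of_real (L x) * A x) \<le> norm (B * norm (A x))"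
    proof (rule AE_I2)
      fix x assume x: "x \<in> space M"
      have "norm (of_real (L x) * A x) \<le> B * norm (A x)"
        unfolding norm_mult using LB[OF x] by (intro mult_right_mono) auto
      then show "norm (of_real (L x) * A x) \<le> norm (B * norm (A x))" by simp
    qed
  qed (use A in auto)
  have "norm (\<integral>x. exp (z * of_real (L x)) * A x \<partial>M) \<le> (\<integral>x. norm (exp (z * of_real (L x)) * A x) \<partial>M)"
    by (rule integral_norm_bound)
  also have "\<dots> \<le> (\<integral>x. exp (\<bar>Re z\<bar> * B) * norm (A x) \<partial>M)"
    by (rule integral_mono) (use A int bnd in auto)
  finally show "norm (\<integral>x. exp (z * of_real (L x)) * A x \<partial>M) \<le> exp (\<bar>Re z\<bar> * B) * (\<integral>x. norm (A x) \<partial>M)" by simp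
  show "(\<lambda>z. \<integral>x. exp (z * of_real (L x)) * A x \<partial>M) holomorphic_on UNIV"
  proof (unfold holomorphic_on_def, intro ballI)
    fix z
    let ?F = "\<lambda>z. \<integral>x. exp (z * of_real (L x)) * A x \<partial>M"
    let ?D = "\<integral>x. exp (z * of_real (L x)) * (of_real (L x) * A x) \<partial>M"
    define K where "K = (\<integral>x. exp (\<bar>Re z\<bar> * B) * norm (A x) * (B\<^sup>2 * exp B) \<partial>M)"
    have est: "norm (?F (z + h) - ?F z - h * ?D) \<le> (norm h)\<^sup>2 * K" if h: "norm h \<le> 1" for h
    proof -
      have "?F (z + h) - ?F z - h * ?D
          = (\<integral>x. exp ((z + h) * of_real (L x)) * A x - exp (z * of_real (L x)) * A x
               - h * (exp (z * of_real (L x)) * (of_real (L x) * A x)) \<partial>M)"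
        by (simp add: int intL Bochner_Integration.integral_diff Bochner_Integration.integrable_diff)
      also have "\<dots> = (\<integral>x. (exp (z * of_real (L x)) * A x) * (exp (h * of_real (L x)) - 1 - h * of_real (L x)) \<partial>M)"
        by (rule Bochner_Integration.integral_cong) (auto simp: algebra_simps exp_add)
      also have "norm \<dots> \<le> (\<integral>x. (norm h)\<^sup>2 * (exp (\<bar>Re z\<bar> * B) * norm (A x) * (B\<^sup>2 * exp B)) \<partial>M)"
      proof (rule order_trans[OF integral_norm_bound], rule integral_mono)
        have "integrable M (\<lambda>x. (exp ((z + h) * of_real (L x)) * A x - exp (z * of_real (L x)) * A x
               - h * (exp (z * of_real (L x)) * (of_real (L x) * A x))))"
          by (intro Bochner_Integration.integrable_diff integrable_mult_right int intL)
        then have "integrable M (\<lambda>x. (exp (z * of_real (L x)) * A x) * (exp (h * of_real (L x)) - 1 - h * of_real (L x)))"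
          by (simp add: algebra_simps exp_add)
        then show "integrable M (\<lambda>x. norm ((exp (z * of_real (L x)) * A x) * (exp (h * of_real (L x)) - 1 - h * of_real (L x))))"
          by (rule integrable_norm)
        show "integrable M (\<lambda>x. (norm h)\<^sup>2 * (exp (\<bar>Re z\<bar> * B) * norm (A x) * (B\<^sup>2 * exp B)))"
          using A by auto
        fix x assume x: "x \<in> space M"
        let ?w = "h * of_real (L x)"
        have nw: "norm ?w = norm h * \<bar>L x\<bar>" by (simp add: norm_mult)
        have "norm ?w \<le> 1 * B" unfolding nw using LB[OF x] h by (intro mult_mono) auto
        moreover have "(norm ?w)\<^sup>2 \<le> (norm h)\<^sup>2 * B\<^sup>2"
          unfolding nw power_mult_distrib using LB[OF x] by (intro mult_left_mono power_mono) auto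
        ultimately have "(norm ?w)\<^sup>2 * exp (norm ?w) \<le> ((norm h)\<^sup>2 * B\<^sup>2) * exp B"
          by (intro mult_mono) auto
        with norm_exp_diff_bound[of ?w]
        have e: "norm (exp ?w - 1 - ?w) \<le> (norm h)\<^sup>2 * (B\<^sup>2 * exp B)" by (simp add: mult.assoc)
        have "norm ((exp (z * of_real (L x)) * A x) * (exp ?w - 1 - ?w))
           \<le> (exp (\<bar>Re z\<bar> * B) * norm (A x)) * ((norm h)\<^sup>2 * (B\<^sup>2 * exp B))"
          unfolding norm_mult[of "exp (z * of_real (L x)) * A x"]
          by (intro mult_mono bnd[OF x] e) auto
        then show "norm ((exp (z * of_real (L x)) * A x) * (exp ?w - 1 - ?w)) \<le>
            (norm h)\<^sup>2 * (exp (\<bar>Re z\<bar> * B) * norm (A x) * (B\<^sup>2 * exp B))"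
          by (simp add: algebra_simps)
      qed
      also have "\<dots> = (norm h)\<^sup>2 * K" by (simp add: K_def)
      finally show ?thesis .
    qed
    have "((\<lambda>h. (?F (z + h) - ?F z) / h - ?D) \<longlongrightarrow> 0) (at 0)"
    proof (rule Lim_null_comparison)
      show "eventually (\<lambda>h. norm ((?F (z + h) - ?F z) / h - ?D) \<le> norm h * K) (at 0)"
        unfolding eventually_at
      proof (intro exI[of _ 1] conjI ballI impI)
        fix h :: complex assume h: "h \<noteq> 0 \<and> dist h 0 < 1"
        then have "(?F (z + h) - ?F z) / h - ?D = (?F (z + h) - ?F z - h * ?D) / h"
          by (simp add: diff_divide_distrib)
        then have "norm ((?F (z + h) - ?F z) / h - ?D) = norm (?F (z + h) - ?F z - h * ?D) / norm h"
          by (simp add: norm_divide)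
        also have "\<dots> \<le> (norm h)\<^sup>2 * K / norm h"
          using est[of h] h by (intro divide_right_mono) auto
        also have "\<dots> = norm h * K" using h by (simp add: power2_eq_square)
        finally show "norm ((?F (z + h) - ?F z) / h - ?D) \<le> norm h * K" .
      qed simp
      show "((\<lambda>h::complex. norm h * K) \<longlongrightarrow> 0) (at 0)"
        by (intro tendsto_mult_left_zero tendsto_norm_zero tendsto_ident_at)
    qed
    then have "DERIV ?F z :> ?D"
      unfolding DERIV_def by (simp add: LIM_zero_iff)
    then show "?F field_differentiable at z within UNIV"
      by (auto simp: field_differentiable_def)
  qed
qed

section \<open>The Hardy--Littlewood--Sobolev inequality\<close>

lemma nn_integral_reflect:
  fixes f :: "real \<Rightarrow> ennreal"
  assumes [measurable]: "f \<in> borel_measurable borel"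
  shows "(\<integral>\<^sup>+ s. f (t - s) \<partial>lborel) = (\<integral>\<^sup>+ u. f u \<partial>lborel)"
  using nn_integral_real_affine[of f "-1" t] by simp

lemma nn_integral_abs_le:
  fixes f :: "real \<Rightarrow> ennreal"
  assumes [measurable]: "f \<in> borel_measurable borel"
  shows "(\<integral>\<^sup>+ u. f \<bar>u\<bar> \<partial>lborel) \<le> 2 * (\<integral>\<^sup>+ u. f u * indicator {0..} u \<partial>lborel)"
proof -
  have "(\<integral>\<^sup>+ u. f \<bar>u\<bar> \<partial>lborel) \<le> (\<integral>\<^sup>+ u. f u * indicator {0..} u + f (0 - u) * indicator {0..} (0 - u) \<partial>lborel)"
    by (intro nn_integral_mono) (auto simp: indicator_def abs_if not_less)
  also have "\<dots> = (\<integral>\<^sup>+ u. f u * indicator {0..} u \<partial>lborel) + (\<integral>\<^sup>+ u. f (0 - u) * indicator {0..} (0 - u) \<partial>lborel)"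
    by (intro nn_integral_add) auto
  also have "(\<integral>\<^sup>+ u. f (0 - u) * indicator {0..} (0 - u) \<partial>lborel) = (\<integral>\<^sup>+ u. f u * indicator {0..} u \<partial>lborel)"
    by (rule nn_integral_reflect[of "\<lambda>u. f u * indicator {0..} u"]) auto
  finally show ?thesis by (simp add: mult_2)
qed

text \<open>Truncating the singularity at \<open>d\<close> only lowers the integrand, so the bound
  does not see \<open>d\<close>. This is what makes the later estimates uniform in
  \<open>N\<close>.\<close>

lemma nn_integral_power_near:
  fixes b R :: real
  assumes b: "0 < b" "b < 1" and R: "0 < R" and d: "0 < d"
  shows "(\<integral>\<^sup>+ u. ennreal (max \<bar>u\<bar> d powr - b) * indicator {..R} \<bar>u\<bar> \<partial>lborel) \<le> ennreal (2 / (1 - b) * R powr (1 - b))"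
proof -
  have "(\<integral>\<^sup>+ u. ennreal (max \<bar>u\<bar> d powr - b) * indicator {..R} \<bar>u\<bar> \<partial>lborel)
     \<le> 2 * (\<integral>\<^sup>+ u. ennreal (max u d powr - b) * indicator {..R} u * indicator {0..} u \<partial>lborel)"
    by (rule nn_integral_abs_le) auto
  also have "(\<integral>\<^sup>+ u. ennreal (max u d powr - b) * indicator {..R} u * indicator {0..} u \<partial>lborel)
     \<le> (\<integral>\<^sup>+ u. ennreal (u powr - b) * indicator {0..R} u \<partial>lborel)"
  proof (rule nn_integral_mono_AE)
    \<comment> \<open>By convention \<open>0 powr - b = 0\<close>, so the comparison fails at
      \<open>u = 0\<close> and can be claimed only almost everywhere.\<close>
    show "AE u in lborel. ennreal (max u d powr - b) * indicator {..R} u * indicator {0..} u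
        \<le> ennreal (u powr - b) * indicator {0..R} u"
      using AE_lborel_singleton[of "0::real"]
    proof eventually_elim
      case (elim u)
      have "max u d powr - b \<le> u powr - b" if "u > 0"
        using that b by (intro powr_mono2') auto
      then show ?case using elim by (auto simp: indicator_def intro!: ennreal_leI)
    qed
  qed
  also have "\<dots> = ennreal (R powr (1 - b) / (1 - b))"
  proof -
    have "((\<lambda>x. x powr - b) has_integral (R powr (- b + 1) / (- b + 1))) {0..R}"
      using b R by (intro has_integral_powr_from_0) auto
    then show ?thesis
      by (subst nn_integral_has_integral_lebesgue'[of "{0..R}" "\<lambda>x. x powr - b"]) auto
  qed
  finally have "(\<integral>\<^sup>+ u. ennreal (max \<bar>u\<bar> d powr - b) * indicator {..R} \<bar>u\<bar> \<partial>lborel) \<le> 2 * ennreal (R powr (1 - b) / (1 - b))"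
    by (simp add: mult_left_mono)
  also have "\<dots> = ennreal (2 * (R powr (1 - b) / (1 - b)))" using b by (subst ennreal_mult) auto
  finally show ?thesis by simp
qed

lemma nn_integral_power_far:
  fixes R :: real
  assumes R: "0 < R"
  shows "(\<integral>\<^sup>+ u. ennreal (\<bar>u\<bar> powr - 2) * indicator {R<..} \<bar>u\<bar> \<partial>lborel) \<le> ennreal (2 / R)"
proof -
  have "(\<integral>\<^sup>+ u. ennreal (\<bar>u\<bar> powr - 2) * indicator {R<..} \<bar>u\<bar> \<partial>lborel)
     \<le> 2 * (\<integral>\<^sup>+ u. ennreal (u powr - 2) * indicator {R<..} u * indicator {0..} u \<partial>lborel)"
    by (rule nn_integral_abs_le) auto
  also have "(\<integral>\<^sup>+ u. ennreal (u powr - 2) * indicator {R<..} u * indicator {0..} u \<partial>lborel)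
     \<le> (\<integral>\<^sup>+ u. ennreal (u powr - 2) * indicator {R..} u \<partial>lborel)"
    by (intro nn_integral_mono) (auto simp: indicator_def)
  also have "\<dots> = ennreal (1 / R)"
  proof -
    have "((\<lambda>x. x powr - 2) has_integral (- (R powr (- 2 + 1)) / (- 2 + 1))) {R..}"
      using R by (intro has_integral_powr_to_inf) auto
    moreover have "- (R powr (- 2 + 1)) / (- 2 + 1) = 1 / R" using R by (simp add: powr_minus_divide)
    ultimately show ?thesis
      by (subst nn_integral_has_integral_lebesgue'[of "{R..}" "\<lambda>x. x powr - 2"]) auto
  qed
  finally show ?thesis using R by (simp add: ennreal_mult'[symmetric] mult_left_mono flip: ennreal_numeral)
qed

text \<open>By symmetry one may assume \<open>G s \<le> G t\<close>; the inner integral is then split at \<open>\<bar>t - s\<bar> = G t powr - r\<close>.\<close>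

lemma Hardy_Littlewood_Sobolev:
  fixes G :: "real \<Rightarrow> real" and b d :: real
  assumes b: "0 < b" "b < 1" and d: "0 < d"
    and G[measurable]: "G \<in> borel_measurable borel" and G0: "\<And>t. 0 \<le> G t"
    and G1: "(\<integral>\<^sup>+ t. ennreal (G t powr (2 / (2 - b))) \<partial>lborel) \<le> 1"
  shows "(\<integral>\<^sup>+ t. \<integral>\<^sup>+ s. ennreal (G t * G s * max \<bar>t - s\<bar> d powr - b) \<partial>lborel \<partial>lborel) \<le> ennreal (4 / (1 - b) + 6)"
proof -
  \<comment> \<open>The scaling exponent: \<open>2 / r + b = 2\<close>.\<close>
  define r where "r = 2 / (2 - b)"
  define k where "k u = max \<bar>u\<bar> d powr - b" for u
  \<comment> \<open>The near part contributes \<open>2 / (1 - b)\<close>, and the two terms of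
    Young's inequality in the far part contribute 1 and 2.\<close>
  define C where "C = 2 / (1 - b) + 3"
  have k[measurable]: "k \<in> borel_measurable borel" unfolding k_def by measurable
  have k0: "0 \<le> k u" and ksym: "k (-u) = k u" for u by (auto simp: k_def)
  have r: "1 < r" "r < 2" using b by (auto simp: r_def field_simps)
  have C: "0 < C" using b by (auto simp: C_def add_pos_pos)
  define H where "H t s = ennreal (G t * G s * k (t - s)) * indicator {s. G s \<le> G t} s" for t s
  have Hm[measurable]: "case_prod H \<in> borel_measurable (borel \<Otimes>\<^sub>M borel)"
    unfolding H_def by measurable
  have inner: "(\<integral>\<^sup>+ s. H t s \<partial>lborel) \<le> ennreal (C * G t powr r)" for t
  proof (cases "G t = 0")
    case True
    then show ?thesis by (simp add: H_def)
  next
    case False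
    define g where "g = G t"
    have g: "g > 0" using False G0[of t] by (auto simp: g_def)
    \<comment> \<open>This radius balances both regions: \<open>g * R powr (1 - b)\<close> and
      \<open>1 / (g * R)\<close> both equal \<open>g powr (r - 1)\<close>.\<close>
    define R where "R = g powr - r"
    have R: "R > 0" using g by (simp add: R_def)
    have near: "g * R powr (1 - b) = g powr (r - 1)"
    proof -
      have "g * R powr (1 - b) = g powr 1 * g powr ((- r) * (1 - b))"
        using g by (simp add: R_def powr_powr)
      also have "\<dots> = g powr (1 + (- r) * (1 - b))" by (simp only: powr_add)
      also have "1 + (- r) * (1 - b) = r - 1" using b by (simp add: r_def field_simps)
      finally show ?thesis .
    qed
    have pw: "G s * k (t - s) * indicator {s. G s \<le> g} s
        \<le> g * (k (t - s) * indicator {..R} \<bar>t - s\<bar>)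
          + (g powr (r - 1) * G s powr r + 1 / g * (\<bar>t - s\<bar> powr - 2 * indicator {R<..} \<bar>t - s\<bar>))" for s
    proof (cases "G s \<le> g")
      case le: True
      show ?thesis
      proof (cases "\<bar>t - s\<bar> \<le> R")
        case True
        have "G s * k (t - s) \<le> g * k (t - s)" using le k0 by (intro mult_right_mono) auto
        moreover have "0 \<le> g powr (r - 1) * G s powr r" by simp
        ultimately have "G s * k (t - s) \<le> g * k (t - s) + g powr (r - 1) * G s powr r" by linarith
        then show ?thesis using True le by (simp add: indicator_def)
      next
        case False
        \<comment> \<open>Weight for Young's inequality with the conjugate exponents
          \<open>r\<close> and \<open>2 / b\<close>. It satisfies
          \<open>a powr r = g powr (r - 1)\<close> and \<open>a powr (2 / b) = g\<close>, so the
          kernel term becomes \<open>\<bar>t - s\<bar> powr - 2 / g\<close>, which is integrable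
          beyond \<open>R\<close>.\<close>
        define a where "a = g powr ((r - 1) / r)"
        have a: "a > 0" using g by (simp add: a_def)
        have dist: "\<bar>t - s\<bar> > 0" using False R by linarith
        have kle: "k (t - s) \<le> \<bar>t - s\<bar> powr - b"
          unfolding k_def using dist b by (intro powr_mono2') auto
        define y where "y = \<bar>t - s\<bar> powr - b / a"
        have y0: "0 \<le> y" using a by (simp add: y_def)
        have "(a * G s) * y \<le> (a * G s) powr r / r + y powr (2 / b) / (2 / b)"
          using r b a G0[of s] y0 by (intro Youngs_inequality) (auto simp: r_def field_simps)
        also have "\<dots> \<le> (a * G s) powr r + y powr (2 / b)"
        proof -
          have "(a * G s) powr r / r \<le> (a * G s) powr r / 1" using r by (intro divide_left_mono) auto
          moreover have "y powr (2 / b) / (2 / b) \<le> y powr (2 / b) / 1"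
            using b by (intro divide_left_mono) (auto simp: field_simps)
          ultimately show ?thesis by simp
        qed
        also have "(a * G s) powr r = g powr (r - 1) * G s powr r"
          using a G0[of s] r g by (simp add: powr_mult a_def powr_powr)
        also have "y powr (2 / b) = 1 / g * \<bar>t - s\<bar> powr - 2"
        proof -
          have "(r - 1) / r * (2 / b) = 1" using b by (simp add: r_def field_simps)
          then have "a powr (2 / b) = g" using g by (simp only: a_def powr_powr) simp
          moreover have "(\<bar>t - s\<bar> powr - b) powr (2 / b) = \<bar>t - s\<bar> powr - 2" using b by (simp add: powr_powr)
          ultimately show ?thesis using a by (simp add: y_def powr_divide)
        qed
        finally have "(a * G s) * y \<le> g powr (r - 1) * G s powr r + 1 / g * \<bar>t - s\<bar> powr - 2" .
        moreover have "(a * G s) * y = G s * \<bar>t - s\<bar> powr - b" using a by (simp add: y_def)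
        moreover have "G s * k (t - s) \<le> G s * \<bar>t - s\<bar> powr - b" using kle G0 by (intro mult_left_mono) auto
        ultimately have "G s * k (t - s) \<le> g powr (r - 1) * G s powr r + 1 / g * \<bar>t - s\<bar> powr - 2" by linarith
        then show ?thesis using le False by (simp add: indicator_def)
      qed
    next
      case False
      then show ?thesis using g k0[of "t - s"] by (auto simp: indicator_def)
    qed
    have 1: "(\<integral>\<^sup>+ s. H t s \<partial>lborel) = (\<integral>\<^sup>+ s. ennreal g * ennreal (G s * k (t - s) * indicator {s. G s \<le> g} s) \<partial>lborel)"
      using g G0 k0 by (intro nn_integral_cong) (auto simp: H_def g_def indicator_def ennreal_mult'[symmetric] mult.assoc)
    have 2: "\<dots> = ennreal g * (\<integral>\<^sup>+ s. ennreal (G s * k (t - s) * indicator {s. G s \<le> g} s) \<partial>lborel)"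
      by (rule nn_integral_cmult) measurable
    have "(\<integral>\<^sup>+ s. ennreal (G s * k (t - s) * indicator {s. G s \<le> g} s) \<partial>lborel)
      \<le> (\<integral>\<^sup>+ s. ennreal g * (ennreal (k (t - s)) * indicator {..R} \<bar>t - s\<bar>)
         + (ennreal (g powr (r - 1)) * ennreal (G s powr r) + ennreal (1 / g) * (ennreal (\<bar>t - s\<bar> powr - 2) * indicator {R<..} \<bar>t - s\<bar>)) \<partial>lborel)"
    proof (rule nn_integral_mono)
      fix s
      have "ennreal (G s * k (t - s) * indicator {s. G s \<le> g} s) \<le> ennreal (g * (k (t - s) * indicator {..R} \<bar>t - s\<bar>)
          + (g powr (r - 1) * G s powr r + 1 / g * (\<bar>t - s\<bar> powr - 2 * indicator {R<..} \<bar>t - s\<bar>)))"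
        by (rule ennreal_leI[OF pw])
      also have "\<dots> = ennreal g * (ennreal (k (t - s)) * indicator {..R} \<bar>t - s\<bar>)
         + (ennreal (g powr (r - 1)) * ennreal (G s powr r) + ennreal (1 / g) * (ennreal (\<bar>t - s\<bar> powr - 2) * indicator {R<..} \<bar>t - s\<bar>))"
        using g k0[of "t - s"] by (cases "\<bar>t - s\<bar> \<le> R")
          (simp_all add: ennreal_mult'[symmetric] ennreal_plus[symmetric] del: ennreal_plus)
      finally show "ennreal (G s * k (t - s) * indicator {s. G s \<le> g} s) \<le> \<dots>" .
    qed
    also have "\<dots> = ennreal g * (\<integral>\<^sup>+ s. ennreal (k (t - s)) * indicator {..R} \<bar>t - s\<bar> \<partial>lborel)
       + (ennreal (g powr (r - 1)) * (\<integral>\<^sup>+ s. ennreal (G s powr r) \<partial>lborel)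
       + ennreal (1 / g) * (\<integral>\<^sup>+ s. ennreal (\<bar>t - s\<bar> powr - 2) * indicator {R<..} \<bar>t - s\<bar> \<partial>lborel))"
    proof -
      have [measurable]: "(\<lambda>s. ennreal (k (t - s)) * indicator {..R} \<bar>t - s\<bar>) \<in> borel_measurable borel"
        "(\<lambda>s. ennreal (\<bar>t - s\<bar> powr - 2) * indicator {R<..} \<bar>t - s\<bar>) \<in> borel_measurable borel"
        "(\<lambda>s. ennreal (G s powr r)) \<in> borel_measurable borel"
        by measurable
      show ?thesis
        by (simp add: nn_integral_add nn_integral_cmult)
    qed
    also have "\<dots> \<le> ennreal g * ennreal (2 / (1 - b) * R powr (1 - b)) + (ennreal (g powr (r - 1)) * 1 + ennreal (1 / g) * ennreal (2 / R))"
    proof -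
      have "(\<integral>\<^sup>+ s. ennreal (k (t - s)) * indicator {..R} \<bar>t - s\<bar> \<partial>lborel) \<le> ennreal (2 / (1 - b) * R powr (1 - b))"
        using nn_integral_power_near[OF b R d] nn_integral_reflect[of "\<lambda>u. ennreal (k u) * indicator {..R} \<bar>u\<bar>" t]
        by (simp add: k_def)
      moreover have "(\<integral>\<^sup>+ s. ennreal (\<bar>t - s\<bar> powr - 2) * indicator {R<..} \<bar>t - s\<bar> \<partial>lborel) \<le> ennreal (2 / R)"
        using nn_integral_power_far[OF R] nn_integral_reflect[of "\<lambda>u. ennreal (\<bar>u\<bar> powr - 2) * indicator {R<..} \<bar>u\<bar>" t]
        by simp
      ultimately show ?thesis using G1 by (intro add_mono mult_left_mono) (auto simp: r_def)
    qed
    also have "\<dots> = ennreal (C * g powr (r - 1))"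
    proof -
      have "1 / g * (2 / R) = 2 * g powr (r - 1)" using g by (simp add: R_def powr_minus powr_diff divide_simps)
      moreover have "g * (2 / (1 - b) * R powr (1 - b)) = 2 / (1 - b) * g powr (r - 1)" using near by simp
      ultimately show ?thesis using g b R
        by (simp add: ennreal_mult[symmetric] ennreal_plus[symmetric] C_def algebra_simps del: ennreal_plus)
    qed
    finally have "(\<integral>\<^sup>+ s. H t s \<partial>lborel) \<le> ennreal g * ennreal (C * g powr (r - 1))"
      unfolding 1 2 by (intro mult_left_mono) auto
    also have "\<dots> = ennreal (C * g powr r)"
      using g C by (simp add: ennreal_mult[symmetric] powr_diff)
    finally show ?thesis by (simp add: g_def)
  qed
  have half: "(\<integral>\<^sup>+ t. \<integral>\<^sup>+ s. H t s \<partial>lborel \<partial>lborel) \<le> ennreal C"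
  proof -
    have "(\<integral>\<^sup>+ t. \<integral>\<^sup>+ s. H t s \<partial>lborel \<partial>lborel) \<le> (\<integral>\<^sup>+ t. ennreal C * ennreal (G t powr r) \<partial>lborel)"
      using inner C by (intro nn_integral_mono) (simp add: ennreal_mult')
    also have "\<dots> = ennreal C * (\<integral>\<^sup>+ t. ennreal (G t powr r) \<partial>lborel)" by (rule nn_integral_cmult) measurable
    also have "\<dots> \<le> ennreal C * 1" using G1 by (intro mult_left_mono) (auto simp: r_def)
    finally show ?thesis by simp
  qed
  have "(\<integral>\<^sup>+ t. \<integral>\<^sup>+ s. ennreal (G t * G s * k (t - s)) \<partial>lborel \<partial>lborel)
      \<le> (\<integral>\<^sup>+ t. \<integral>\<^sup>+ s. H t s + H s t \<partial>lborel \<partial>lborel)"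
  proof (intro nn_integral_mono)
    fix t s
    have "k (s - t) = k (t - s)" using ksym[of "t - s"] by simp
    then show "ennreal (G t * G s * k (t - s)) \<le> H t s + H s t"
      by (cases "G s \<le> G t") (auto simp: H_def mult.commute indicator_def)
  qed
  also have "\<dots> = (\<integral>\<^sup>+ t. \<integral>\<^sup>+ s. H t s \<partial>lborel \<partial>lborel) + (\<integral>\<^sup>+ t. \<integral>\<^sup>+ s. H s t \<partial>lborel \<partial>lborel)"
    by (simp add: nn_integral_add)
  also have "(\<integral>\<^sup>+ t. \<integral>\<^sup>+ s. H s t \<partial>lborel \<partial>lborel) = (\<integral>\<^sup>+ t. \<integral>\<^sup>+ s. H t s \<partial>lborel \<partial>lborel)"
    by (rule lborel_pair.Fubini') simp
  also have "(\<integral>\<^sup>+ t. \<integral>\<^sup>+ s. H t s \<partial>lborel \<partial>lborel) + (\<integral>\<^sup>+ t. \<integral>\<^sup>+ s. H t s \<partial>lborel \<partial>lborel) \<le> ennreal C + ennreal C"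
    by (intro add_mono half)
  also have "\<dots> = ennreal (4 / (1 - b) + 6)" using C by (simp add: ennreal_plus[symmetric] C_def del: ennreal_plus)
  finally show ?thesis by (simp add: k_def)
qed

section \<open>The dispersive estimate\<close>

text \<open>Summation by parts: the total variation of an antitone \<open>c\<close> telescopes to at
  most \<open>2 * K\<close>, and each of the two boundary terms costs another
  \<open>K\<close>.\<close>

lemma norm_Abel_sum_antimono_le:
  fixes c :: "nat \<Rightarrow> real" and z :: "nat \<Rightarrow> complex"
  assumes z: "\<And>n. norm (z n) \<le> 1"
    and anti: "\<And>n. a \<le> n \<Longrightarrow> Suc n < b \<Longrightarrow> c (Suc n) \<le> c n"
    and K: "\<And>n. a \<le> n \<Longrightarrow> n < b \<Longrightarrow> \<bar>c n\<bar> \<le> K" and K0: "0 \<le> K"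
  shows "norm (\<Sum>n\<in>{a..<b}. c n * (z (Suc n) - z n)) \<le> 4 * K"
proof (cases "a < b")
  case True
  have "norm ((\<Sum>n\<in>{a..<Suc m}. c n * (z (Suc n) - z n)) - c m * z (Suc m)) \<le> \<bar>c a\<bar> + (c a - c m)"
    if "a \<le> m" "m < b" for m
    using that
  proof (induction m rule: nat_induct_at_least)
    case base
    then show ?case using z[of a]
      by (simp add: algebra_simps norm_mult mult_left_le)
  next
    case (Suc m)
    have "(\<Sum>n\<in>{a..<Suc (Suc m)}. c n * (z (Suc n) - z n)) - c (Suc m) * z (Suc (Suc m))
        = ((\<Sum>n\<in>{a..<Suc m}. c n * (z (Suc n) - z n)) - c m * z (Suc m)) + of_real (c m - c (Suc m)) * z (Suc m)"
      using Suc by (simp add: algebra_simps)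
    also have "norm \<dots> \<le> (\<bar>c a\<bar> + (c a - c m)) + (c m - c (Suc m)) * 1"
    proof (rule norm_triangle_mono)
      show "norm ((\<Sum>n\<in>{a..<Suc m}. c n * (z (Suc n) - z n)) - c m * z (Suc m)) \<le> \<bar>c a\<bar> + (c a - c m)"
        using Suc by simp
      have "norm (of_real (c m - c (Suc m)) * z (Suc m)) = (c m - c (Suc m)) * norm (z (Suc m))"
        using anti[of m] Suc by (simp add: norm_mult del: of_real_diff)
      also have "\<dots> \<le> (c m - c (Suc m)) * 1" using anti[of m] Suc z by (intro mult_left_mono) auto
      finally show "norm (of_real (c m - c (Suc m)) * z (Suc m)) \<le> (c m - c (Suc m)) * 1" .
    qed
    finally show ?case by simp
  qed
  from this[of "b - 1"] have 1: "norm ((\<Sum>n\<in>{a..<b}. c n * (z (Suc n) - z n)) - c (b - 1) * z b) \<le> \<bar>c a\<bar> + (c a - c (b - 1))"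
    using True by simp
  have 2: "norm (c (b - 1) * z b) \<le> K"
  proof -
    have "norm (c (b - 1) * z b) \<le> \<bar>c (b - 1)\<bar> * 1" unfolding norm_mult using z by (intro mult_mono) auto
    moreover have "\<bar>c (b - 1)\<bar> \<le> K" using True by (intro K) auto
    ultimately show ?thesis by linarith
  qed
  have 3: "norm (\<Sum>n\<in>{a..<b}. c n * (z (Suc n) - z n))
     \<le> norm ((\<Sum>n\<in>{a..<b}. c n * (z (Suc n) - z n)) - c (b - 1) * z b) + norm (c (b - 1) * z b)"
    using norm_triangle_ineq[of "(\<Sum>n\<in>{a..<b}. c n * (z (Suc n) - z n)) - c (b - 1) * z b" "c (b - 1) * z b"] by simp
  have "\<bar>c (b - 1)\<bar> \<le> K" "\<bar>c a\<bar> \<le> K" using True by (auto intro: K)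
  then show ?thesis using 1 2 3 by linarith
qed (use K0 in auto)

lemma sin_ge_half:
  fixes u :: real
  assumes "0 \<le> u" "u \<le> 1"
  shows "u / 2 \<le> sin u"
proof -
  have "\<bar>sin u - (\<Sum>m<3. sin_coeff m * u ^ m)\<bar> \<le> inverse (fact 3) * \<bar>u\<bar> ^ 3"
    by (rule Maclaurin_sin_bound)
  moreover have "(\<Sum>m<3. sin_coeff m * u ^ m) = u"
    by (simp add: numeral_3_eq_3 sin_coeff_def)
  moreover have "u ^ 3 \<le> u"
    using assms by (metis power_decreasing power_one_right one_le_numeral)
  ultimately have "\<bar>sin u - u\<bar> \<le> u ^ 3 / 6" "u ^ 3 \<le> u" using assms by (auto simp: fact_numeral)
  then show ?thesis using assms by linarith
qed

lemma cot_antimono: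
  fixes x y :: real
  assumes "0 < x" "x \<le> y" "y < pi"
  shows "cot y \<le> cot x"
proof -
  have s: "sin x > 0" "sin y > 0" using assms by (auto intro: sin_gt_zero)
  have "0 \<le> sin (y - x)" using assms by (intro sin_ge_zero) auto
  then have "cos y * sin x \<le> cos x * sin y" by (simp add: sin_diff mult.commute)
  then show ?thesis using s by (simp add: cot_def divide_simps mult.commute)
qed

text \<open>Monotonicity reduces the claim to the two ends of the interval, where the cotangents are
  opposite.\<close>

lemma abs_cot_half_le:
  fixes D \<delta> :: real
  assumes d: "0 < \<delta>" "\<delta> \<le> 1" and D: "\<delta> \<le> D" "D \<le> 2 * pi - \<delta>"
  shows "\<bar>cot (D / 2)\<bar> \<le> 4 / \<delta>"
proof -
  have s: "\<delta> / 4 \<le> sin (\<delta> / 2)" using sin_ge_half[of "\<delta> / 2"] d by simp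
  have "cot (\<delta> / 2) \<le> 1 / sin (\<delta> / 2)"
    using s d by (simp add: cot_def divide_right_mono)
  also have "\<dots> \<le> 1 / (\<delta> / 4)" using s d by (intro divide_left_mono) auto
  finally have c: "cot (\<delta> / 2) \<le> 4 / \<delta>" by simp
  have 1: "cot (D / 2) \<le> cot (\<delta> / 2)" using d D by (intro cot_antimono) auto
  have "cot (pi - \<delta> / 2) \<le> cot (D / 2)" using d D pi_gt_zero by (intro cot_antimono) (auto simp: field_simps)
  moreover have "cot (pi - \<delta> / 2) = - cot (\<delta> / 2)" by (simp add: cot_def)
  ultimately show ?thesis using 1 c by (simp add: abs_le_iff)
qed

text \<open>Abel summation based on \<open>1 / (cis D - 1) = - 1/2 - (\<i>/2) cot (D/2)\<close>, where the cotangents of the half increments are monotone.\<close>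

lemma Kuzmin_Landau:
  fixes \<phi> :: "nat \<Rightarrow> real"
  assumes mono: "\<And>n. \<phi> (Suc n) - \<phi> n \<le> \<phi> (Suc (Suc n)) - \<phi> (Suc n)"
    and d: "0 < \<delta>" "\<delta> \<le> 1"
    and lo: "\<And>n. a \<le> n \<Longrightarrow> n < b \<Longrightarrow> \<delta> \<le> \<phi> (Suc n) - \<phi> n"
    and hi: "\<And>n. a \<le> n \<Longrightarrow> n < b \<Longrightarrow> \<phi> (Suc n) - \<phi> n \<le> 2 * pi - \<delta>"
  shows "norm (\<Sum>n\<in>{a..<b}. cis (\<phi> n)) \<le> 1 + 8 / \<delta>"
proof (cases "a \<le> b")
  case ab: True
  define c where "c n = cot ((\<phi> (Suc n) - \<phi> n) / 2)" for n
  define z where "z n = cis (\<phi> n)" for n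
  have eq: "cis (\<phi> n) = - (1/2) * (z (Suc n) - z n) - (\<i> / 2) * (c n * (z (Suc n) - z n))" if "a \<le> n" "n < b" for n
  proof -
    define y where "y = (\<phi> (Suc n) - \<phi> n) / 2"
    have y: "0 < y" "y < pi" using lo[OF that] hi[OF that] d by (auto simp: y_def)
    then have s: "sin y > 0" by (intro sin_gt_zero)
    have "\<phi> (Suc n) = \<phi> n + 2 * y" by (simp add: y_def field_simps)
    then have zz: "z (Suc n) = z n * cis (2 * y)" by (simp add: z_def cis_mult)
    have "cis (2 * y) - 1 = cis y * (cis y - cis (- y))" by (simp add: right_diff_distrib cis_mult)
    also have "cis y - cis (- y) = 2 * \<i> * sin y" by (simp add: complex_eq_iff)
    finally have "cis (2 * y) - 1 = 2 * \<i> * sin y * cis y" by (simp add: mult.commute)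
    then have zd: "z (Suc n) - z n = z n * (2 * \<i> * sin y * cis y)" using zz by (metis mult.right_neutral right_diff_distrib)
    have "- (1/2) - (\<i> / 2) * c n = - (\<i> / 2) * (cos y - \<i> * sin y) / sin y"
      using s by (simp add: c_def y_def[symmetric] cot_def field_simps)
    also have "cos y - \<i> * sin y = cis (- y)" by (simp add: complex_eq_iff)
    finally have f: "- (1/2) - (\<i> / 2) * c n = - (\<i> / 2) * cis (- y) / sin y" .
    have cancel: "(- (\<i> / 2) * A / S) * (Z * (2 * \<i> * S * B)) = Z * (A * B)" if "S \<noteq> 0" for A B S Z :: complex
      using that by (simp add: field_simps)
    have "(- (1/2) - (\<i> / 2) * c n) * (z (Suc n) - z n) = z n * (cis (- y) * cis y)"
      unfolding zd f by (rule cancel) (use s in auto)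
    also have "cis (- y) * cis y = 1" by (simp add: cis_mult)
    finally show ?thesis unfolding z_def[symmetric] by (simp add: left_diff_distrib mult.assoc)
  qed
  have "(\<Sum>n\<in>{a..<b}. cis (\<phi> n)) = - (1/2) * (\<Sum>n\<in>{a..<b}. z (Suc n) - z n) - (\<i> / 2) * (\<Sum>n\<in>{a..<b}. c n * (z (Suc n) - z n))"
    unfolding sum_distrib_left sum_subtractf[symmetric] by (rule sum.cong) (use eq in auto)
  also have "(\<Sum>n\<in>{a..<b}. z (Suc n) - z n) = z b - z a" using ab by (rule sum_Suc_diff')
  also have "norm (- (1/2) * (z b - z a) - (\<i> / 2) * (\<Sum>n\<in>{a..<b}. c n * (z (Suc n) - z n)))
      \<le> 1 + 1/2 * (4 * (4 / \<delta>))"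
  proof (rule order_trans[OF norm_triangle_ineq4 add_mono])
    have "norm (z b - z a) \<le> 1 + 1" by (rule order_trans[OF norm_triangle_ineq4]) (simp add: z_def)
    then show "norm (- (1/2) * (z b - z a)) \<le> 1" by (simp add: norm_mult norm_divide)
    have "norm (\<Sum>n\<in>{a..<b}. c n * (z (Suc n) - z n)) \<le> 4 * (4 / \<delta>)"
    proof (rule norm_Abel_sum_antimono_le)
      fix n assume n: "a \<le> n" "Suc n < b"
      show "c (Suc n) \<le> c n" unfolding c_def
        using lo[of n] hi[of "Suc n"] mono[of n] n d by (intro cot_antimono) auto
    next
      fix n assume n: "a \<le> n" "n < b"
      show "\<bar>c n\<bar> \<le> 4 / \<delta>" unfolding c_def by (intro abs_cot_half_le d lo hi n)
    qed (use d in \<open>auto simp: z_def\<close>)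
    then show "norm ((\<i> / 2) * (\<Sum>n\<in>{a..<b}. c n * (z (Suc n) - z n))) \<le> 1/2 * (4 * (4 / \<delta>))"
      by (simp add: norm_mult norm_divide)
  qed
  finally show ?thesis by simp
qed (use d in auto)

lemma cis_add_2pi_int: "cis (x + 2 * pi * of_int k) = cis x"
  by (metis cis_mult cis_multiple_2pi Ints_of_int mult.right_neutral)

text \<open>Discrete second-derivative test. The increments rise by at least \<open>t\<close> per
  step, so few of them lie in \<open>[-\<delta>, \<delta>]\<close>; these terms are bounded
  trivially and the two outer blocks by \<open>Kuzmin_Landau\<close>. The window from
  \<open>- 5\<close> to \<open>2 * pi - 2\<close> keeps all increments away from every nonzero
  multiple of \<open>2 * pi\<close>.\<close>

lemma convex_phase_sum_bound_aux:
  fixes \<phi> :: "nat \<Rightarrow> real"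
  assumes t: "0 < t" "t \<le> 1"
    and inc: "\<And>n. \<phi> (Suc n) - \<phi> n + t \<le> \<phi> (Suc (Suc n)) - \<phi> (Suc n)"
    and range: "\<And>n. n < N \<Longrightarrow> \<phi> (Suc n) - \<phi> n \<le> \<phi> 1 - \<phi> 0 + 3"
    and start: "- 5 \<le> \<phi> 1 - \<phi> 0" "\<phi> 1 - \<phi> 0 \<le> - 5 + 2 * pi"
  shows "norm (\<Sum>n<N. cis (\<phi> n)) \<le> 21 / sqrt t"
proof -
  define D where "D n = \<phi> (Suc n) - \<phi> n" for n
  \<comment> \<open>Balances the \<open>2 * \<delta> / t + 1\<close> middle terms against the outer
    bounds \<open>1 + 8 / \<delta>\<close>. The total is \<open>3 + 18 / \<delta>\<close>, and
    \<open>\<delta> \<le> 1\<close> turns it into \<open>21 / \<delta>\<close>.\<close>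
  define \<delta> where "\<delta> = sqrt t"
  have d: "0 < \<delta>" "\<delta> \<le> 1" using t by (auto simp: \<delta>_def)
  have Dinc: "D n + t \<le> D (Suc n)" for n using inc by (simp add: D_def)
  have Dgap: "D n + real k * t \<le> D (n + k)" for n k
  proof (induction k)
    case (Suc k)
    then show ?case using Dinc[of "n + k"] by (simp add: algebra_simps)
  qed simp
  have Dmono: "D m \<le> D n" if "m \<le> n" for m n
    using Dgap[of m "n - m"] that t by (smt (verit) le_add_diff_inverse mult_nonneg_nonneg of_nat_0_le_iff)
  have bounds: "- 5 \<le> D n" "D n \<le> 2 * pi - 2" if "n < N" for n
    using Dmono[of 0 n] start range[OF that] by (auto simp: D_def)
  \<comment> \<open>The alternative \<open>n = N\<close> is the default when no increment crosses
    the threshold; blocks may then be empty.\<close>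
  define m1 where "m1 = (LEAST n. n = N \<or> - \<delta> \<le> D n)"
  define m2 where "m2 = (LEAST n. n = N \<or> \<delta> < D n)"
  have m1: "m1 = N \<or> - \<delta> \<le> D m1" "m1 \<le> N" "\<And>n. n < m1 \<Longrightarrow> D n < - \<delta>"
    unfolding m1_def by (rule LeastI[of _ N], simp) (auto intro: Least_le dest: not_less_Least)
  have m2: "m2 = N \<or> \<delta> < D m2" "m2 \<le> N" "\<And>n. n < m2 \<Longrightarrow> D n \<le> \<delta>"
    unfolding m2_def by (rule LeastI[of _ N], simp) (auto intro: Least_le dest: not_less_Least)
  have m12: "m1 \<le> m2"
  proof (rule ccontr)
    assume "\<not> m1 \<le> m2"
    then have "m2 < m1" "m2 \<noteq> N" using m1(2) by auto
    then show False using m1(3)[of m2] m2(1) d by auto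
  qed
  have A: "norm (\<Sum>n\<in>{0..<m1}. cis (\<phi> n)) \<le> 1 + 8 / \<delta>"
  proof -
    \<comment> \<open>Adding \<open>2 * pi * n\<close> leaves every term unchanged and moves the
      negative increments into \<open>[\<delta>, 2 * pi - \<delta>]\<close>. The lower end uses
      \<open>2 * pi - 5 \<ge> 1 \<ge> \<delta>\<close>.\<close>
    define \<psi> where "\<psi> n = \<phi> n + 2 * pi * real n" for n
    have psiD: "\<psi> (Suc n) - \<psi> n = D n + 2 * pi" for n by (simp add: \<psi>_def D_def algebra_simps)
    have "norm (\<Sum>n\<in>{0..<m1}. cis (\<psi> n)) \<le> 1 + 8 / \<delta>"
    proof (rule Kuzmin_Landau)
      fix n
      show "\<psi> (Suc n) - \<psi> n \<le> \<psi> (Suc (Suc n)) - \<psi> (Suc n)" unfolding psiD using Dmono[of n "Suc n"] by simp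
      assume n: "0 \<le> n" "n < m1"
      show "\<psi> (Suc n) - \<psi> n \<le> 2 * pi - \<delta>" unfolding psiD using m1(3)[OF n(2)] by simp
      show "\<delta> \<le> \<psi> (Suc n) - \<psi> n" unfolding psiD using bounds[of n] n m1(2) d pi_gt3 by simp
    qed (use d in auto)
    moreover have "cis (\<psi> n) = cis (\<phi> n)" for n
      using cis_add_2pi_int[of "\<phi> n" "int n"] by (simp add: \<psi>_def)
    ultimately show ?thesis by simp
  qed
  have C: "norm (\<Sum>n\<in>{m2..<N}. cis (\<phi> n)) \<le> 1 + 8 / \<delta>"
  proof (rule Kuzmin_Landau)
    fix n
    show "\<phi> (Suc n) - \<phi> n \<le> \<phi> (Suc (Suc n)) - \<phi> (Suc n)" using Dmono[of n "Suc n"] by (simp add: D_def)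
    assume n: "m2 \<le> n" "n < N"
    then show "\<phi> (Suc n) - \<phi> n \<le> 2 * pi - \<delta>" using bounds[of n] d by (simp add: D_def)
    show "\<delta> \<le> \<phi> (Suc n) - \<phi> n" using Dmono[OF n(1)] m2(1) n by (auto simp: D_def)
  qed (use d in auto)
  have B: "norm (\<Sum>n\<in>{m1..<m2}. cis (\<phi> n)) \<le> 2 * \<delta> / t + 1"
  proof (cases "m1 < m2")
    case True
    then have "m1 \<noteq> N" using m2(2) by auto
    then have "- \<delta> + real (m2 - 1 - m1) * t \<le> \<delta>"
      using Dgap[of m1 "m2 - 1 - m1"] m1(1) m2(3)[of "m2 - 1"] True by auto
    then have "real (m2 - 1 - m1) \<le> 2 * \<delta> / t" using t by (simp add: field_simps)
    moreover have "real (m2 - m1) = real (m2 - 1 - m1) + 1" using True by simp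
    moreover have "norm (\<Sum>n\<in>{m1..<m2}. cis (\<phi> n)) \<le> (\<Sum>n\<in>{m1..<m2}. 1)"
      by (rule order_trans[OF norm_sum]) simp
    ultimately show ?thesis by simp
  qed (use d t in auto)
  have "(\<Sum>n<N. cis (\<phi> n)) = (\<Sum>n\<in>{0..<m1}. cis (\<phi> n)) + ((\<Sum>n\<in>{m1..<m2}. cis (\<phi> n)) + (\<Sum>n\<in>{m2..<N}. cis (\<phi> n)))"
    using m12 m2(2) by (simp add: sum.atLeastLessThan_concat lessThan_atLeast0)
  also have "norm \<dots> \<le> (1 + 8 / \<delta>) + ((2 * \<delta> / t + 1) + (1 + 8 / \<delta>))"
    by (intro order_trans[OF norm_triangle_ineq] add_mono A B C)
  also have "2 * \<delta> / t = 2 / \<delta>" 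
  proof -
    have "t = \<delta> * \<delta>" using t by (simp add: \<delta>_def)
    then show ?thesis using d by simp
  qed
  also have "(1 + 8 / \<delta>) + ((2 / \<delta> + 1) + (1 + 8 / \<delta>)) = 3 * 1 + 18 / \<delta>" by simp
  also have "\<dots> \<le> 3 * (1 / \<delta>) + 18 / \<delta>" using d by (intro add_mono mult_left_mono) auto
  finally show ?thesis by (simp add: \<delta>_def)
qed

text \<open>Subtracting \<open>2 * pi * k * n\<close> from the phase changes no term;
  \<open>k\<close> is chosen to bring the first increment into the window of length
  \<open>2 * pi\<close> that starts at \<open>- 5\<close>.\<close>

lemma convex_phase_sum_bound:
  fixes \<phi> :: "nat \<Rightarrow> real"
  assumes t: "0 < t" "t \<le> 1"
    and inc: "\<And>n. \<phi> (Suc n) - \<phi> n + t \<le> \<phi> (Suc (Suc n)) - \<phi> (Suc n)"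
    and range: "\<And>n. n < N \<Longrightarrow> \<phi> (Suc n) - \<phi> n \<le> \<phi> 1 - \<phi> 0 + 3"
  shows "norm (\<Sum>n<N. cis (\<phi> n)) \<le> 21 / sqrt t"
proof -
  define k where "k = \<lfloor>(\<phi> 1 - \<phi> 0 + 5) / (2 * pi)\<rfloor>"
  have k: "2 * pi * of_int k \<le> \<phi> 1 - \<phi> 0 + 5" "\<phi> 1 - \<phi> 0 + 5 \<le> 2 * pi * (of_int k + 1)"
  proof -
    define w where "w = (\<phi> 1 - \<phi> 0 + 5) / (2 * pi)"
    have w: "of_int k \<le> w" "w \<le> of_int k + 1" using floor_correct[of w] by (auto simp: k_def w_def)
    have e: "\<phi> 1 - \<phi> 0 + 5 = 2 * pi * w" by (simp add: w_def)
    show "2 * pi * of_int k \<le> \<phi> 1 - \<phi> 0 + 5" "\<phi> 1 - \<phi> 0 + 5 \<le> 2 * pi * (of_int k + 1)"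
      unfolding e using w by (auto intro!: mult_left_mono)
  qed
  define \<psi> where "\<psi> n = \<phi> n + 2 * pi * of_int (- k * int n)" for n
  have "norm (\<Sum>n<N. cis (\<psi> n)) \<le> 21 / sqrt t"
    by (rule convex_phase_sum_bound_aux[OF t]) (use inc range k in \<open>auto simp: \<psi>_def algebra_simps\<close>)
  then show ?thesis unfolding \<psi>_def cis_add_2pi_int .
qed

section \<open>The dispersion relation and the convolution kernel\<close>

definition dispersion :: "int \<Rightarrow> real" where
  "dispersion n = sqrt (of_int n ^ 2 + of_int n ^ 4)"

lemma dispersion_minus: "dispersion (- n) = dispersion n"
  by (simp add: dispersion_def)

text \<open>The square of \<open>n^2 + 1/2\<close> exceeds \<open>n^2 + n^4\<close> by exactly
  1/4.\<close>

lemma dispersion_bounds: "of_int n ^ 2 \<le> dispersion n" "dispersion n \<le> of_int n ^ 2 + 1/2"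
proof -
  show "of_int n ^ 2 \<le> dispersion n" unfolding dispersion_def
    by (rule real_le_rsqrt) simp
  show "dispersion n \<le> of_int n ^ 2 + 1/2" unfolding dispersion_def
    by (rule real_le_lsqrt) (auto simp: power2_eq_square power4_eq_xxxx algebra_simps)
qed

text \<open>The second difference of \<open>n^2\<close> is 2, and the deviation of the dispersion
  from \<open>n^2\<close> takes away at most 1, which leaves convexity at least \<open>t\<close>.
  The total growth of the increments is at most \<open>2 * N * t \<le> 2\<close>, and only here is
  the shortness of the time used.\<close>

lemma half_kernel_bound:
  fixes x t :: real
  assumes N: "1 \<le> N" and t: "0 < t" "t * real N \<le> 1"
  shows "norm (\<Sum>n<N. cis (x * real n + t * dispersion (int n))) \<le> 21 / sqrt t"
proof (rule convex_phase_sum_bound)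
  show t1: "t \<le> 1" using mult_left_mono[of 1 "real N" t] N t by linarith
  note b = dispersion_bounds
  show "x * real (Suc n) + t * dispersion (int (Suc n)) - (x * real n + t * dispersion (int n)) + t
    \<le> x * real (Suc (Suc n)) + t * dispersion (int (Suc (Suc n))) - (x * real (Suc n) + t * dispersion (int (Suc n)))" for n
  proof -
    have "1 \<le> dispersion (int (Suc (Suc n))) - 2 * dispersion (int (Suc n)) + dispersion (int n)"
      using b(1)[of "int (Suc (Suc n))"] b(2)[of "int (Suc n)"] b(1)[of "int n"]
      by (simp add: power2_eq_square algebra_simps)
    then have "t * 1 \<le> t * (dispersion (int (Suc (Suc n))) - 2 * dispersion (int (Suc n)) + dispersion (int n))"
      using t by (intro mult_left_mono) auto
    then show ?thesis by (simp add: algebra_simps)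
  qed
  show "x * real (Suc n) + t * dispersion (int (Suc n)) - (x * real n + t * dispersion (int n))
    \<le> x * real 1 + t * dispersion (int 1) - (x * real 0 + t * dispersion (int 0)) + 3" if n: "n < N" for n
  proof -
    have "dispersion (int (Suc n)) - dispersion (int n) - (dispersion 1 - dispersion 0) \<le> 2 * real N"
      using b(2)[of "int (Suc n)"] b(1)[of "int n"] b(1)[of 1] b(2)[of 0] n
      by (simp add: power2_eq_square algebra_simps)
    then have "t * (dispersion (int (Suc n)) - dispersion (int n) - (dispersion 1 - dispersion 0)) \<le> t * (2 * real N)"
      using t by (intro mult_left_mono) auto
    then show ?thesis using t by (simp add: algebra_simps)
  qed
qed (use t in auto)

definition kernel :: "nat \<Rightarrow> real \<Rightarrow> real \<Rightarrow> complex" where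
  "kernel N t x = (\<Sum>n\<in>{- int N..int N}. cis (x * of_int n + t * dispersion n))"

lemma norm_kernel_le: "norm (kernel N t x) \<le> 2 * real N + 1"
proof -
  have "norm (kernel N t x) \<le> (\<Sum>n\<in>{- int N..int N}. 1)"
    unfolding kernel_def by (rule order_trans[OF norm_sum]) simp
  then show ?thesis by simp
qed

lemma kernel_uminus: "kernel N (- t) x = cnj (kernel N t (- x))"
  unfolding kernel_def cnj_sum by (rule sum.cong) (auto simp: cis_cnj)

lemma sum_int_symmetric:
  fixes f :: "int \<Rightarrow> complex"
  shows "(\<Sum>n\<in>{- int N..int N}. f n) + f 0 = (\<Sum>n<Suc N. f (int n)) + (\<Sum>n<Suc N. f (- int n))"
proof (induction N)
  case (Suc N)
  have "{- int (Suc N)..int (Suc N)} = insert (- int (Suc N)) (insert (int (Suc N)) {- int N..int N})" by auto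
  then have "(\<Sum>n\<in>{- int (Suc N)..int (Suc N)}. f n) = f (- int (Suc N)) + (f (int (Suc N)) + (\<Sum>n\<in>{- int N..int N}. f n))"
    by (simp del: of_nat_Suc)
  then show ?case using Suc by (simp add: algebra_simps)
qed simp

text \<open>The dispersion is even, so the negative frequencies are a half sum at
  \<open>- x\<close>. The constant is 21 + 21 for the half sums over \<open>n < N\<close> plus 3 for
  what they miss or count twice, the frequencies \<open>N\<close>, \<open>- N\<close> and 0,
  absorbed because the time is at most 1.\<close>

lemma dispersive_estimate:
  assumes N: "1 \<le> N" and t: "t \<noteq> 0" "\<bar>t\<bar> * real N \<le> 1"
  shows "norm (kernel N t x) \<le> 45 / sqrt \<bar>t\<bar>"
proof -
  have pos: "norm (kernel N t x) \<le> 45 / sqrt t" if t: "0 < t" "t * real N \<le> 1" for t x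
  proof -
    have t1: "t \<le> 1" using mult_left_mono[of 1 "real N" t] N t by linarith
    let ?f = "\<lambda>n. cis (x * of_int n + t * dispersion n)"
    have "kernel N t x = (\<Sum>n<N. ?f (int n)) + (\<Sum>n<N. ?f (- int n)) + (?f (int N) + ?f (- int N) - ?f 0)"
      using sum_int_symmetric[of ?f N] by (simp add: kernel_def algebra_simps)
    also have "norm \<dots> \<le> (21 / sqrt t + 21 / sqrt t) + 3"
    proof (intro order_trans[OF norm_triangle_ineq] add_mono)
      show "norm (\<Sum>n<N. ?f (int n)) \<le> 21 / sqrt t" using half_kernel_bound[OF N t, of x] by simp
      show "norm (\<Sum>n<N. ?f (- int n)) \<le> 21 / sqrt t" using half_kernel_bound[OF N t, of "- x"] by (simp add: dispersion_minus)
      show "norm (?f (int N) + ?f (- int N) - ?f 0) \<le> 3"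
        by (rule order_trans[OF norm_triangle_ineq4], rule order_trans[OF add_right_mono[OF norm_triangle_ineq]]) simp
    qed
    also have "3 \<le> 3 / sqrt t" using t t1 by (simp add: field_simps)
    finally show ?thesis by simp
  qed
  show ?thesis
  proof (cases "t > 0")
    case True
    then show ?thesis using pos[of t x] t by simp
  next
    case False
    then have "norm (kernel N (- t) (- x)) \<le> 45 / sqrt (- t)" using pos[of "- t" "- x"] t by simp
    then show ?thesis using False by (simp add: kernel_uminus)
  qed
qed

section \<open>The spectral theorem for Hermitian matrices\<close>

text \<open>Vectors are plain functions of which only the values on \<open>S\<close> matter, so the
  dimension \<open>2 * N + 1\<close> needs no type of its own.\<close>

definition ip :: "'i set \<Rightarrow> ('i \<Rightarrow> complex) \<Rightarrow> ('i \<Rightarrow> complex) \<Rightarrow> complex" where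
  "ip S u v = (\<Sum>n\<in>S. u n * cnj (v n))"

definition mat_app :: "'i set \<Rightarrow> ('i \<Rightarrow> 'i \<Rightarrow> complex) \<Rightarrow> ('i \<Rightarrow> complex) \<Rightarrow> 'i \<Rightarrow> complex" where
  "mat_app S g u n = (\<Sum>m\<in>S. g n m * u m)"

lemma ip_add_left: "ip S (\<lambda>n. u n + v n) w = ip S u w + ip S v w"
  by (simp add: ip_def algebra_simps sum.distrib)

lemma ip_diff_left: "ip S (\<lambda>n. u n - v n) w = ip S u w - ip S v w"
  by (simp add: ip_def algebra_simps sum_subtractf)

lemma ip_add_right: "ip S w (\<lambda>n. u n + v n) = ip S w u + ip S w v"
  by (simp add: ip_def algebra_simps sum.distrib)

lemma ip_scale_left: "ip S (\<lambda>n. c * u n) w = c * ip S u w"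
  by (simp add: ip_def sum_distrib_left mult.assoc)

lemma ip_scale_right: "ip S w (\<lambda>n. c * u n) = cnj c * ip S w u"
  by (simp add: ip_def sum_distrib_left algebra_simps)

lemma ip_sum_left: "ip S (\<lambda>n. \<Sum>k\<in>K. v k n) w = (\<Sum>k\<in>K. ip S (v k) w)"
  unfolding ip_def sum_distrib_right by (rule sum.swap)

lemma ip_cnj: "cnj (ip S u v) = ip S v u"
  by (simp add: ip_def mult.commute)

lemma ip_self: "ip S u u = of_real (\<Sum>n\<in>S. (norm (u n))\<^sup>2)"
  by (simp add: ip_def complex_norm_square[symmetric])

lemma ip_self_eq_0: "finite S \<Longrightarrow> ip S u u = 0 \<Longrightarrow> n \<in> S \<Longrightarrow> u n = 0"
  unfolding ip_self of_real_eq_0_iff by (subst (asm) sum_nonneg_eq_0_iff) auto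

lemma mat_app_add: "mat_app S g (\<lambda>n. u n + v n) = (\<lambda>n. mat_app S g u n + mat_app S g v n)"
  by (simp add: mat_app_def fun_eq_iff algebra_simps sum.distrib)

lemma mat_app_scale: "mat_app S g (\<lambda>n. c * u n) = (\<lambda>n. c * mat_app S g u n)"
  by (simp add: mat_app_def fun_eq_iff sum_distrib_left algebra_simps)

lemma ip_mat_app_hermitian:
  assumes "\<And>n m. n \<in> S \<Longrightarrow> m \<in> S \<Longrightarrow> g m n = cnj (g n m)"
  shows "ip S (mat_app S g u) v = ip S u (mat_app S g v)"
proof -
  have "ip S (mat_app S g u) v = (\<Sum>n\<in>S. \<Sum>m\<in>S. g n m * u m * cnj (v n))"
    by (simp add: ip_def mat_app_def sum_distrib_right)
  also have "\<dots> = (\<Sum>m\<in>S. \<Sum>n\<in>S. g n m * u m * cnj (v n))" by (rule sum.swap)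
  also have "\<dots> = (\<Sum>m\<in>S. \<Sum>n\<in>S. u m * (cnj (g m n) * cnj (v n)))"
    by (intro sum.cong refl) (simp add: assms[symmetric])
  also have "\<dots> = ip S u (mat_app S g v)" by (simp add: ip_def mat_app_def sum_distrib_left)
  finally show ?thesis .
qed

lemma continuous_on_ip [continuous_intros]:
  fixes F G :: "'a::topological_space \<Rightarrow> 'i \<Rightarrow> complex"
  assumes "\<And>n. n \<in> S \<Longrightarrow> continuous_on A (\<lambda>x. F x n)" "\<And>n. n \<in> S \<Longrightarrow> continuous_on A (\<lambda>x. G x n)"
  shows "continuous_on A (\<lambda>x. ip S (F x) (G x))"
  unfolding ip_def by (intro continuous_intros assms)

text \<open>Fixing the coordinates outside \<open>S\<close> to 0 makes the set a closed part of a
  product of compact discs and points, so Tychonoff's theorem applies in the function space.\<close>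

lemma compact_unit_sphere_orthogonal:
  fixes S :: "'i set" and e :: "nat \<Rightarrow> 'i \<Rightarrow> complex"
  assumes S: "finite S"
  shows "compact {u. (\<forall>n. n \<notin> S \<longrightarrow> u n = 0) \<and> ip S u u = 1 \<and> (\<forall>k<K. ip S u (e k) = 0)}" (is "compact ?C")
proof -
  define B where "B = (PiE UNIV (\<lambda>i. if i \<in> S then cball 0 1 else {0 :: complex}))"
  have "compactin (product_topology (\<lambda>i. euclidean) UNIV) B"
    unfolding B_def by (subst compactin_PiE) auto
  then have B: "compact B" by (simp add: euclidean_product_topology)
  have coord: "continuous_on UNIV (\<lambda>u::'i \<Rightarrow> complex. u n)" for n
    by (rule continuous_on_product_coordinates)
  have cl: "closed ({u. ip S u u = 1} \<inter> (\<Inter>k\<in>{..<K}. {u. ip S u (e k) = 0}))"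
    by (intro closed_Int closed_INT closed_Collect_eq continuous_intros coord ballI)
  have "?C = B \<inter> ({u. ip S u u = 1} \<inter> (\<Inter>k\<in>{..<K}. {u. ip S u (e k) = 0}))" (is "_ = ?D")
  proof
    show "?D \<subseteq> ?C" by (auto simp: B_def PiE_iff split: if_splits)
    show "?C \<subseteq> ?D"
    proof
      fix u assume u: "u \<in> ?C"
      have "cmod (u n) \<le> 1" if "n \<in> S" for n
      proof -
        have "complex_of_real (\<Sum>n\<in>S. (norm (u n))\<^sup>2) = complex_of_real 1" using u by (simp add: ip_self)
        then have "(\<Sum>n\<in>S. (norm (u n))\<^sup>2) = 1" by (simp only: of_real_eq_iff)
        moreover have "(norm (u n))\<^sup>2 \<le> (\<Sum>n\<in>S. (norm (u n))\<^sup>2)"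
          using S that by (intro member_le_sum) auto
        ultimately have "(norm (u n))\<^sup>2 \<le> 1\<^sup>2" by simp
        then show ?thesis by (rule power2_le_imp_le) simp
      qed
      then show "u \<in> ?D" using u by (auto simp: B_def PiE_iff)
    qed
  qed
  then show ?thesis using compact_Int_closed[OF B cl] by simp
qed

text \<open>A maximiser of the Rayleigh quotient on the unit sphere orthogonal to the eigenvectors found so far is again an eigenvector.\<close>

lemma hermitian_next_eigenvector:
  fixes S :: "'i set" and g :: "'i \<Rightarrow> 'i \<Rightarrow> complex" and e :: "nat \<Rightarrow> 'i \<Rightarrow> complex" and \<mu> :: "nat \<Rightarrow> real"
  assumes S: "finite S"
    and herm: "\<And>n m. n \<in> S \<Longrightarrow> m \<in> S \<Longrightarrow> g m n = cnj (g n m)"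
    and eig: "\<And>k n. k < K \<Longrightarrow> n \<in> S \<Longrightarrow> mat_app S g (e k) n = \<mu> k * e k n"
    and h: "\<And>k. k < K \<Longrightarrow> ip S h (e k) = 0" and hn: "n0 \<in> S" "h n0 \<noteq> 0"
  shows "\<exists>v \<nu>. ip S v v = 1 \<and> (\<forall>k<K. ip S v (e k) = 0) \<and> (\<forall>n\<in>S. mat_app S g v n = of_real \<nu> * v n)"
proof -
  define C where "C = {u. (\<forall>n. n \<notin> S \<longrightarrow> u n = 0) \<and> ip S u u = 1 \<and> (\<forall>k<K. ip S u (e k) = 0)}"
  define R where "R u = Re (ip S (mat_app S g u) u)" for u
  have normal: "\<exists>c>0. (\<lambda>n. of_real c * (if n \<in> S then u n else 0)) \<in> C \<and> c\<^sup>2 * Re (ip S u u) = 1"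
    if u: "\<And>k. k < K \<Longrightarrow> ip S u (e k) = 0" and n: "n \<in> S" "u n \<noteq> 0" for u n
  proof -
    define s where "s = (\<Sum>n\<in>S. (norm (u n))\<^sup>2)"
    have "s > 0" unfolding s_def using S n by (intro sum_pos2[of _ n]) auto
    define c where "c = 1 / sqrt s"
    have c: "c > 0" and s: "c\<^sup>2 * s = 1" using \<open>s > 0\<close> by (auto simp: c_def power_divide)
    have uu: "ip S u u = of_real s" by (simp add: ip_self s_def)
    have res: "ip S (\<lambda>n. if n \<in> S then u n else 0) v = ip S u v" "ip S v (\<lambda>n. if n \<in> S then u n else 0) = ip S v u" for v
      by (auto simp: ip_def intro: sum.cong)
    show ?thesis
    proof (intro exI[of _ c] conjI c)
      have "ip S (\<lambda>n. of_real c * (if n \<in> S then u n else 0)) (\<lambda>n. of_real c * (if n \<in> S then u n else 0)) = of_real (c\<^sup>2 * s)"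
        unfolding ip_scale_left ip_scale_right res uu
        by (simp only: complex_cnj_complex_of_real power2_eq_square of_real_mult mult.assoc)
      then show "(\<lambda>n. of_real c * (if n \<in> S then u n else 0)) \<in> C"
        unfolding C_def s by (simp add: ip_scale_left res u)
      show "c\<^sup>2 * Re (ip S u u) = 1" using s uu by simp
    qed
  qed
  have "C \<noteq> {}" using normal[OF h hn] by auto
  moreover have "compact C" unfolding C_def by (rule compact_unit_sphere_orthogonal[OF S])
  moreover have "continuous_on C R"
    unfolding R_def mat_app_def
    by (intro continuous_intros continuous_on_subset[OF continuous_on_product_coordinates]) auto
  ultimately obtain v where v: "v \<in> C" and max: "\<And>u. u \<in> C \<Longrightarrow> R u \<le> R v"
    using continuous_attains_sup[of C R] by blast
  define \<nu> where "\<nu> = R v"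
  have v1: "ip S v v = 1" and vo: "\<And>k. k < K \<Longrightarrow> ip S v (e k) = 0" using v by (auto simp: C_def)
  have Rle: "R u \<le> \<nu> * Re (ip S u u)" if u: "\<And>k. k < K \<Longrightarrow> ip S u (e k) = 0" for u
  proof (cases "\<exists>n\<in>S. u n \<noteq> 0")
    case True
    then obtain c where c: "c > 0" "(\<lambda>n. of_real c * (if n \<in> S then u n else 0)) \<in> C" "c\<^sup>2 * Re (ip S u u) = 1"
      using normal[OF u] by blast
    have "mat_app S g (\<lambda>n. of_real c * (if n \<in> S then u n else 0)) = (\<lambda>n. of_real c * mat_app S g u n)"
      by (auto simp: mat_app_def fun_eq_iff sum_distrib_left intro!: sum.cong)
    then have "R (\<lambda>n. of_real c * (if n \<in> S then u n else 0)) = Re (of_real (c * c) * ip S (mat_app S g u) u)"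
      unfolding R_def by (simp add: ip_def sum_distrib_left mult_ac cong: sum.cong)
    then have "R (\<lambda>n. of_real c * (if n \<in> S then u n else 0)) = c\<^sup>2 * R u"
      by (simp add: R_def power2_eq_square)
    then have "c\<^sup>2 * R u \<le> \<nu> * (c\<^sup>2 * Re (ip S u u))" using max[OF c(2)] c(3) by (simp add: \<nu>_def)
    then have "c\<^sup>2 * R u \<le> c\<^sup>2 * (\<nu> * Re (ip S u u))" by (simp add: mult_ac)
    then show ?thesis using c(1) by simp
  next
    case False
    then show ?thesis by (simp add: R_def ip_def)
  qed
  define E where "E n = mat_app S g v n - of_real \<nu> * v n" for n
  have EL: "ip S E w = ip S (mat_app S g v) w - of_real \<nu> * ip S v w" for w
    by (simp add: ip_def E_def algebra_simps sum_subtractf sum_distrib_left)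
  \<comment> \<open>The residual \<open>E\<close> stays orthogonal to the old eigenvectors because
    the matrix is Hermitian, so \<open>v + s * E\<close> is an admissible competitor.\<close>
  have Eo: "ip S E (e k) = 0" if "k < K" for k
  proof -
    have "ip S (mat_app S g v) (e k) = ip S v (mat_app S g (e k))" by (rule ip_mat_app_hermitian[OF herm])
    also have "\<dots> = ip S v (\<lambda>n. of_real (\<mu> k) * e k n)"
      unfolding ip_def by (rule sum.cong) (simp_all add: eig[OF that])
    also have "\<dots> = 0" using vo[OF that] by (simp add: ip_scale_right)
    finally show ?thesis using vo[OF that] by (simp add: EL)
  qed
  \<comment> \<open>The Rayleigh inequality tested at \<open>v + s * E\<close>: its term of first
    order in \<open>s\<close> is \<open>2 * Re (ip S E E)\<close>. After division by
    \<open>s\<close>, letting \<open>s\<close> tend to 0 forces \<open>E = 0\<close>.\<close>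
  have key: "2 * Re (ip S E E) \<le> s * (\<nu> * Re (ip S E E) - R E)" if s: "s > 0" for s
  proof -
    have 1: "R (\<lambda>n. v n + of_real s * E n) \<le> \<nu> * Re (ip S (\<lambda>n. v n + of_real s * E n) (\<lambda>n. v n + of_real s * E n))"
      by (rule Rle) (simp add: ip_add_left ip_scale_left vo Eo)
    have sw: "Re (ip S E v) = Re (ip S v E)" by (metis ip_cnj cnj.sel(1))
    have "ip S (mat_app S g E) v = ip S E (mat_app S g v)" by (rule ip_mat_app_hermitian[OF herm])
    then have sw2: "Re (ip S (mat_app S g E) v) = Re (ip S (mat_app S g v) E)" by (metis ip_cnj cnj.sel(1))
    have 2: "R (\<lambda>n. v n + of_real s * E n) = \<nu> + 2 * s * Re (ip S (mat_app S g v) E) + s\<^sup>2 * R E"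
      unfolding R_def \<nu>_def mat_app_add mat_app_scale ip_add_left ip_add_right ip_scale_left ip_scale_right
      by (simp add: sw2 power2_eq_square algebra_simps)
    have 3: "Re (ip S (\<lambda>n. v n + of_real s * E n) (\<lambda>n. v n + of_real s * E n)) = 1 + 2 * s * Re (ip S v E) + s\<^sup>2 * Re (ip S E E)"
      unfolding ip_add_left ip_add_right ip_scale_left ip_scale_right v1
      by (simp add: sw power2_eq_square algebra_simps)
    have 4: "Re (ip S E E) = Re (ip S (mat_app S g v) E) - \<nu> * Re (ip S v E)" by (simp add: EL)
    have "2 * s * Re (ip S E E) \<le> s\<^sup>2 * (\<nu> * Re (ip S E E) - R E)"
      using 1 unfolding 2 3 4 by (simp add: algebra_simps)
    then have "s * (2 * Re (ip S E E)) \<le> s * (s * (\<nu> * Re (ip S E E) - R E))" by (simp add: power2_eq_square mult_ac)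
    then show ?thesis using s by simp
  qed
  have "((\<lambda>s. s * (\<nu> * Re (ip S E E) - R E)) \<longlongrightarrow> 0 * (\<nu> * Re (ip S E E) - R E)) (at_right 0)"
    by (intro tendsto_intros)
  then have "2 * Re (ip S E E) \<le> 0 * (\<nu> * Re (ip S E E) - R E)"
    by (rule tendsto_lowerbound) (auto intro!: eventually_at_rightI[of 0 1] key)
  then have "(\<Sum>n\<in>S. (norm (E n))\<^sup>2) = 0"
    unfolding ip_self by (simp add: sum_nonneg order_antisym)
  then have EE: "ip S E E = 0" by (simp only: ip_self of_real_0)
  have "E n = 0" if "n \<in> S" for n by (rule ip_self_eq_0[OF S EE that])
  then show ?thesis using v1 vo by (intro exI[of _ v] exI[of _ \<nu>]) (auto simp: E_def)
qed

text \<open>A longest orthonormal system of eigenvectors exists because its length is at most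
  \<open>card S\<close>. If it failed to resolve the identity, some residual \<open>h K e m\<close>
  would be nonzero and orthogonal to it, and one more eigenvector could be found.\<close>

theorem hermitian_spectral_decomposition:
  fixes S :: "'i set" and g :: "'i \<Rightarrow> 'i \<Rightarrow> complex"
  assumes S: "finite S"
    and herm: "\<And>n m. n \<in> S \<Longrightarrow> m \<in> S \<Longrightarrow> g m n = cnj (g n m)"
  obtains K :: nat and e :: "nat \<Rightarrow> 'i \<Rightarrow> complex" and \<mu> :: "nat \<Rightarrow> real"
  where "\<And>k l. k < K \<Longrightarrow> l < K \<Longrightarrow> ip S (e k) (e l) = (if k = l then 1 else 0)"
    and "\<And>k n. k < K \<Longrightarrow> n \<in> S \<Longrightarrow> mat_app S g (e k) n = \<mu> k * e k n"
    and "\<And>n m. n \<in> S \<Longrightarrow> m \<in> S \<Longrightarrow> (\<Sum>k<K. e k n * cnj (e k m)) = (if n = m then 1 else 0)"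
proof -
  define ons where "ons K e \<mu> \<longleftrightarrow> (\<forall>k<K. \<forall>l<K. ip S (e k) (e l) = (if k = l then 1 else 0)) \<and>
      (\<forall>k<K. \<forall>n\<in>S. mat_app S g (e k) n = of_real (\<mu> k) * e k n)"
    for K :: nat and e :: "nat \<Rightarrow> 'i \<Rightarrow> complex" and \<mu> :: "nat \<Rightarrow> real"
  \<comment> \<open>The unit vector at \<open>m\<close> minus its projection onto the span of the
    first \<open>K\<close> vectors.\<close>
  define h where "h K e m n = (if n = m then 1 else 0) - (\<Sum>k<K. cnj (e k m) * e k n)"
    for K :: nat and e :: "nat \<Rightarrow> 'i \<Rightarrow> complex" and m n :: 'i
  have h_orth: "ip S (h K e m) (e l) = 0" if "ons K e \<mu>" "m \<in> S" "l < K" for K e \<mu> m l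
  proof -
    have "ip S (\<lambda>n. if n = m then 1 else 0) (e l) = (\<Sum>n\<in>S. if n = m then cnj (e l n) else 0)"
      unfolding ip_def by (rule sum.cong) auto
    also have "\<dots> = cnj (e l m)" using S that by (simp add: sum.delta)
    finally have 1: "ip S (\<lambda>n. if n = m then 1 else 0) (e l) = cnj (e l m)" .
    have "(\<Sum>k<K. cnj (e k m) * ip S (e k) (e l)) = (\<Sum>k<K. if k = l then cnj (e k m) else 0)"
      using that by (intro sum.cong) (auto simp: ons_def)
    also have "\<dots> = cnj (e l m)" using that by (simp add: sum.delta)
    finally show ?thesis unfolding h_def[abs_def]
      by (simp add: ip_diff_left ip_sum_left ip_scale_left 1)
  qed
  \<comment> \<open>Bessel's inequality for each unit vector, summed over \<open>S\<close>: the left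
    side counts the \<open>K\<close> norms, the right side counts \<open>card S\<close>.\<close>
  have bound: "K \<le> card S" if o: "ons K e \<mu>" for K e \<mu>
  proof -
    have "(\<Sum>k<K. (norm (e k m))\<^sup>2) \<le> 1" if m: "m \<in> S" for m
    proof -
      have "ip S (h K e m) (h K e m) = ip S (h K e m) (\<lambda>n. if n = m then 1 else 0) - ip S (h K e m) (\<lambda>n. \<Sum>k<K. cnj (e k m) * e k n)"
        by (subst (2) h_def[abs_def]) (simp add: ip_def algebra_simps sum_subtractf)
      also have "ip S (h K e m) (\<lambda>n. \<Sum>k<K. cnj (e k m) * e k n) = (\<Sum>k<K. e k m * ip S (h K e m) (e k))"
        unfolding ip_def by (simp add: sum_distrib_left) (subst sum.swap, simp add: mult_ac)
      also have "\<dots> = 0" using h_orth[OF o m] by simp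
      also have "ip S (h K e m) (\<lambda>n. if n = m then 1 else 0) = (\<Sum>n\<in>S. if n = m then h K e m n else 0)"
        unfolding ip_def by (rule sum.cong) auto
      also have "\<dots> = 1 - (\<Sum>k<K. cnj (e k m) * e k m)" using S m by (simp add: sum.delta h_def)
      also have "(\<Sum>k<K. cnj (e k m) * e k m) = of_real (\<Sum>k<K. (norm (e k m))\<^sup>2)"
        by (simp add: complex_norm_square[symmetric] mult.commute)
      finally have "of_real (\<Sum>n\<in>S. (norm (h K e m n))\<^sup>2) = (of_real (1 - (\<Sum>k<K. (norm (e k m))\<^sup>2)) :: complex)"
        unfolding ip_self by simp
      then have "(\<Sum>n\<in>S. (norm (h K e m n))\<^sup>2) = 1 - (\<Sum>k<K. (norm (e k m))\<^sup>2)" by (simp only: of_real_eq_iff)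
      moreover have "0 \<le> (\<Sum>n\<in>S. (norm (h K e m n))\<^sup>2)" by (simp add: sum_nonneg)
      ultimately show ?thesis by linarith
    qed
    then have "(\<Sum>m\<in>S. \<Sum>k<K. (norm (e k m))\<^sup>2) \<le> (\<Sum>m\<in>S. 1)" by (rule sum_mono)
    moreover have "(\<Sum>m\<in>S. \<Sum>k<K. (norm (e k m))\<^sup>2) = (\<Sum>k<K. \<Sum>m\<in>S. (norm (e k m))\<^sup>2)" by (rule sum.swap)
    moreover have "(\<Sum>m\<in>S. (norm (e k m))\<^sup>2) = 1" if "k < K" for k
    proof -
      have "complex_of_real (\<Sum>m\<in>S. (norm (e k m))\<^sup>2) = of_real 1" using o that by (simp add: ip_self[symmetric] ons_def del: of_real_sum)
      then show ?thesis by (simp only: of_real_eq_iff)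
    qed
    ultimately show ?thesis by simp
  qed
  have "\<exists>K. (\<exists>e \<mu>. ons K e \<mu>) \<and> (\<forall>K'. (\<exists>e \<mu>. ons K' e \<mu>) \<longrightarrow> K' \<le> K)"
    by (rule ex_has_greatest_nat[of "\<lambda>K. \<exists>e \<mu>. ons K e \<mu>" 0 id "Suc (card S)", simplified]) (auto simp: less_Suc_eq_le dest: bound, simp add: ons_def)
  then obtain K e \<mu> where o: "ons K e \<mu>" and max: "\<And>K' e \<mu>. ons K' e \<mu> \<Longrightarrow> K' \<le> K" by blast
  have complete: "h K e m n = 0" if m: "m \<in> S" and n: "n \<in> S" for m n
  proof (rule ccontr)
    assume "h K e m n \<noteq> 0"
    then have "\<exists>v \<nu>. ip S v v = 1 \<and> (\<forall>k<K. ip S v (e k) = 0) \<and> (\<forall>n\<in>S. mat_app S g v n = of_real \<nu> * v n)"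
      using o n by (intro hermitian_next_eigenvector[where e = e and \<mu> = \<mu> and h = "h K e m" and ?n0.0 = n] S herm h_orth[OF o m])
        (auto simp: ons_def)
    then obtain v \<nu> where v: "ip S v v = 1" "\<forall>k<K. ip S v (e k) = 0" "\<forall>n\<in>S. mat_app S g v n = of_real \<nu> * v n"
      by blast
    have v': "ip S (e k) v = 0" if "k < K" for k using v(2) that by (metis ip_cnj complex_cnj_zero)
    have "ons (Suc K) (e(K := v)) (\<mu>(K := \<nu>))"
      using o v v' by (auto simp: ons_def less_Suc_eq)
    then show False using max by fastforce
  qed
  show ?thesis
  proof (rule that[of K e \<mu>])
    fix n m assume "n \<in> S" "m \<in> S"
    then show "(\<Sum>k<K. e k n * cnj (e k m)) = (if n = m then 1 else 0)"
      using complete[of m n] by (auto simp: h_def mult.commute)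
  qed (use o in \<open>auto simp: ons_def\<close>)
qed

section \<open>Square-integrable functions on the torus\<close>

definition square_integrable :: "'a measure \<Rightarrow> ('a \<Rightarrow> complex) \<Rightarrow> bool" where
  "square_integrable M f \<longleftrightarrow> f \<in> borel_measurable M \<and> integrable M (\<lambda>x. (norm (f x))\<^sup>2)"

lemma square_integrable_mult_cnj:
  assumes "square_integrable M f" "square_integrable M g"
  shows "integrable M (\<lambda>x. f x * cnj (g x))"
proof (rule Bochner_Integration.integrable_bound)
  show "integrable M (\<lambda>x. (norm (f x))\<^sup>2 + (norm (g x))\<^sup>2)"
    using assms by (auto simp: square_integrable_def)
  show "(\<lambda>x. f x * cnj (g x)) \<in> borel_measurable M"
    using assms by (auto simp: square_integrable_def intro!: borel_measurable_times borel_measurable_continuous_on[OF continuous_on_cnj[OF continuous_on_id]])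
  have "a * b \<le> a\<^sup>2 + b\<^sup>2" for a b :: real
    using sum_squares_bound[of a b] zero_le_power2[of a] zero_le_power2[of b] by linarith
  then show "AE x in M. norm (f x * cnj (g x)) \<le> norm ((norm (f x))\<^sup>2 + (norm (g x))\<^sup>2)"
    by (simp add: norm_mult)
qed

lemma Bessel_inequality:
  assumes J: "finite J" and \<phi>: "\<And>j. j \<in> J \<Longrightarrow> square_integrable M (\<phi> j)" and h: "square_integrable M h"
    and orth: "\<And>j k. j \<in> J \<Longrightarrow> k \<in> J \<Longrightarrow> (\<integral>x. \<phi> j x * cnj (\<phi> k x) \<partial>M) = (if j = k then 1 else 0)"
  shows "(\<Sum>j\<in>J. (norm (\<integral>x. h x * cnj (\<phi> j x) \<partial>M))\<^sup>2) \<le> (\<integral>x. (norm (h x))\<^sup>2 \<partial>M)"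
proof -
  define c where "c j = (\<integral>x. h x * cnj (\<phi> j x) \<partial>M)" for j
  have i1: "integrable M (\<lambda>x. h x * cnj (\<phi> j x))" "integrable M (\<lambda>x. \<phi> j x * cnj (h x))" if "j \<in> J" for j
    using square_integrable_mult_cnj h \<phi> that by blast+
  have i2: "integrable M (\<lambda>x. \<phi> j x * cnj (\<phi> k x))" if "j \<in> J" "k \<in> J" for j k
    using square_integrable_mult_cnj \<phi> that by blast
  have i3: "integrable M (\<lambda>x. h x * cnj (h x))" using square_integrable_mult_cnj h by blast
  have cc: "(\<integral>x. \<phi> j x * cnj (h x) \<partial>M) = cnj (c j)" for j
  proof -
    have "(\<integral>x. \<phi> j x * cnj (h x) \<partial>M) = (\<integral>x. cnj (h x * cnj (\<phi> j x)) \<partial>M)" by (simp add: mult.commute)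
    also have "\<dots> = cnj (c j)" unfolding c_def by (rule Bochner_Integration.integral_cnj)
    finally show ?thesis .
  qed
  define r where "r x = h x - (\<Sum>j\<in>J. c j * \<phi> j x)" for x
  have "r x * cnj (r x) = h x * cnj (h x) - (\<Sum>j\<in>J. cnj (c j) * (h x * cnj (\<phi> j x)))
      - (\<Sum>j\<in>J. c j * (\<phi> j x * cnj (h x))) + (\<Sum>j\<in>J. \<Sum>k\<in>J. c j * cnj (c k) * (\<phi> j x * cnj (\<phi> k x)))" for x
  proof -
    have "(\<Sum>j\<in>J. c j * \<phi> j x) * cnj (\<Sum>j\<in>J. c j * \<phi> j x) = (\<Sum>j\<in>J. \<Sum>k\<in>J. c j * cnj (c k) * (\<phi> j x * cnj (\<phi> k x)))"
      unfolding cnj_sum sum_product by (simp add: mult_ac)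
    moreover have "(\<Sum>j\<in>J. c j * \<phi> j x) * cnj (h x) = (\<Sum>j\<in>J. c j * (\<phi> j x * cnj (h x)))"
      by (simp add: sum_distrib_right mult.assoc)
    moreover have "h x * cnj (\<Sum>j\<in>J. c j * \<phi> j x) = (\<Sum>j\<in>J. cnj (c j) * (h x * cnj (\<phi> j x)))"
      by (simp add: sum_distrib_left mult.left_commute)
    ultimately show ?thesis unfolding r_def complex_cnj_diff by (simp only: left_diff_distrib right_diff_distrib) simp
  qed
  then have "(\<integral>x. r x * cnj (r x) \<partial>M) = (\<integral>x. h x * cnj (h x) \<partial>M) - (\<Sum>j\<in>J. cnj (c j) * c j)
      - (\<Sum>j\<in>J. c j * cnj (c j)) + (\<Sum>j\<in>J. \<Sum>k\<in>J. c j * cnj (c k) * (if j = k then 1 else 0))"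
    using i1 i2 i3 by (simp add: c_def[symmetric] cc orth cong: sum.cong)
  also have "(\<Sum>j\<in>J. \<Sum>k\<in>J. c j * cnj (c k) * (if j = k then 1 else 0)) = (\<Sum>j\<in>J. c j * cnj (c j))"
    using J by (intro sum.cong refl) (simp add: if_distrib cong: if_cong)
  finally have eq: "(\<integral>x. r x * cnj (r x) \<partial>M) = (\<integral>x. h x * cnj (h x) \<partial>M) - (\<Sum>j\<in>J. cnj (c j) * c j)" by simp
  have "(\<integral>x. r x * cnj (r x) \<partial>M) = of_real (\<integral>x. (norm (r x))\<^sup>2 \<partial>M)"
    unfolding integral_complex_of_real[symmetric] by (simp add: complex_norm_square[symmetric])
  moreover have "(\<integral>x. h x * cnj (h x) \<partial>M) = of_real (\<integral>x. (norm (h x))\<^sup>2 \<partial>M)"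
    unfolding integral_complex_of_real[symmetric] by (simp add: complex_norm_square[symmetric])
  moreover have "(\<Sum>j\<in>J. cnj (c j) * c j) = of_real (\<Sum>j\<in>J. (norm (c j))\<^sup>2)"
    by (simp add: complex_norm_square[symmetric] mult.commute)
  ultimately have "complex_of_real (\<integral>x. (norm (r x))\<^sup>2 \<partial>M) = of_real ((\<integral>x. (norm (h x))\<^sup>2 \<partial>M) - (\<Sum>j\<in>J. (norm (c j))\<^sup>2))"
    using eq by simp
  then have "(\<integral>x. (norm (r x))\<^sup>2 \<partial>M) = (\<integral>x. (norm (h x))\<^sup>2 \<partial>M) - (\<Sum>j\<in>J. (norm (c j))\<^sup>2)"
    by (simp only: of_real_eq_iff)
  moreover have "0 \<le> (\<integral>x. (norm (r x))\<^sup>2 \<partial>M)" by simp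
  ultimately show ?thesis by (simp add: c_def)
qed

text \<open>A density rather than a restricted space: the space remains \<open>UNIV\<close> with the
  Borel sets, so sections and products need no side conditions.\<close>

definition interval_measure_on :: "real set \<Rightarrow> real measure" where
  "interval_measure_on I = density lborel (indicator I)"

lemma sets_interval_measure_on [measurable_cong, simp]: "sets (interval_measure_on I) = sets borel"
  by (simp add: interval_measure_on_def)

lemma space_interval_measure_on [simp]: "space (interval_measure_on I) = UNIV"
  by (simp add: interval_measure_on_def)

lemma nn_integral_interval_measure_on:
  assumes [measurable]: "I \<in> sets borel" "f \<in> borel_measurable borel"
  shows "(\<integral>\<^sup>+ x. f x \<partial>interval_measure_on I) = (\<integral>\<^sup>+ x. f x * indicator I x \<partial>lborel)"
  unfolding interval_measure_on_def by (subst nn_integral_density) (auto simp: mult.commute)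

lemma emeasure_interval_measure_on:
  "I \<in> sets borel \<Longrightarrow> emeasure (interval_measure_on I) UNIV = emeasure lborel I"
  by (simp add: interval_measure_on_def emeasure_density)

lemma finite_interval_measure_on:
  "I \<in> sets borel \<Longrightarrow> emeasure lborel I < \<infinity> \<Longrightarrow> finite_measure (interval_measure_on I)"
  by (intro finite_measureI) (simp add: emeasure_interval_measure_on)

lemma integral_interval_measure_on:
  fixes f :: "real \<Rightarrow> 'b::{banach, second_countable_topology}"
  assumes [measurable]: "I \<in> sets borel" "f \<in> borel_measurable borel"
  shows "(\<integral>x. f x \<partial>interval_measure_on I) = (\<integral>x. indicator I x *\<^sub>R f x \<partial>lborel)"
proof -
  have "interval_measure_on I = density lborel (\<lambda>x. ennreal (indicator I x))"
    by (simp add: interval_measure_on_def ennreal_indicator)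
  then show ?thesis by (simp add: integral_density)
qed

lemma integrable_bounded_finite_measure:
  fixes f :: "'a \<Rightarrow> 'b::{banach, second_countable_topology}"
  assumes "finite_measure M" "f \<in> borel_measurable M" "\<And>x. norm (f x) \<le> B"
  shows "integrable M f"
  using assms by (intro finite_measure.integrable_const_bound[of M f B]) auto

abbreviation torus_measure :: "real measure" where
  "torus_measure \<equiv> interval_measure_on torus"

lemma torus_borel [measurable, simp]: "torus \<in> sets borel"
  by (simp add: torus_def)

lemma emeasure_torus: "emeasure lborel torus = ennreal (2 * pi)"
  by (simp add: torus_def)

lemma finite_torus_measure: "finite_measure torus_measure"
  by (rule finite_interval_measure_on) (auto simp: emeasure_torus)

lemma integral_torus_cis: "(\<integral>x. cis (x * of_int k) \<partial>torus_measure) = (if k = 0 then 2 * pi else 0)"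
proof (cases "k = 0")
  case True
  have "(\<integral>x. (1::complex) \<partial>torus_measure) = of_real (measure torus_measure UNIV)" by (simp add: lebesgue_integral_const scaleR_conv_of_real)
  also have "\<dots> = of_real (2 * pi)" by (simp add: measure_def emeasure_interval_measure_on emeasure_torus)
  finally show ?thesis using True by simp
next
  case False
  have m[measurable]: "(\<lambda>x. cis (x * of_int k)) \<in> borel_measurable borel"
    by (intro borel_measurable_continuous_onI continuous_intros)
  have "(\<integral>x. cis (x * of_int k) \<partial>torus_measure) = (\<integral>x. indicator torus x *\<^sub>R cis (x * of_int k) \<partial>lborel)"
    by (simp add: integral_interval_measure_on)
  also have "\<dots> = (\<integral>x. indicator {0..2 * pi} x *\<^sub>R cis (x * of_int k) \<partial>lborel)"
  proof (rule integral_cong_AE)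
    show "AE x in lborel. indicator torus x *\<^sub>R cis (x * of_int k) = indicator {0..2 * pi} x *\<^sub>R cis (x * of_int k)"
      using AE_lborel_singleton[of "2 * pi"] by eventually_elim (auto simp: torus_def indicator_def)
  qed measurable
  also have "\<dots> = cis (2 * pi * of_int k) / (\<i> * of_int k) - cis (0 * of_int k) / (\<i> * of_int k)"
  proof (rule integral_FTC_Icc)
    fix x :: real
    have "((\<lambda>x. exp (\<i> * of_int k * of_real x) / (\<i> * of_int k)) has_vector_derivative exp (\<i> * of_int k * of_real x)) (at x)"
      using False by (auto intro!: derivative_eq_intros has_vector_derivative_real_field simp: field_simps)
    then show "((\<lambda>x. cis (x * of_int k) / (\<i> * of_int k)) has_vector_derivative cis (x * of_int k)) (at x within {0..2 * pi})"
      by (simp add: cis_conv_exp mult_ac has_vector_derivative_at_within)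
    show "continuous_on {0..2 * pi} (\<lambda>x. cis (x * of_int k))" by (intro continuous_intros)
  qed simp
  also have "\<dots> = 0" by (simp add: cis_multiple_2pi)
  finally show ?thesis using False by simp
qed

lemma borel_measurable_cis [measurable (raw)]:
  "f \<in> borel_measurable M \<Longrightarrow> (\<lambda>x. cis (f x)) \<in> borel_measurable M"
  by (rule borel_measurable_continuous_on[OF continuous_on_cis[OF continuous_on_id]])

lemma borel_measurable_cnj [measurable (raw)]:
  "f \<in> borel_measurable M \<Longrightarrow> (\<lambda>x. cnj (f x)) \<in> borel_measurable M"
  by (rule borel_measurable_continuous_on[OF continuous_on_cnj[OF continuous_on_id]])

lemma torus_Bessel:
  assumes S: "finite S" and h: "square_integrable torus_measure h"
  shows "(\<Sum>n\<in>S. (norm (\<integral>x. h x * cis (x * of_int n) \<partial>torus_measure))\<^sup>2) \<le> 2 * pi * (\<integral>x. (norm (h x))\<^sup>2 \<partial>torus_measure)"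
proof -
  define c where "c = 1 / sqrt (2 * pi)"
  have c: "c * c * (2 * pi) = 1" "c > 0" by (auto simp: c_def)
  define \<phi> where "\<phi> n x = of_real c * cis (- (x * of_int n))" for n :: int and x :: real
  have phim[measurable]: "\<phi> n \<in> borel_measurable borel" for n unfolding \<phi>_def by measurable
  have "(\<Sum>n\<in>S. (norm (\<integral>x. h x * cnj (\<phi> n x) \<partial>torus_measure))\<^sup>2) \<le> (\<integral>x. (norm (h x))\<^sup>2 \<partial>torus_measure)"
  proof (rule Bessel_inequality[OF S _ h])
    show "square_integrable torus_measure (\<phi> n)" for n unfolding square_integrable_def
      using c by (auto intro!: integrable_bounded_finite_measure[OF finite_torus_measure, of _ "c\<^sup>2"] simp: \<phi>_def norm_mult power_mult_distrib)
    fix n m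
    have "\<phi> n x * cnj (\<phi> m x) = of_real (c * c) * cis (x * of_int (m - n))" for x
      by (simp add: \<phi>_def cis_cnj cis_mult algebra_simps)
    then have "(\<integral>x. \<phi> n x * cnj (\<phi> m x) \<partial>torus_measure) = of_real (c * c) * (if m - n = 0 then 2 * pi else 0)"
      by (simp only: integral_mult_right_zero integral_torus_cis) simp
    also have "\<dots> = of_real (if n = m then c * c * (2 * pi) else 0)" by auto
    finally show "(\<integral>x. \<phi> n x * cnj (\<phi> m x) \<partial>torus_measure) = (if n = m then 1 else 0)" unfolding c by auto
  qed
  moreover have "(norm (\<integral>x. h x * cnj (\<phi> n x) \<partial>torus_measure))\<^sup>2 = (norm (\<integral>x. h x * cis (x * of_int n) \<partial>torus_measure))\<^sup>2 / (2 * pi)" for n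
  proof -
    have "(\<lambda>x. h x * cnj (\<phi> n x)) = (\<lambda>x. of_real c * (h x * cis (x * of_int n)))"
      by (simp add: \<phi>_def cis_cnj fun_eq_iff)
    then have "(norm (\<integral>x. h x * cnj (\<phi> n x) \<partial>torus_measure))\<^sup>2 = c\<^sup>2 * (norm (\<integral>x. h x * cis (x * of_int n) \<partial>torus_measure))\<^sup>2"
      using c by (simp add: norm_mult power_mult_distrib)
    then show ?thesis by (simp add: c_def power_divide)
  qed
  ultimately show ?thesis by (simp add: sum_divide_distrib[symmetric] field_simps)
qed

lemma integral_pair_product:
  fixes f :: "'a \<Rightarrow> complex" and g :: "'b \<Rightarrow> complex"
  assumes M: "sigma_finite_measure M1" "sigma_finite_measure M2" and f: "integrable M1 f" and g: "integrable M2 g"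
  shows "integrable (M1 \<Otimes>\<^sub>M M2) (\<lambda>z. f (fst z) * g (snd z))"
    and "(\<integral>z. f (fst z) * g (snd z) \<partial>(M1 \<Otimes>\<^sub>M M2)) = (\<integral>x. f x \<partial>M1) * (\<integral>y. g y \<partial>M2)"
proof -
  interpret pair_sigma_finite M1 M2 using M by (simp add: pair_sigma_finite_def)
  have [measurable]: "f \<in> borel_measurable M1" "g \<in> borel_measurable M2" using f g by auto
  show i: "integrable (M1 \<Otimes>\<^sub>M M2) (\<lambda>z. f (fst z) * g (snd z))"
    by (rule Fubini_integrable) (use f g in \<open>auto simp: norm_mult\<close>)
  have "(\<integral>z. f (fst z) * g (snd z) \<partial>(M1 \<Otimes>\<^sub>M M2)) = (\<integral>x. \<integral>y. f x * g y \<partial>M2 \<partial>M1)"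
    using integral_fst'[OF i] by simp
  then show "(\<integral>z. f (fst z) * g (snd z) \<partial>(M1 \<Otimes>\<^sub>M M2)) = (\<integral>x. f x \<partial>M1) * (\<integral>y. g y \<partial>M2)" by simp
qed

section \<open>Space-time integrals over a short time slab\<close>

text \<open>A class closed under sums, products, conjugation and sections, on which integrability
  over the finite measures in use is automatic. The bound is demanded at every point, not almost
  everywhere, so that it survives restriction to sections.\<close>

definition bounded_borel :: "'a measure \<Rightarrow> ('a \<Rightarrow> 'b::{banach, second_countable_topology}) \<Rightarrow> bool" where
  "bounded_borel M f \<longleftrightarrow> f \<in> borel_measurable M \<and> (\<exists>C. \<forall>z. norm (f z) \<le> C)"

lemma bounded_borelI: "f \<in> borel_measurable M \<Longrightarrow> (\<And>z. norm (f z) \<le> C) \<Longrightarrow> bounded_borel M f"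
  by (auto simp: bounded_borel_def)

lemma bounded_borel_measurable: "bounded_borel M f \<Longrightarrow> f \<in> borel_measurable M"
  by (simp add: bounded_borel_def)

lemma bounded_borel_integrable: "finite_measure M \<Longrightarrow> bounded_borel M f \<Longrightarrow> integrable M f"
  unfolding bounded_borel_def using integrable_bounded_finite_measure by blast

lemma bounded_borel_compose:
  "bounded_borel M f \<Longrightarrow> g \<in> M' \<rightarrow>\<^sub>M M \<Longrightarrow> bounded_borel M' (\<lambda>z. f (g z))"
  unfolding bounded_borel_def by (auto intro: measurable_compose)

lemma bounded_borel_const: "bounded_borel M (\<lambda>z. c)"
  by (rule bounded_borelI[of _ _ "norm c"]) auto

lemma bounded_borel_mult:
  fixes f g :: "'a \<Rightarrow> 'b::{banach, second_countable_topology, real_normed_algebra}"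
  assumes "bounded_borel M f" "bounded_borel M g"
  shows "bounded_borel M (\<lambda>z. f z * g z)"
proof -
  obtain C D where CD: "\<And>z. norm (f z) \<le> C" "\<And>z. norm (g z) \<le> D"
    using assms by (auto simp: bounded_borel_def)
  show ?thesis
  proof (rule bounded_borelI[of _ _ "C * D"])
    show "(\<lambda>z. f z * g z) \<in> borel_measurable M" using assms by (auto simp: bounded_borel_def)
    fix z
    have "0 \<le> C" using CD(1)[of z] norm_ge_zero order_trans by blast
    then show "norm (f z * g z) \<le> C * D"
      using CD[of z] by (intro order_trans[OF norm_mult_ineq] mult_mono) auto
  qed
qed

lemma bounded_borel_add:
  assumes "bounded_borel M f" "bounded_borel M g"
  shows "bounded_borel M (\<lambda>z. f z + g z)"
proof -
  obtain C D where CD: "\<And>z. norm (f z) \<le> C" "\<And>z. norm (g z) \<le> D"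
    using assms by (auto simp: bounded_borel_def)
  show ?thesis
    by (rule bounded_borelI[of _ _ "C + D"])
       (use assms in \<open>auto simp: bounded_borel_def intro!: norm_triangle_mono CD\<close>)
qed

lemma bounded_borel_sum: "(\<And>i. i \<in> I \<Longrightarrow> bounded_borel M (f i)) \<Longrightarrow> bounded_borel M (\<lambda>z. \<Sum>i\<in>I. f i z)"
  by (induction I rule: infinite_finite_induct) (auto intro: bounded_borel_const bounded_borel_add)

lemma bounded_borel_cnj: "bounded_borel M f \<Longrightarrow> bounded_borel M (\<lambda>z. cnj (f z))"
  unfolding bounded_borel_def by auto

lemma bounded_borel_of_real: "bounded_borel M f \<Longrightarrow> bounded_borel M (\<lambda>z. complex_of_real (f z))"
  unfolding bounded_borel_def by auto

lemma bounded_borel_norm: "bounded_borel M f \<Longrightarrow> bounded_borel M (\<lambda>z. norm (f z))"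
  unfolding bounded_borel_def by auto

lemma bounded_borel_cis: "f \<in> borel_measurable M \<Longrightarrow> bounded_borel M (\<lambda>z. cis (f z))"
  by (rule bounded_borelI[of _ _ 1]) auto

lemmas bounded_borel_intros = bounded_borel_const bounded_borel_mult bounded_borel_add bounded_borel_sum
  bounded_borel_cnj bounded_borel_of_real bounded_borel_norm bounded_borel_cis

definition wave :: "int \<Rightarrow> real \<times> real \<Rightarrow> complex" where
  "wave n z = cis (snd z * of_int n + fst z * dispersion n)"

lemma norm_wave [simp]: "norm (wave n z) = 1"
  by (simp add: wave_def)

lemma bounded_borel_wave: "bounded_borel (borel \<Otimes>\<^sub>M borel) (wave n)"
  unfolding wave_def by (intro bounded_borel_cis) measurable

lemma wave_measurable [measurable]: "wave n \<in> borel_measurable (borel \<Otimes>\<^sub>M borel)"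
  using bounded_borel_wave by (rule bounded_borel_measurable)

text \<open>This factorisation over frequencies separates the two space-time points: integrals
  against the kernel become sums of products of Fourier coefficients.\<close>

lemma kernel_eq_sum_waves:
  "kernel N (fst X - fst Y) (snd X - snd Y) = (\<Sum>n\<in>{- int N..int N}. wave n X * cnj (wave n Y))"
  unfolding kernel_def wave_def by (intro sum.cong refl) (simp add: cis_cnj cis_mult algebra_simps)

lemma sum_norm_mult_le_sqrt:
  fixes a b :: "'i \<Rightarrow> complex"
  shows "norm (\<Sum>n\<in>S. a n * b n) \<le> sqrt (\<Sum>n\<in>S. (norm (a n))\<^sup>2) * sqrt (\<Sum>n\<in>S. (norm (b n))\<^sup>2)"
proof -
  have "norm (\<Sum>n\<in>S. a n * b n) \<le> (\<Sum>n\<in>S. \<bar>norm (a n)\<bar> * \<bar>norm (b n)\<bar>)"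
    by (rule order_trans[OF norm_sum]) (simp add: norm_mult)
  also have "\<dots> \<le> L2_set (\<lambda>n. norm (a n)) S * L2_set (\<lambda>n. norm (b n)) S"
    by (rule L2_set_mult_ineq)
  finally show ?thesis by (simp add: L2_set_def)
qed

text \<open>All bounds are uniform in \<open>t0\<close>, so one locale serves every slab of the
  covering.\<close>

locale time_slab =
  fixes N :: nat and t0 :: real
  assumes N: "1 \<le> N"
begin

definition slab :: "real set" where "slab = {t0..<t0 + 1 / real N}"

definition tm :: "real measure" where "tm = interval_measure_on slab"

text \<open>Pairs of space-time points are grouped as \<open>((t, s), (x, y))\<close>, so that Fubini separates the times from the positions.\<close>

definition prod_measure :: "((real \<times> real) \<times> (real \<times> real)) measure" where
  "prod_measure = (tm \<Otimes>\<^sub>M tm) \<Otimes>\<^sub>M (torus_measure \<Otimes>\<^sub>M torus_measure)"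

definition pX :: "(real \<times> real) \<times> (real \<times> real) \<Rightarrow> real \<times> real" where
  "pX \<zeta> = (fst (fst \<zeta>), fst (snd \<zeta>))"

definition pY :: "(real \<times> real) \<times> (real \<times> real) \<Rightarrow> real \<times> real" where
  "pY \<zeta> = (snd (fst \<zeta>), snd (snd \<zeta>))"

definition dint :: "(real \<times> real \<Rightarrow> complex) \<Rightarrow> complex" where
  "dint a = (\<integral>t. \<integral>x. a (t, x) \<partial>torus_measure \<partial>tm)"

lemma slab_borel [measurable, simp]: "slab \<in> sets borel" by (simp add: slab_def)

lemma sets_tm [measurable_cong, simp]: "sets tm = sets borel" by (simp add: tm_def)
lemma space_tm [simp]: "space tm = UNIV" by (simp add: tm_def)

lemma finite_tm: "finite_measure tm"
  unfolding tm_def by (rule finite_interval_measure_on) (auto simp: slab_def)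

lemma slab_diff: "t \<in> slab \<Longrightarrow> s \<in> slab \<Longrightarrow> \<bar>t - s\<bar> * real N \<le> 1"
proof -
  assume "t \<in> slab" "s \<in> slab"
  then have "\<bar>t - s\<bar> \<le> 1 / real N" by (auto simp: slab_def)
  then have "\<bar>t - s\<bar> * real N \<le> 1 / real N * real N" by (rule mult_right_mono) simp
  then show ?thesis using N by simp
qed

lemma sets_prod_measure [measurable_cong]:
  "sets prod_measure = sets ((borel \<Otimes>\<^sub>M borel) \<Otimes>\<^sub>M (borel \<Otimes>\<^sub>M borel))"
  unfolding prod_measure_def by (intro sets_pair_measure_cong) auto

lemma finite_pairs: "finite_measure (tm \<Otimes>\<^sub>M tm)" "finite_measure (torus_measure \<Otimes>\<^sub>M torus_measure)"
    "finite_measure prod_measure"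
  unfolding prod_measure_def by (intro finite_measure_pair_measure finite_tm finite_torus_measure)+

lemma sigma_finite: "sigma_finite_measure tm" "sigma_finite_measure torus_measure"
  "sigma_finite_measure (tm \<Otimes>\<^sub>M tm)" "sigma_finite_measure (torus_measure \<Otimes>\<^sub>M torus_measure)"
  using finite_tm finite_torus_measure finite_pairs by (auto simp: finite_measure_def)

lemma pXY_measurable [measurable]: "pX \<in> prod_measure \<rightarrow>\<^sub>M borel \<Otimes>\<^sub>M borel" "pY \<in> prod_measure \<rightarrow>\<^sub>M borel \<Otimes>\<^sub>M borel"
  unfolding pX_def[abs_def] pY_def[abs_def] by measurable

lemma bounded_borel_pX: "bounded_borel (borel \<Otimes>\<^sub>M borel) a \<Longrightarrow> bounded_borel prod_measure (\<lambda>\<zeta>. a (pX \<zeta>))"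
  by (rule bounded_borel_compose) measurable

lemma bounded_borel_pY: "bounded_borel (borel \<Otimes>\<^sub>M borel) a \<Longrightarrow> bounded_borel prod_measure (\<lambda>\<zeta>. a (pY \<zeta>))"
  by (rule bounded_borel_compose) measurable

lemma bounded_borel_fst: "bounded_borel (borel \<Otimes>\<^sub>M borel) a \<Longrightarrow> bounded_borel prod_measure (\<lambda>\<zeta>. a (fst \<zeta>))"
  by (rule bounded_borel_compose) measurable

lemma bounded_borel_section:
  "bounded_borel (borel \<Otimes>\<^sub>M borel) a \<Longrightarrow> bounded_borel torus_measure (\<lambda>x. a (t, x))"
  by (rule bounded_borel_compose) measurable

lemma bounded_borel_inner_integral:
  fixes a :: "real \<times> real \<Rightarrow> 'b::{banach, second_countable_topology}"
  assumes "bounded_borel (borel \<Otimes>\<^sub>M borel) a"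
  shows "bounded_borel borel (\<lambda>t. \<integral>x. a (t, x) \<partial>torus_measure)"
proof -
  obtain C where C: "\<And>z. norm (a z) \<le> C" using assms by (auto simp: bounded_borel_def)
  note [measurable] = bounded_borel_measurable[OF assms]
  show ?thesis
  proof (rule bounded_borelI[of _ _ "C * (2 * pi)"])
    show "(\<lambda>t. \<integral>x. a (t, x) \<partial>torus_measure) \<in> borel_measurable borel"
      by (rule sigma_finite_measure.borel_measurable_lebesgue_integral[OF sigma_finite(2)]) (auto simp: case_prod_unfold)
    fix t
    have "norm (\<integral>x. a (t, x) \<partial>torus_measure) \<le> (\<integral>x. norm (a (t, x)) \<partial>torus_measure)" by (rule integral_norm_bound)
    also have "\<dots> \<le> (\<integral>x. C \<partial>torus_measure)"
      using C assms by (intro integral_mono bounded_borel_integrable[OF finite_torus_measure] bounded_borel_section bounded_borel_intros) auto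
    also have "\<dots> = C * (2 * pi)" by (simp add: measure_def emeasure_interval_measure_on emeasure_torus)
    finally show "norm (\<integral>x. a (t, x) \<partial>torus_measure) \<le> C * (2 * pi)" .
  qed
qed

lemma bounded_borel_tm: "bounded_borel borel f \<Longrightarrow> bounded_borel tm f"
  by (rule bounded_borel_compose[of borel f "\<lambda>x. x"]) measurable

lemma integral_prod_measure:
  assumes "bounded_borel prod_measure f"
  shows "(\<integral>\<zeta>. f \<zeta> \<partial>prod_measure) = (\<integral>p. \<integral>r. f (p, r) \<partial>(torus_measure \<Otimes>\<^sub>M torus_measure) \<partial>(tm \<Otimes>\<^sub>M tm))"
proof -
  interpret pair_sigma_finite "tm \<Otimes>\<^sub>M tm" "torus_measure \<Otimes>\<^sub>M torus_measure"
    using sigma_finite by (simp add: pair_sigma_finite_def)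
  show ?thesis
    using integral_fst'[of f] bounded_borel_integrable[OF finite_pairs(3) assms] by (simp add: prod_measure_def)
qed

lemma integral_prod_measure_product:
  assumes a: "bounded_borel (borel \<Otimes>\<^sub>M borel) a" and b: "bounded_borel (borel \<Otimes>\<^sub>M borel) b"
  shows "(\<integral>\<zeta>. a (pX \<zeta>) * b (pY \<zeta>) \<partial>prod_measure) = dint a * dint b"
proof -
  have "(\<integral>\<zeta>. a (pX \<zeta>) * b (pY \<zeta>) \<partial>prod_measure)
     = (\<integral>p. \<integral>r. a (fst p, fst r) * b (snd p, snd r) \<partial>(torus_measure \<Otimes>\<^sub>M torus_measure) \<partial>(tm \<Otimes>\<^sub>M tm))"
    by (subst integral_prod_measure, intro bounded_borel_mult bounded_borel_pX bounded_borel_pY a b) (simp add: pX_def pY_def)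
  also have "\<dots> = (\<integral>p. (\<integral>x. a (fst p, x) \<partial>torus_measure) * (\<integral>y. b (snd p, y) \<partial>torus_measure) \<partial>(tm \<Otimes>\<^sub>M tm))"
    by (intro Bochner_Integration.integral_cong refl integral_pair_product(2)[OF sigma_finite(2) sigma_finite(2), of "\<lambda>x. a (_, x)" "\<lambda>y. b (_, y)"]
         bounded_borel_integrable[OF finite_torus_measure] bounded_borel_section a b)
  also have "\<dots> = dint a * dint b" unfolding dint_def
    by (rule integral_pair_product(2)[OF sigma_finite(1) sigma_finite(1)])
       (intro bounded_borel_integrable[OF finite_tm] bounded_borel_tm bounded_borel_inner_integral a b)+
  finally show ?thesis .
qed

text \<open>For fixed times the form splits over frequencies, and the time phases are unimodular.
  Cauchy--Schwarz in the frequency and Bessel's inequality in space then give the constant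
  \<open>2 * pi\<close>, independent of \<open>N\<close>; only \<open>\<kappa>\<close> couples the
  two times.\<close>

lemma operator_bound:
  assumes g: "bounded_borel (borel \<Otimes>\<^sub>M borel) g" and h: "bounded_borel (borel \<Otimes>\<^sub>M borel) h"
    and \<kappa>: "bounded_borel (borel \<Otimes>\<^sub>M borel) (\<kappa> :: real \<times> real \<Rightarrow> complex)"
  shows "norm (\<integral>\<zeta>. \<kappa> (fst \<zeta>) * (g (pX \<zeta>) * h (pY \<zeta>) * kernel N (fst (pX \<zeta>) - fst (pY \<zeta>)) (snd (pX \<zeta>) - snd (pY \<zeta>))) \<partial>prod_measure)
    \<le> (\<integral>p. norm (\<kappa> p) * (2 * pi * (sqrt (\<integral>x. (norm (g (fst p, x)))\<^sup>2 \<partial>torus_measure) * sqrt (\<integral>y. (norm (h (snd p, y)))\<^sup>2 \<partial>torus_measure))) \<partial>(tm \<Otimes>\<^sub>M tm))"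
proof -
  let ?S = "{- int N..int N}"
  let ?T = torus_measure
  let ?F = "\<lambda>\<zeta>. \<kappa> (fst \<zeta>) * (g (pX \<zeta>) * h (pY \<zeta>) * (\<Sum>n\<in>?S. wave n (pX \<zeta>) * cnj (wave n (pY \<zeta>))))"
  have bF: "bounded_borel prod_measure ?F" by (intro bounded_borel_mult bounded_borel_sum bounded_borel_cnj bounded_borel_pX bounded_borel_pY bounded_borel_fst bounded_borel_wave g h \<kappa>)
  have inner: "norm (\<integral>r. ?F (p, r) \<partial>(?T \<Otimes>\<^sub>M ?T))
     \<le> norm (\<kappa> p) * (2 * pi * (sqrt (\<integral>x. (norm (g (fst p, x)))\<^sup>2 \<partial>?T) * sqrt (\<integral>y. (norm (h (snd p, y)))\<^sup>2 \<partial>?T)))" for p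
  proof -
    obtain t s where p: "p = (t, s)" by force
    define a where "a n = (\<integral>x. g (t, x) * wave n (t, x) \<partial>?T)" for n
    define b where "b n = (\<integral>y. h (s, y) * cnj (wave n (s, y)) \<partial>?T)" for n
    have ib: "integrable ?T (\<lambda>x. g (t, x) * wave n (t, x))" "integrable ?T (\<lambda>y. h (s, y) * cnj (wave n (s, y)))" for n
      by (intro bounded_borel_integrable[OF finite_torus_measure] bounded_borel_mult bounded_borel_cnj bounded_borel_section g h bounded_borel_wave)+
    note pr = integral_pair_product[OF sigma_finite(2) sigma_finite(2) ib]
    have "(\<integral>r. ?F (p, r) \<partial>(?T \<Otimes>\<^sub>M ?T)) = (\<integral>r. \<kappa> p * (\<Sum>n\<in>?S. (g (t, fst r) * wave n (t, fst r)) * (h (s, snd r) * cnj (wave n (s, snd r)))) \<partial>(?T \<Otimes>\<^sub>M ?T))"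
      by (intro Bochner_Integration.integral_cong refl) (simp add: pX_def pY_def p sum_distrib_left mult_ac)
    also have "\<dots> = \<kappa> p * (\<Sum>n\<in>?S. a n * b n)"
      using pr by (simp add: a_def b_def)
    finally have "norm (\<integral>r. ?F (p, r) \<partial>(?T \<Otimes>\<^sub>M ?T)) = norm (\<kappa> p) * norm (\<Sum>n\<in>?S. a n * b n)" by (simp only: norm_mult)
    also have "\<dots> \<le> norm (\<kappa> p) * (sqrt (2 * pi * (\<integral>x. (norm (g (t, x)))\<^sup>2 \<partial>?T)) * sqrt (2 * pi * (\<integral>y. (norm (h (s, y)))\<^sup>2 \<partial>?T)))"
    proof (intro mult_left_mono order_trans[OF sum_norm_mult_le_sqrt] mult_mono real_sqrt_le_mono)
      have na: "norm (a n) = norm (\<integral>x. g (t, x) * cis (x * of_int n) \<partial>?T)" for n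
      proof -
        have "a n = (\<integral>x. cis (t * dispersion n) * (g (t, x) * cis (x * of_int n)) \<partial>?T)"
          unfolding a_def wave_def by (intro Bochner_Integration.integral_cong refl) (simp add: cis_mult[symmetric])
        then show ?thesis by (simp add: norm_mult)
      qed
      have nb: "norm (b n) = norm (\<integral>y. cnj (h (s, y)) * cis (y * of_int n) \<partial>?T)" for n
      proof -
        have "b n = (\<integral>y. cis (- (s * dispersion n)) * cnj (cnj (h (s, y)) * cis (y * of_int n)) \<partial>?T)"
          unfolding b_def wave_def by (intro Bochner_Integration.integral_cong refl) (simp add: cis_cnj cis_mult[symmetric])
        also have "\<dots> = cis (- (s * dispersion n)) * cnj (\<integral>y. cnj (h (s, y)) * cis (y * of_int n) \<partial>?T)"
          by (simp only: integral_mult_right_zero Bochner_Integration.integral_cnj)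
        finally show ?thesis by (simp add: norm_mult)
      qed
      have sq: "square_integrable ?T (\<lambda>x. k (t, x))" if "bounded_borel (borel \<Otimes>\<^sub>M borel) k" for k t
        unfolding square_integrable_def power2_eq_square
        by (intro conjI bounded_borel_integrable[OF finite_torus_measure] bounded_borel_mult bounded_borel_norm bounded_borel_measurable[of ?T] bounded_borel_section that)
      show "(\<Sum>n\<in>?S. (norm (a n))\<^sup>2) \<le> 2 * pi * (\<integral>x. (norm (g (t, x)))\<^sup>2 \<partial>?T)"
        unfolding na by (rule torus_Bessel) (auto intro: sq g)
      have "(\<Sum>n\<in>?S. (norm (b n))\<^sup>2) \<le> 2 * pi * (\<integral>y. (norm (cnj (h (s, y))))\<^sup>2 \<partial>?T)"
        unfolding nb by (rule torus_Bessel) (auto intro: sq[of "\<lambda>z. cnj (h z)"] bounded_borel_cnj h)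
      then show "(\<Sum>n\<in>?S. (norm (b n))\<^sup>2) \<le> 2 * pi * (\<integral>y. (norm (h (s, y)))\<^sup>2 \<partial>?T)" by simp
    qed (auto intro: sum_nonneg)
    also have "sqrt (2 * pi * (\<integral>x. (norm (g (t, x)))\<^sup>2 \<partial>?T)) * sqrt (2 * pi * (\<integral>y. (norm (h (s, y)))\<^sup>2 \<partial>?T))
       = 2 * pi * (sqrt (\<integral>x. (norm (g (t, x)))\<^sup>2 \<partial>?T) * sqrt (\<integral>y. (norm (h (s, y)))\<^sup>2 \<partial>?T))"
    proof -
      have "sqrt (c * a) * sqrt (c * b) = c * (sqrt a * sqrt b)" if "0 \<le> c" for a b c :: real
      proof -
        have "sqrt (c * a) * sqrt (c * b) = (sqrt c * sqrt c) * (sqrt a * sqrt b)" by (simp add: real_sqrt_mult)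
        then show ?thesis using that by simp
      qed
      then show ?thesis by simp
    qed
    finally show ?thesis by (simp add: p)
  qed
  have sqb: "bounded_borel borel (\<lambda>t. sqrt (\<integral>x. (norm (k (t, x)))\<^sup>2 \<partial>?T))" if k: "bounded_borel (borel \<Otimes>\<^sub>M borel) (k :: real \<times> real \<Rightarrow> complex)" for k
  proof -
    have "bounded_borel (borel \<Otimes>\<^sub>M borel) (\<lambda>z. (norm (k z))\<^sup>2)"
      unfolding power2_eq_square by (intro bounded_borel_mult bounded_borel_norm k)
    from bounded_borel_inner_integral[OF this] obtain C where
      C: "\<And>t. norm (\<integral>x. (norm (k (t, x)))\<^sup>2 \<partial>?T) \<le> C" and [measurable]: "(\<lambda>t. \<integral>x. (norm (k (t, x)))\<^sup>2 \<partial>?T) \<in> borel_measurable borel"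
      by (auto simp: bounded_borel_def)
    show ?thesis
    proof (rule bounded_borelI[of _ _ "sqrt C"])
      show "norm (sqrt (\<integral>x. (norm (k (t, x)))\<^sup>2 \<partial>?T)) \<le> sqrt C" for t using C[of t] by simp
    qed measurable
  qed
  have "norm (\<integral>\<zeta>. ?F \<zeta> \<partial>prod_measure) = norm (\<integral>p. \<integral>r. ?F (p, r) \<partial>(?T \<Otimes>\<^sub>M ?T) \<partial>(tm \<Otimes>\<^sub>M tm))"
    by (simp only: integral_prod_measure[OF bF])
  also have "\<dots> \<le> (\<integral>p. norm (\<integral>r. ?F (p, r) \<partial>(?T \<Otimes>\<^sub>M ?T)) \<partial>(tm \<Otimes>\<^sub>M tm))" by (rule integral_norm_bound)
  also have "\<dots> \<le> (\<integral>p. norm (\<kappa> p) * (2 * pi * (sqrt (\<integral>x. (norm (g (fst p, x)))\<^sup>2 \<partial>?T) * sqrt (\<integral>y. (norm (h (snd p, y)))\<^sup>2 \<partial>?T))) \<partial>(tm \<Otimes>\<^sub>M tm))"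
  proof (rule integral_mono)
    interpret pair_sigma_finite "tm \<Otimes>\<^sub>M tm" "?T \<Otimes>\<^sub>M ?T"
      using sigma_finite by (simp add: pair_sigma_finite_def)
    have "integrable ((tm \<Otimes>\<^sub>M tm) \<Otimes>\<^sub>M (?T \<Otimes>\<^sub>M ?T)) ?F" using bounded_borel_integrable[OF finite_pairs(3) bF] by (simp add: prod_measure_def)
    from integrable_norm[OF integrable_fst'[OF this]]
    show "integrable (tm \<Otimes>\<^sub>M tm) (\<lambda>p. norm (\<integral>r. ?F (p, r) \<partial>(?T \<Otimes>\<^sub>M ?T)))" .
    show "integrable (tm \<Otimes>\<^sub>M tm) (\<lambda>p. norm (\<kappa> p) * (2 * pi * (sqrt (\<integral>x. (norm (g (fst p, x)))\<^sup>2 \<partial>?T) * sqrt (\<integral>y. (norm (h (snd p, y)))\<^sup>2 \<partial>?T))))"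
      by (intro bounded_borel_integrable[OF finite_pairs(1)] bounded_borel_mult bounded_borel_const bounded_borel_norm
           bounded_borel_compose[OF sqb[OF g]] bounded_borel_compose[OF sqb[OF h]] bounded_borel_compose[OF \<kappa>, of "\<lambda>x. x"]) measurable
  qed (rule inner)
  finally show ?thesis by (simp only: kernel_eq_sum_waves)
qed

text \<open>The truncation at \<open>N\<^sup>-\<^sup>2\<close> keeps all powers bounded; below it the trivial bound on the kernel replaces the dispersive one. The cap at 1 is inactive on the slab.\<close>

definition tdist :: "real \<times> real \<Rightarrow> real" where
  "tdist p = min 1 (max \<bar>fst p - snd p\<bar> (1 / (real N)\<^sup>2))"

lemma tdist_measurable [measurable]: "tdist \<in> borel_measurable (borel \<Otimes>\<^sub>M borel)"
  unfolding tdist_def[abs_def] by measurable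

lemma tdist_bounds: "1 / (real N)\<^sup>2 \<le> tdist p" "tdist p \<le> 1" "0 < tdist p"
proof -
  have "1 / (real N)\<^sup>2 \<le> 1" "0 < 1 / (real N)\<^sup>2" using N by auto
  then show "1 / (real N)\<^sup>2 \<le> tdist p" "tdist p \<le> 1" "0 < tdist p" by (auto simp: tdist_def less_max_iff_disj)
qed

lemma tdist_slab:
  assumes "t \<in> slab" "s \<in> slab"
  shows "tdist (t, s) = max \<bar>t - s\<bar> (1 / (real N)\<^sup>2)"
proof -
  have "\<bar>t - s\<bar> * 1 \<le> \<bar>t - s\<bar> * real N" using N by (intro mult_left_mono) auto
  from order_trans[OF this slab_diff[OF assms]] have "\<bar>t - s\<bar> \<le> 1" by simp
  moreover have "1 / (real N)\<^sup>2 \<le> 1" using N by auto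
  ultimately show ?thesis by (simp add: tdist_def)
qed

text \<open>2025 is the square of the dispersive constant 45. Below the truncation the trivial bound
  \<open>3 * N\<close> fits with room to spare.\<close>

lemma kernel_tdist_bound:
  assumes "t \<in> slab" "s \<in> slab"
  shows "(norm (kernel N (t - s) x))\<^sup>2 \<le> 2025 / tdist (t, s)"
proof (cases "1 / (real N)\<^sup>2 \<le> \<bar>t - s\<bar>")
  case True
  then have ts: "tdist (t, s) = \<bar>t - s\<bar>" "t - s \<noteq> 0" using tdist_slab[OF assms] tdist_bounds(3)[of "(t, s)"] by auto
  have "(norm (kernel N (t - s) x))\<^sup>2 \<le> (45 / sqrt \<bar>t - s\<bar>)\<^sup>2"
    by (intro power_mono dispersive_estimate N ts(2) slab_diff assms) auto
  then show ?thesis using ts by (simp add: power_divide)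
next
  case False
  then have ts: "tdist (t, s) = 1 / (real N)\<^sup>2" using tdist_slab[OF assms] by auto
  have "norm (kernel N (t - s) x) \<le> 3 * real N" using norm_kernel_le[of N "t - s" x] N by linarith
  then have "(norm (kernel N (t - s) x))\<^sup>2 \<le> (3 * real N)\<^sup>2" by (intro power_mono) auto
  also have "\<dots> \<le> 2025 * (real N)\<^sup>2" by (simp add: power_mult_distrib)
  finally show ?thesis using ts by simp
qed

lemma nn_integral_tm_pair:
  assumes [measurable]: "f \<in> borel_measurable (borel \<Otimes>\<^sub>M borel)"
  shows "(\<integral>\<^sup>+ p. f p \<partial>(tm \<Otimes>\<^sub>M tm)) = (\<integral>\<^sup>+ t. \<integral>\<^sup>+ s. f (t, s) * indicator slab s * indicator slab t \<partial>lborel \<partial>lborel)"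
proof -
  have "(\<integral>\<^sup>+ p. f p \<partial>(tm \<Otimes>\<^sub>M tm)) = (\<integral>\<^sup>+ t. \<integral>\<^sup>+ s. f (t, s) \<partial>tm \<partial>tm)"
    by (subst sigma_finite_measure.nn_integral_fst[OF sigma_finite(1), symmetric]) auto
  also have "\<dots> = (\<integral>\<^sup>+ t. (\<integral>\<^sup>+ s. f (t, s) * indicator slab s \<partial>lborel) * indicator slab t \<partial>lborel)"
    unfolding tm_def by (simp add: nn_integral_interval_measure_on)
  also have "\<dots> = (\<integral>\<^sup>+ t. \<integral>\<^sup>+ s. f (t, s) * indicator slab s * indicator slab t \<partial>lborel \<partial>lborel)"
    by (intro nn_integral_cong nn_integral_multc[symmetric]) measurable
  finally show ?thesis .
qed

text \<open>The kernel bound holds only for two times in the slab, so the comparison is asked there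
  and nowhere else.\<close>

lemma nn_integral_tm_pair_mono:
  assumes [measurable]: "f \<in> borel_measurable (borel \<Otimes>\<^sub>M borel)" "g \<in> borel_measurable (borel \<Otimes>\<^sub>M borel)"
    and le: "\<And>t s. t \<in> slab \<Longrightarrow> s \<in> slab \<Longrightarrow> f (t, s) \<le> g (t, s)"
  shows "(\<integral>\<^sup>+ p. f p \<partial>(tm \<Otimes>\<^sub>M tm)) \<le> (\<integral>\<^sup>+ p. g p \<partial>(tm \<Otimes>\<^sub>M tm))"
  by (simp add: nn_integral_tm_pair, intro nn_integral_mono) (auto simp: indicator_def le)

lemma slab_HLS:
  assumes b: "0 < b" "b < 1" and G[measurable]: "G \<in> borel_measurable borel" and G0: "\<And>t. 0 \<le> G t"
    and G1: "(\<integral>\<^sup>+ t. ennreal (G t powr (2 / (2 - b))) \<partial>tm) \<le> 1"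
  shows "(\<integral>\<^sup>+ p. ennreal (G (fst p) * G (snd p) * tdist p powr - b) \<partial>(tm \<Otimes>\<^sub>M tm)) \<le> ennreal (4 / (1 - b) + 6)"
proof -
  define H where "H t = G t * indicator slab t" for t
  have [measurable]: "H \<in> borel_measurable borel" unfolding H_def by measurable
  define d where "d = 1 / (real N)\<^sup>2"
  have d: "d > 0" using N by (simp add: d_def)
  have "(\<integral>\<^sup>+ p. ennreal (G (fst p) * G (snd p) * tdist p powr - b) \<partial>(tm \<Otimes>\<^sub>M tm))
      = (\<integral>\<^sup>+ t. \<integral>\<^sup>+ s. ennreal (H t * H s * max \<bar>t - s\<bar> d powr - b) \<partial>lborel \<partial>lborel)"
    by (subst nn_integral_tm_pair, measurable) (intro nn_integral_cong, auto simp: H_def indicator_def tdist_slab d_def)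
  also have "\<dots> \<le> ennreal (4 / (1 - b) + 6)"
  proof (rule Hardy_Littlewood_Sobolev[OF b d])
    have "(\<integral>\<^sup>+ t. ennreal (H t powr (2 / (2 - b))) \<partial>lborel) = (\<integral>\<^sup>+ t. ennreal (G t powr (2 / (2 - b))) * indicator slab t \<partial>lborel)"
      by (intro nn_integral_cong) (auto simp: H_def indicator_def)
    also have "\<dots> = (\<integral>\<^sup>+ t. ennreal (G t powr (2 / (2 - b))) \<partial>tm)"
      unfolding tm_def by (simp add: nn_integral_interval_measure_on)
    finally show "(\<integral>\<^sup>+ t. ennreal (H t powr (2 / (2 - b))) \<partial>lborel) \<le> 1" using G1 by simp
  qed (auto simp: H_def G0)
  finally show ?thesis .
qed

end

section \<open>The interpolation argument\<close>

text \<open>The sum of the bounds on the two boundary lines, since one constant must serve both. The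
  first is the Bessel factor \<open>2 * pi\<close> times the Hardy--Littlewood--Sobolev constant for
  \<open>\<tau> / 2\<close>, the second the dispersive 45 times the square root of the one for
  \<open>\<tau>\<close>.\<close>

definition interp_const :: "real \<Rightarrow> real" where
  "interp_const \<tau> = 2 * pi * (4 / (1 - \<tau> / 2) + 6) + 45 * sqrt (4 / (1 - \<tau>) + 6)"

context time_slab
begin

lemma dint_cnj: "dint (\<lambda>z. cnj (f z)) = cnj (dint f)"
  unfolding dint_def by (simp only: Bochner_Integration.integral_cnj)

lemma dint_of_real: "dint (\<lambda>z. of_real (f z)) = of_real (\<integral>t. \<integral>x. f (t, x) \<partial>torus_measure \<partial>tm)"
  unfolding dint_def by simp

lemma dint_cmult: "dint (\<lambda>z. c * f z) = c * dint f"
  unfolding dint_def by simp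

lemma dint_sum:
  assumes "\<And>i. i \<in> I \<Longrightarrow> bounded_borel (borel \<Otimes>\<^sub>M borel) (f i)"
  shows "dint (\<lambda>z. \<Sum>i\<in>I. f i z) = (\<Sum>i\<in>I. dint (f i))"
  unfolding dint_def
  by (subst Bochner_Integration.integral_sum, intro bounded_borel_integrable[OF finite_torus_measure] bounded_borel_section assms, assumption,
      subst Bochner_Integration.integral_sum) (intro bounded_borel_integrable[OF finite_tm] bounded_borel_tm bounded_borel_inner_integral assms refl | assumption)+

end

text \<open>The exponents are dual to those of the density: \<open>1 / \<tau>\<close> is conjugate
  to \<open>q\<close> and \<open>2 / (2 - \<tau>)\<close> is conjugate to
  \<open>p = 2 / \<tau>\<close>. By \<open>V_norm\<close>, \<open>v t\<close> is the spatial norm of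
  \<open>V (t, _)\<close>. The bounds \<open>m\<close> and \<open>M\<close> serve only qualitative
  boundedness.\<close>

locale weighted_slab = time_slab +
  fixes \<tau> m M :: real and V :: "real \<times> real \<Rightarrow> real" and v :: "real \<Rightarrow> real"
  assumes tau: "0 < \<tau>" "\<tau> < 1" and m: "0 < m"
    and V_measurable [measurable]: "V \<in> borel_measurable (borel \<Otimes>\<^sub>M borel)"
    and v_measurable [measurable]: "v \<in> borel_measurable borel"
    and V_bounds: "\<And>z. m \<le> V z" "\<And>z. V z \<le> M" and v_bounds: "\<And>t. m \<le> v t" "\<And>t. v t \<le> M"
    and V_norm: "\<And>t. (\<integral>x. (V (t, x) / v t) powr (1 / \<tau>) \<partial>torus_measure) = 1"
    and v_norm: "(\<integral>\<^sup>+ t. ennreal (v t powr (2 / (2 - \<tau>))) \<partial>tm) \<le> 1"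
begin

lemma V_pos: "0 < V z" and v_pos: "0 < v t"
  using m V_bounds(1)[of z] v_bounds(1)[of t] by linarith+

lemma bounded_V: "bounded_borel (borel \<Otimes>\<^sub>M borel) V"
  by (rule bounded_borelI[of _ _ M]) (use V_pos V_bounds in \<open>auto simp: less_imp_le\<close>)

text \<open>Two factors of different origin: \<open>sqrt V\<close> belongs to the eigenfunction
  \<open>sqrt V * u k\<close>, while \<open>sqrt v\<close> is the square root of the interpolated
  weight at exponent 0.\<close>

definition amp :: "real \<times> real \<Rightarrow> real" where "amp z = sqrt (V z) * sqrt (v (fst z))"

text \<open>\<open>exp (z * lr)\<close> is the power \<open>z / (2 * \<tau>)\<close> of
  \<open>V / v\<close>, the analytic part of the square root of the interpolated weight.\<close>

definition lr :: "real \<times> real \<Rightarrow> real" where "lr z = ln (V z / v (fst z)) / (2 * \<tau>)"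

lemma amp_measurable [measurable]: "amp \<in> borel_measurable (borel \<Otimes>\<^sub>M borel)"
  unfolding amp_def[abs_def] by measurable

lemma lr_measurable [measurable]: "lr \<in> borel_measurable (borel \<Otimes>\<^sub>M borel)"
  unfolding lr_def[abs_def] by measurable

lemma amp_nonneg: "0 \<le> amp z"
  using V_pos[of z] v_pos[of "fst z"] by (simp add: amp_def)

lemma amp_sq: "(amp z)\<^sup>2 = V z * v (fst z)"
  using V_pos[of z] v_pos[of "fst z"] by (simp add: amp_def power_mult_distrib)

lemma bounded_amp: "bounded_borel (borel \<Otimes>\<^sub>M borel) amp"
proof (rule bounded_borelI[of _ _ "sqrt M * sqrt M"])
  fix z
  have "norm (amp z) = sqrt (V z) * sqrt (v (fst z))" using amp_nonneg[of z] by (simp add: amp_def)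
  also have "\<dots> \<le> sqrt M * sqrt M"
    using V_bounds[of z] v_bounds[of "fst z"] m by (intro mult_mono real_sqrt_le_mono) auto
  finally show "norm (amp z) \<le> sqrt M * sqrt M" .
qed measurable

lemma bounded_lr: "\<bar>lr z\<bar> \<le> ln (M / m) / (2 * \<tau>)"
proof -
  have M: "M > 0" "m \<le> M" using V_bounds[of z] m by linarith+
  have "V z / v (fst z) \<le> M / m" using V_bounds[of z] v_bounds[of "fst z"] m M by (intro frac_le) auto
  moreover have "m / M \<le> V z / v (fst z)" using V_bounds[of z] v_bounds[of "fst z"] m V_pos v_pos by (intro frac_le) (auto simp: less_imp_le)
  moreover have "0 < V z / v (fst z)" using V_pos v_pos by simp
  ultimately have "ln (V z / v (fst z)) \<le> ln (M / m)" "ln (m / M) \<le> ln (V z / v (fst z))"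
    using m M by (auto intro!: ln_mono)
  moreover have "ln (m / M) = - ln (M / m)" using m M by (simp add: ln_div)
  ultimately have "\<bar>ln (V z / v (fst z))\<bar> \<le> ln (M / m)" by linarith
  then show ?thesis using tau by (simp add: lr_def divide_right_mono)
qed

text \<open>The two places where the family is evaluated: the point \<open>\<tau>\<close> gives back
  \<open>V\<close>, and on the line \<open>Re z = 1\<close> the squared modulus is the density
  normalised by \<open>V_norm\<close>.\<close>

lemma exp_lr: "exp (\<tau> * lr z) * amp z = V z" "exp (2 * lr z) = (V z / v (fst z)) powr (1 / \<tau>)"
proof -
  have p: "0 < V z / v (fst z)" using V_pos v_pos by simp
  have "exp (\<tau> * lr z) = (V z / v (fst z)) powr (1 / 2)"
    using p tau V_pos[of z] v_pos[of "fst z"] by (simp add: lr_def powr_def)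
  also have "\<dots> = sqrt (V z / v (fst z))" using p by (simp add: powr_half_sqrt)
  finally show "exp (\<tau> * lr z) * amp z = V z"
    using V_pos[of z] v_pos[of "fst z"] by (simp add: amp_def real_sqrt_divide)
  show "exp (2 * lr z) = (V z / v (fst z)) powr (1 / \<tau>)"
    using p tau V_pos[of z] v_pos[of "fst z"] by (simp add: lr_def powr_def)
qed

text \<open>Everything multiplied by \<open>z\<close> in the exponent. Together with the power
  \<open>- \<tau> / 2\<close> in \<open>Amp\<close>, its last term inserts \<open>tdist\<close> to
  the power \<open>(z - \<tau>) / 2\<close>, which is trivial at \<open>z = \<tau>\<close>.\<close>

definition phase :: "(real \<times> real) \<times> (real \<times> real) \<Rightarrow> real" where
  "phase \<zeta> = lr (pX \<zeta>) + lr (pY \<zeta>) + ln (tdist (fst \<zeta>)) / 2"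

lemma phase_measurable [measurable]: "phase \<in> borel_measurable prod_measure"
  unfolding phase_def[abs_def] by measurable

lemma ln_tdist_bound: "\<bar>ln (tdist p)\<bar> \<le> ln ((real N)\<^sup>2)"
proof -
  have "ln (1 / (real N)\<^sup>2) \<le> ln (tdist p)" using tdist_bounds[of p] N by (intro ln_mono) auto
  moreover have "ln (tdist p) \<le> 0" using tdist_bounds[of p] by simp
  ultimately show ?thesis using N by (simp add: ln_div)
qed

lemma phase_bound: "\<bar>phase \<zeta>\<bar> \<le> 2 * (ln (M / m) / (2 * \<tau>)) + ln ((real N)\<^sup>2) / 2"
  using bounded_lr[of "pX \<zeta>"] bounded_lr[of "pY \<zeta>"] ln_tdist_bound[of "fst \<zeta>"]
  unfolding phase_def by linarith

end

text \<open>The \<open>\<mu> k\<close> are positive eigenvalues of the Gram matrix with unit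
  eigenvectors \<open>e k\<close>. The weights \<open>d\<close> are free: a linear bound valid for
  all of them is a Schatten bound by duality.\<close>

locale eigen_slab = weighted_slab +
  fixes J :: "nat set" and e :: "nat \<Rightarrow> int \<Rightarrow> complex" and \<mu> d :: "nat \<Rightarrow> real"
  assumes J: "finite J" and mu_pos: "\<And>k. k \<in> J \<Longrightarrow> 0 < \<mu> k" and d_pos: "\<And>k. k \<in> J \<Longrightarrow> 0 < d k"
    and d_sum: "(\<Sum>k\<in>J. d k) \<le> 1"
    and orth: "\<And>k l. k \<in> J \<Longrightarrow> l \<in> J \<Longrightarrow>
      dint (\<lambda>z. of_real (V z) * ((\<Sum>n\<in>{- int N..int N}. e k n * wave n z) * cnj (\<Sum>n\<in>{- int N..int N}. e l n * wave n z)))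
        = (if k = l then of_real (\<mu> k) else 0)"
    and eig: "\<And>k n. k \<in> J \<Longrightarrow> n \<in> {- int N..int N} \<Longrightarrow>
      dint (\<lambda>z. of_real (V z) * ((\<Sum>n\<in>{- int N..int N}. e k n * wave n z) * cnj (wave n z))) = of_real (\<mu> k) * e k n"
    and unit: "\<And>k. k \<in> J \<Longrightarrow> (\<Sum>n\<in>{- int N..int N}. (norm (e k n))\<^sup>2) = 1"
begin

definition u :: "nat \<Rightarrow> real \<times> real \<Rightarrow> complex" where
  "u k z = (\<Sum>n\<in>{- int N..int N}. e k n * wave n z)"

definition Ker :: "(real \<times> real) \<times> (real \<times> real) \<Rightarrow> complex" where
  "Ker \<zeta> = kernel N (fst (pX \<zeta>) - fst (pY \<zeta>)) (snd (pX \<zeta>) - snd (pY \<zeta>))"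

definition Amp :: "nat \<Rightarrow> (real \<times> real) \<times> (real \<times> real) \<Rightarrow> complex" where
  "Amp k \<zeta> = of_real (tdist (fst \<zeta>) powr (- \<tau> / 2)) *
     ((cnj (u k (pX \<zeta>)) * of_real (amp (pX \<zeta>))) * (u k (pY \<zeta>) * of_real (amp (pY \<zeta>))) * Ker \<zeta>)"

definition I :: "nat \<Rightarrow> complex \<Rightarrow> complex" where
  "I k z = (\<integral>\<zeta>. exp (z * of_real (phase \<zeta>)) * Amp k \<zeta> \<partial>prod_measure)"

text \<open>This is \<open>d k\<close> to the power \<open>1 - z / 2\<close>, divided by
  \<open>\<mu> k\<close>, the squared norm of \<open>sqrt V * u k\<close>. Its modulus is
  \<open>d k / \<mu> k\<close> on the line \<open>Re z = 0\<close> and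
  \<open>sqrt (d k) / \<mu> k\<close> on \<open>Re z = 1\<close>.\<close>

definition coef :: "nat \<Rightarrow> complex \<Rightarrow> complex" where
  "coef k z = exp (- z * of_real (ln (d k) / 2)) * of_real (d k / \<mu> k)"

text \<open>The trace of the interpolated operator against the operator that is diagonal in the
  normalised functions \<open>sqrt V * u k\<close>, with entries \<open>d k\<close> to the power
  \<open>1 - z / 2\<close>.\<close>

definition F :: "complex \<Rightarrow> complex" where
  "F z = (\<Sum>k\<in>J. coef k z * I k z)"

lemma bounded_u: "bounded_borel (borel \<Otimes>\<^sub>M borel) (u k)"
  unfolding u_def by (intro bounded_borel_sum bounded_borel_mult bounded_borel_const bounded_borel_wave)

lemma u_measurable [measurable]: "u k \<in> borel_measurable (borel \<Otimes>\<^sub>M borel)"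
  using bounded_u by (rule bounded_borel_measurable)

lemma Ker_eq: "Ker \<zeta> = (\<Sum>n\<in>{- int N..int N}. wave n (pX \<zeta>) * cnj (wave n (pY \<zeta>)))"
  unfolding Ker_def by (rule kernel_eq_sum_waves)

lemma bounded_Ker: "bounded_borel prod_measure Ker"
  unfolding Ker_eq[abs_def] by (intro bounded_borel_sum bounded_borel_mult bounded_borel_cnj bounded_borel_pX bounded_borel_pY bounded_borel_wave)

lemma Ker_measurable [measurable]: "Ker \<in> borel_measurable prod_measure"
  using bounded_Ker by (rule bounded_borel_measurable)

lemma bounded_tdist_powr: "bounded_borel (borel \<Otimes>\<^sub>M borel) (\<lambda>p. tdist p powr (- b))" if "0 \<le> b"
proof (rule bounded_borelI[of _ _ "(1 / (real N)\<^sup>2) powr (- b)"])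
  fix p
  show "norm (tdist p powr (- b)) \<le> (1 / (real N)\<^sup>2) powr (- b)"
    using tdist_bounds[of p] N that by (auto intro!: powr_mono2')
qed measurable

lemma bounded_Amp: "bounded_borel prod_measure (Amp k)"
proof -
  have "bounded_borel prod_measure (\<lambda>\<zeta>. tdist (fst \<zeta>) powr - (\<tau> / 2))"
    using tau by (intro bounded_borel_fst[OF bounded_tdist_powr]) auto
  then show ?thesis unfolding Amp_def
    by (intro bounded_borel_mult bounded_borel_of_real bounded_borel_cnj bounded_borel_pX bounded_borel_pY bounded_u bounded_amp bounded_Ker) simp
qed

lemma Amp_integrable: "integrable prod_measure (Amp k)"
  by (rule bounded_borel_integrable[OF finite_pairs(3) bounded_Amp])

lemmas I_exp = holomorphic_exp_integral[OF Amp_integrable phase_measurable phase_bound]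

lemma F_holomorphic: "F holomorphic_on UNIV"
  unfolding F_def I_def coef_def by (intro holomorphic_intros I_exp(1))

text \<open>Only the qualitative hypothesis of the maximum principle; this bound may depend on
  \<open>N\<close>, \<open>m\<close> and \<open>M\<close>.\<close>

lemma F_bounded: "\<exists>B. \<forall>z. 0 \<le> Re z \<longrightarrow> Re z \<le> 1 \<longrightarrow> norm (F z) \<le> B"
proof -
  define b where "b = 2 * (ln (M / m) / (2 * \<tau>)) + ln ((real N)\<^sup>2) / 2"
  have b: "0 \<le> b" using phase_bound[of undefined] by (simp add: b_def)
  define B where "B k = (exp (\<bar>ln (d k) / 2\<bar>) * norm (complex_of_real (d k / \<mu> k))) * (exp b * (\<integral>x. norm (Amp k x) \<partial>prod_measure))" for k
  have "norm (F z) \<le> (\<Sum>k\<in>J. B k)" if z: "0 \<le> Re z" "Re z \<le> 1" for z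
    unfolding F_def
  proof (intro order_trans[OF norm_sum] sum_mono)
    fix k assume "k \<in> J"
    have "Re z * \<bar>ln (d k) / 2\<bar> \<le> 1 * \<bar>ln (d k) / 2\<bar>" using z by (intro mult_right_mono) auto
    then have 1: "Re (- z * of_real (ln (d k) / 2)) \<le> \<bar>ln (d k) / 2\<bar>"
      using z abs_ge_self[of "- (Re z * (ln (d k) / 2))"] by (simp add: abs_mult)
    have "norm (I k z) \<le> exp (\<bar>Re z\<bar> * b) * (\<integral>x. norm (Amp k x) \<partial>prod_measure)"
      unfolding I_def b_def by (rule I_exp(3))
    also have "\<dots> \<le> exp b * (\<integral>x. norm (Amp k x) \<partial>prod_measure)"
      using z b by (intro mult_right_mono) (auto intro: mult_left_le_one_le)
    finally have 2: "norm (I k z) \<le> exp b * (\<integral>x. norm (Amp k x) \<partial>prod_measure)" .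
    have 3: "norm (coef k z) \<le> exp (\<bar>ln (d k) / 2\<bar>) * norm (complex_of_real (d k / \<mu> k))"
      unfolding coef_def norm_mult norm_exp_eq_Re using 1 by (intro mult_right_mono) auto
    show "norm (coef k z * I k z) \<le> B k"
      unfolding B_def norm_mult[of "coef k z"] using 2 3 by (intro mult_mono) auto
  qed
  then show ?thesis by blast
qed

text \<open>At \<open>\<tau>\<close> the powers of \<open>tdist\<close> cancel and the weights
  become \<open>V\<close>. The kernel then splits over frequencies, which leaves the sum of squared
  moduli of the entries of Gram matrix times \<open>e k\<close>, that is of
  \<open>\<mu> k * e k n\<close>.\<close>

lemma I_tau: "k \<in> J \<Longrightarrow> I k (of_real \<tau>) = of_real ((\<mu> k)\<^sup>2)"
proof -
  assume k: "k \<in> J"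
  let ?S = "{- int N..int N}"
  define a where "a n z = of_real (V z) * (cnj (u k z) * wave n z)" for n z
  define b where "b n z = of_real (V z) * (u k z * cnj (wave n z))" for n z
  have ab: "bounded_borel (borel \<Otimes>\<^sub>M borel) (a n)" "bounded_borel (borel \<Otimes>\<^sub>M borel) (b n)" for n
    unfolding a_def b_def by (intro bounded_borel_mult bounded_borel_of_real bounded_borel_cnj bounded_V bounded_u bounded_borel_wave)+
  have "exp (of_real \<tau> * of_real (phase \<zeta>)) * Amp k \<zeta> = (\<Sum>n\<in>?S. a n (pX \<zeta>) * b n (pY \<zeta>))" for \<zeta>
  proof -
    have t: "exp (\<tau> * (ln (tdist (fst \<zeta>)) / 2)) * tdist (fst \<zeta>) powr (- \<tau> / 2) = 1"
      using tdist_bounds(3)[of "fst \<zeta>"] by (simp add: powr_def mult_exp_exp)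
    have "exp (of_real \<tau> * of_real (phase \<zeta>) :: complex) =
        of_real (exp (\<tau> * lr (pX \<zeta>)) * exp (\<tau> * lr (pY \<zeta>)) * exp (\<tau> * (ln (tdist (fst \<zeta>)) / 2)))"
    proof -
      have "exp (\<tau> * phase \<zeta>) = exp (\<tau> * lr (pX \<zeta>)) * exp (\<tau> * lr (pY \<zeta>)) * exp (\<tau> * (ln (tdist (fst \<zeta>)) / 2))"
        unfolding phase_def exp_add[symmetric] by (simp add: distrib_left)
      then show ?thesis by (simp only: of_real_mult[symmetric] exp_of_real)
    qed
    then have "exp (of_real \<tau> * of_real (phase \<zeta>)) * Amp k \<zeta> =
       of_real (exp (\<tau> * (ln (tdist (fst \<zeta>)) / 2)) * tdist (fst \<zeta>) powr (- \<tau> / 2))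
        * (of_real (exp (\<tau> * lr (pX \<zeta>)) * amp (pX \<zeta>)) * of_real (exp (\<tau> * lr (pY \<zeta>)) * amp (pY \<zeta>)) * (cnj (u k (pX \<zeta>)) * u k (pY \<zeta>) * Ker \<zeta>))"
      unfolding Amp_def of_real_mult by (simp only: mult_ac)
    also have "\<dots> = of_real (V (pX \<zeta>)) * of_real (V (pY \<zeta>)) * (cnj (u k (pX \<zeta>)) * u k (pY \<zeta>) * Ker \<zeta>)"
      unfolding t exp_lr by simp
    also have "\<dots> = (\<Sum>n\<in>?S. a n (pX \<zeta>) * b n (pY \<zeta>))"
      unfolding Ker_eq a_def b_def by (simp add: sum_distrib_left mult_ac)
    finally show ?thesis .
  qed
  then have "I k (of_real \<tau>) = (\<integral>\<zeta>. (\<Sum>n\<in>?S. a n (pX \<zeta>) * b n (pY \<zeta>)) \<partial>prod_measure)" by (simp add: I_def)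
  also have "\<dots> = (\<Sum>n\<in>?S. \<integral>\<zeta>. a n (pX \<zeta>) * b n (pY \<zeta>) \<partial>prod_measure)"
    by (rule Bochner_Integration.integral_sum)
       (intro bounded_borel_integrable[OF finite_pairs(3)] bounded_borel_mult bounded_borel_pX bounded_borel_pY ab)
  also have "\<dots> = (\<Sum>n\<in>?S. dint (a n) * dint (b n))" by (simp only: integral_prod_measure_product[OF ab])
  also have "\<dots> = (\<Sum>n\<in>?S. of_real ((\<mu> k)\<^sup>2) * of_real ((norm (e k n))\<^sup>2))"
  proof (rule sum.cong)
    fix n assume n: "n \<in> ?S"
    have bn: "dint (b n) = of_real (\<mu> k) * e k n" using eig[OF k n] by (simp add: b_def[abs_def] u_def)
    have "a n = (\<lambda>z. cnj (b n z))" by (simp add: a_def b_def fun_eq_iff)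
    then have "dint (a n) = cnj (of_real (\<mu> k) * e k n)" using dint_cnj[of "b n"] bn by simp
    then show "dint (a n) * dint (b n) = of_real ((\<mu> k)\<^sup>2) * of_real ((norm (e k n))\<^sup>2)"
      unfolding bn complex_norm_square by (simp add: power2_eq_square mult_ac)
  qed simp
  also have "\<dots> = of_real ((\<mu> k)\<^sup>2 * (\<Sum>n\<in>?S. (norm (e k n))\<^sup>2))" by (simp add: sum_distrib_left)
  finally show ?thesis using unit[OF k] by simp
qed

lemma F_tau: "F (of_real \<tau>) = of_real (\<Sum>k\<in>J. d k powr (1 - \<tau> / 2) * \<mu> k)"
proof -
  have "coef k (of_real \<tau>) * I k (of_real \<tau>) = of_real (d k powr (1 - \<tau> / 2) * \<mu> k)" if k: "k \<in> J" for k
  proof -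
    have "d k powr (1 - \<tau> / 2) = d k * d k powr (- \<tau> / 2)" using d_pos[OF k] powr_add[of "d k" 1 "- \<tau> / 2"] by simp
    also have "d k powr (- \<tau> / 2) = exp (- \<tau> * (ln (d k) / 2))" using d_pos[OF k] by (simp add: powr_def)
    finally have "d k powr (1 - \<tau> / 2) * \<mu> k = exp (- \<tau> * (ln (d k) / 2)) * (d k / \<mu> k) * (\<mu> k)\<^sup>2"
      using mu_pos[OF k] by (simp add: power2_eq_square)
    moreover have "coef k (of_real \<tau>) = of_real (exp (- \<tau> * (ln (d k) / 2)) * (d k / \<mu> k))"
      unfolding coef_def by (simp add: exp_of_real[symmetric])
    ultimately show ?thesis using I_tau[OF k] by simp
  qed
  then show ?thesis unfolding F_def by simp
qed

end

section \<open>Estimates on the two boundary lines of the strip\<close>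

context eigen_slab
begin

definition mass :: "nat \<Rightarrow> real \<Rightarrow> real" where
  "mass k t = (\<integral>x. V (t, x) * (norm (u k (t, x)))\<^sup>2 \<partial>torus_measure)"

lemma bounded_mass: "bounded_borel borel (mass k)"
proof -
  have "bounded_borel (borel \<Otimes>\<^sub>M borel) (\<lambda>z. V z * (norm (u k z))\<^sup>2)"
    unfolding power2_eq_square by (intro bounded_borel_mult bounded_borel_norm bounded_V bounded_u)
  from bounded_borel_inner_integral[OF this] show ?thesis by (simp add: mass_def[abs_def])
qed

lemma mass_measurable [measurable]: "mass k \<in> borel_measurable borel"
  using bounded_mass by (rule bounded_borel_measurable)

lemma mass_nonneg: "0 \<le> mass k t"
  unfolding mass_def using V_pos by (auto simp: less_imp_le intro!: Bochner_Integration.integral_nonneg)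

lemma integral_mass: "k \<in> J \<Longrightarrow> (\<integral>t. mass k t \<partial>tm) = \<mu> k"
proof -
  assume k: "k \<in> J"
  have "dint (\<lambda>z. of_real (V z) * (u k z * cnj (u k z))) = of_real (\<mu> k)"
    using orth[OF k k] by (simp add: u_def)
  moreover have "(\<lambda>z. of_real (V z) * (u k z * cnj (u k z))) = (\<lambda>z. complex_of_real (V z * (norm (u k z))\<^sup>2))"
    by (simp add: fun_eq_iff complex_norm_square[symmetric])
  ultimately have "complex_of_real (\<integral>t. mass k t \<partial>tm) = of_real (\<mu> k)"
    unfolding mass_def using dint_of_real[of "\<lambda>z. V z * (norm (u k z))\<^sup>2"] by simp
  then show ?thesis by (simp only: of_real_eq_iff)
qed

text \<open>Hoelder's inequality in the form of Young's: both
  \<open>v powr (2 / (2 - \<tau>))\<close> and \<open>mass k / \<mu> k\<close> have integral at most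
  1, and the exponent required by \<open>slab_HLS\<close> for \<open>b = \<tau> / 2\<close> is
  exactly the one that interpolates between them.\<close>

lemma left_density_bound:
  assumes k: "k \<in> J"
  shows "(\<integral>\<^sup>+ t. ennreal (sqrt (v t * mass k t / \<mu> k) powr (2 / (2 - \<tau> / 2))) \<partial>tm) \<le> 1"
proof -
  \<comment> \<open>\<open>\<beta>\<close> is half the required exponent, because of the square
    root; \<open>\<alpha> = \<beta> * (2 - \<tau>) / 2\<close> turns \<open>v powr \<beta>\<close>
    into a power of the normalised quantity, and the two add up to 1.\<close>
  define \<alpha> \<beta> where "\<alpha> = (2 - \<tau>) / (4 - \<tau>)" and "\<beta> = 2 / (4 - \<tau>)"
  have ab: "0 < \<alpha>" "0 < \<beta>" "\<alpha> + \<beta> = 1" using tau by (auto simp: \<alpha>_def \<beta>_def add_divide_distrib[symmetric])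
  have pw: "sqrt (v t * mass k t / \<mu> k) powr (2 / (2 - \<tau> / 2)) \<le> \<alpha> * v t powr (2 / (2 - \<tau>)) + \<beta> * (mass k t / \<mu> k)" for t
  proof (cases "mass k t = 0")
    case True
    then show ?thesis using ab by simp
  next
    case False
    then have h: "0 < mass k t / \<mu> k" using mass_nonneg[of k t] mu_pos[OF k] by simp
    have "sqrt (v t * mass k t / \<mu> k) powr (2 / (2 - \<tau> / 2)) = (v t * (mass k t / \<mu> k)) powr (1 / 2 * (2 / (2 - \<tau> / 2)))"
    proof -
      have "0 \<le> v t * (mass k t / \<mu> k)" using h v_pos[of t] by (intro mult_nonneg_nonneg) auto
      then have "sqrt (v t * mass k t / \<mu> k) = (v t * (mass k t / \<mu> k)) powr (1 / 2)" by (simp add: powr_half_sqrt)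
      then show ?thesis by (simp only: powr_powr)
    qed
    also have "1 / 2 * (2 / (2 - \<tau> / 2)) = \<beta>" using tau by (simp add: \<beta>_def field_simps)
    also have "(v t * (mass k t / \<mu> k)) powr \<beta> = v t powr \<beta> * (mass k t / \<mu> k) powr \<beta>"
      using h v_pos[of t] by (intro powr_mult)
    also have "v t powr \<beta> = (v t powr (2 / (2 - \<tau>))) powr \<alpha>"
    proof -
      have "2 / x * (x / y) = 2 / y" if "x \<noteq> 0" for x y :: real using that by simp
      from this[of "2 - \<tau>" "4 - \<tau>"] have "2 / (2 - \<tau>) * \<alpha> = \<beta>" using tau by (simp only: \<alpha>_def \<beta>_def)
      then show ?thesis by (simp only: powr_powr)
    qed
    also have "(v t powr (2 / (2 - \<tau>))) powr \<alpha> * (mass k t / \<mu> k) powr \<beta> \<le> \<alpha> * v t powr (2 / (2 - \<tau>)) + \<beta> * (mass k t / \<mu> k)"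
      using ab h v_pos[of t] by (intro Youngs_inequality_0) auto
    finally show ?thesis .
  qed
  have nm: "(\<integral>\<^sup>+ t. ennreal (mass k t / \<mu> k) \<partial>tm) = 1"
  proof -
    have i: "integrable tm (\<lambda>t. mass k t / \<mu> k)"
      using bounded_borel_integrable[OF finite_tm bounded_borel_tm[OF bounded_mass]] by simp
    show ?thesis
      using integral_mass[OF k] mu_pos[OF k] mass_nonneg
      by (subst nn_integral_eq_integral[OF i]) auto
  qed
  have "(\<integral>\<^sup>+ t. ennreal (sqrt (v t * mass k t / \<mu> k) powr (2 / (2 - \<tau> / 2))) \<partial>tm)
     \<le> (\<integral>\<^sup>+ t. ennreal \<alpha> * ennreal (v t powr (2 / (2 - \<tau>))) + ennreal \<beta> * ennreal (mass k t / \<mu> k) \<partial>tm)"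
  proof (rule nn_integral_mono)
    fix t
    have "ennreal \<alpha> * ennreal x + ennreal \<beta> * ennreal y = ennreal (\<alpha> * x + \<beta> * y)" if "0 \<le> x" "0 \<le> y" for x y
      using ab that by (simp add: ennreal_mult[symmetric] ennreal_plus[symmetric] del: ennreal_plus)
    moreover have "0 \<le> mass k t / \<mu> k" using mass_nonneg[of k t] mu_pos[OF k] by simp
    ultimately have "ennreal \<alpha> * ennreal (v t powr (2 / (2 - \<tau>))) + ennreal \<beta> * ennreal (mass k t / \<mu> k)
      = ennreal (\<alpha> * v t powr (2 / (2 - \<tau>)) + \<beta> * (mass k t / \<mu> k))"
      using powr_ge_zero by blast
    then show "ennreal (sqrt (v t * mass k t / \<mu> k) powr (2 / (2 - \<tau> / 2))) \<le>
        ennreal \<alpha> * ennreal (v t powr (2 / (2 - \<tau>))) + ennreal \<beta> * ennreal (mass k t / \<mu> k)"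
      using ennreal_leI[OF pw[of t]] by simp
  qed
  also have "\<dots> = ennreal \<alpha> * (\<integral>\<^sup>+ t. ennreal (v t powr (2 / (2 - \<tau>))) \<partial>tm) + ennreal \<beta> * (\<integral>\<^sup>+ t. ennreal (mass k t / \<mu> k) \<partial>tm)"
    by (subst nn_integral_add) (auto simp: nn_integral_cmult)
  also have "\<dots> \<le> ennreal \<alpha> * 1 + ennreal \<beta> * 1"
    using v_norm nm by (intro add_mono mult_left_mono) auto
  also have "\<dots> = 1" using ab by (simp add: ennreal_plus[symmetric] del: ennreal_plus)
  finally show ?thesis .
qed

text \<open>On the imaginary axis all powers depending on \<open>z\<close> are unimodular, so
  \<open>operator_bound\<close> applies with
  \<open>norm (\<kappa> p) = tdist p powr - (\<tau> / 2)\<close>. The spatial norms are square roots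
  of \<open>v * mass k\<close>; dividing by \<open>\<mu> k\<close> inside them produces the factor
  \<open>\<mu> k\<close> in front.\<close>

lemma I_left:
  assumes k: "k \<in> J" and z: "Re z = 0"
  shows "norm (I k z) \<le> \<mu> k * (2 * pi * (4 / (1 - \<tau> / 2) + 6))"
proof -
  define \<eta> where "\<eta> = Im z"
  have zi: "z = \<i> * of_real \<eta>" using z by (simp add: \<eta>_def complex_eq_iff)
  define g where "g w = cnj (u k w) * of_real (amp w) * cis (\<eta> * lr w)" for w
  define h where "h w = u k w * of_real (amp w) * cis (\<eta> * lr w)" for w
  define \<kappa> where "\<kappa> p = cis (\<eta> * (ln (tdist p) / 2)) * of_real (tdist p powr (- (\<tau> / 2)))" for p
  have bg: "bounded_borel (borel \<Otimes>\<^sub>M borel) g"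
    unfolding g_def by (intro bounded_borel_mult bounded_borel_cnj bounded_u bounded_borel_of_real bounded_amp bounded_borel_cis) measurable
  have bh: "bounded_borel (borel \<Otimes>\<^sub>M borel) h"
    unfolding h_def by (intro bounded_borel_mult bounded_u bounded_borel_of_real bounded_amp bounded_borel_cis) measurable
  have bk: "bounded_borel (borel \<Otimes>\<^sub>M borel) \<kappa>"
  proof -
    have "0 \<le> \<tau> / 2" using tau by simp
    from bounded_tdist_powr[OF this] show ?thesis
      unfolding \<kappa>_def by (intro bounded_borel_mult bounded_borel_of_real bounded_borel_cis) measurable
  qed
  have "exp (z * of_real (phase \<zeta>)) * Amp k \<zeta> = \<kappa> (fst \<zeta>) * (g (pX \<zeta>) * h (pY \<zeta>) * kernel N (fst (pX \<zeta>) - fst (pY \<zeta>)) (snd (pX \<zeta>) - snd (pY \<zeta>)))" for \<zeta>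
  proof -
    have "exp (z * of_real (phase \<zeta>)) = cis (\<eta> * phase \<zeta>)" by (simp add: zi cis_conv_exp mult.assoc)
    also have "\<dots> = cis (\<eta> * lr (pX \<zeta>)) * cis (\<eta> * lr (pY \<zeta>)) * cis (\<eta> * (ln (tdist (fst \<zeta>)) / 2))"
      by (simp add: phase_def cis_mult distrib_left)
    finally show ?thesis unfolding Amp_def Ker_def g_def h_def \<kappa>_def by (simp only: mult_ac minus_divide_left)
  qed
  then have "norm (I k z) \<le> (\<integral>p. norm (\<kappa> p) * (2 * pi * (sqrt (\<integral>x. (norm (g (fst p, x)))\<^sup>2 \<partial>torus_measure) * sqrt (\<integral>y. (norm (h (snd p, y)))\<^sup>2 \<partial>torus_measure))) \<partial>(tm \<Otimes>\<^sub>M tm))"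
    unfolding I_def using operator_bound[OF bg bh bk] by simp
  also have "\<dots> = (\<integral>p. (\<mu> k * (2 * pi)) * (sqrt (v (fst p) * mass k (fst p) / \<mu> k) * sqrt (v (snd p) * mass k (snd p) / \<mu> k) * tdist p powr - (\<tau> / 2)) \<partial>(tm \<Otimes>\<^sub>M tm))"
  proof (rule Bochner_Integration.integral_cong[OF refl])
    fix p
    have sq: "sqrt (v t * mass k t) = sqrt (\<mu> k) * sqrt (v t * mass k t / \<mu> k)" for t
      using mu_pos[OF k] by (simp add: real_sqrt_mult[symmetric] del: real_sqrt_mult)
    have "(norm (g w))\<^sup>2 = v (fst w) * (V w * (norm (u k w))\<^sup>2)" "(norm (h w))\<^sup>2 = v (fst w) * (V w * (norm (u k w))\<^sup>2)" for w
      using amp_sq[of w] by (simp_all add: g_def h_def norm_mult power_mult_distrib mult_ac)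
    then have gh: "(\<integral>x. (norm (g (t, x)))\<^sup>2 \<partial>torus_measure) = v t * mass k t" "(\<integral>x. (norm (h (t, x)))\<^sup>2 \<partial>torus_measure) = v t * mass k t" for t
      by (simp_all add: mass_def)
    have "norm (\<kappa> p) = tdist p powr - (\<tau> / 2)" by (simp add: \<kappa>_def norm_mult)
    moreover have "sqrt (\<mu> k) * sqrt (\<mu> k) = \<mu> k" using mu_pos[OF k] by simp
    moreover have "a * (2 * pi * ((m * x) * (m * y))) = ((m * m) * (2 * pi)) * (x * y * a)" for a m x y :: real
      by (simp only: mult_ac)
    ultimately show "norm (\<kappa> p) * (2 * pi * (sqrt (\<integral>x. (norm (g (fst p, x)))\<^sup>2 \<partial>torus_measure) * sqrt (\<integral>y. (norm (h (snd p, y)))\<^sup>2 \<partial>torus_measure)))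
       = (\<mu> k * (2 * pi)) * (sqrt (v (fst p) * mass k (fst p) / \<mu> k) * sqrt (v (snd p) * mass k (snd p) / \<mu> k) * tdist p powr - (\<tau> / 2))"
      unfolding gh sq by (simp only:)
  qed
  also have "\<dots> = (\<mu> k * (2 * pi)) * (\<integral>p. sqrt (v (fst p) * mass k (fst p) / \<mu> k) * sqrt (v (snd p) * mass k (snd p) / \<mu> k) * tdist p powr - (\<tau> / 2) \<partial>(tm \<Otimes>\<^sub>M tm))"
    by simp
  also have "\<dots> \<le> (\<mu> k * (2 * pi)) * (4 / (1 - \<tau> / 2) + 6)"
  proof (rule mult_left_mono)
    show "(\<integral>p. sqrt (v (fst p) * mass k (fst p) / \<mu> k) * sqrt (v (snd p) * mass k (snd p) / \<mu> k) * tdist p powr - (\<tau> / 2) \<partial>(tm \<Otimes>\<^sub>M tm)) \<le> 4 / (1 - \<tau> / 2) + 6"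
    proof (rule integral_real_bounded)
      show "(\<integral>\<^sup>+ p. ennreal (sqrt (v (fst p) * mass k (fst p) / \<mu> k) * sqrt (v (snd p) * mass k (snd p) / \<mu> k) * tdist p powr - (\<tau> / 2)) \<partial>(tm \<Otimes>\<^sub>M tm)) \<le> ennreal (4 / (1 - \<tau> / 2) + 6)"
        using tau v_pos mass_nonneg mu_pos[OF k]
        by (intro slab_HLS[of "\<tau> / 2" "\<lambda>t. sqrt (v t * mass k t / \<mu> k)"] left_density_bound[OF k]) (auto simp: less_imp_le)
    qed (use tau in auto)
  qed (use mu_pos[OF k] in auto)
  finally show ?thesis by (simp add: mult.assoc)
qed

lemma norm_coef: "k \<in> J \<Longrightarrow> norm (coef k z) = exp (- (Re z * (ln (d k) / 2))) * (d k / \<mu> k)"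
  unfolding coef_def norm_mult norm_exp_eq_Re norm_of_real using d_pos[of k] mu_pos[of k] by simp

lemma F_left:
  assumes z: "Re z = 0"
  shows "norm (F z) \<le> interp_const \<tau>"
proof -
  define c where "c = 2 * pi * (4 / (1 - \<tau> / 2) + 6)"
  have c: "0 \<le> c" using tau by (simp add: c_def)
  have "norm (F z) \<le> (\<Sum>k\<in>J. d k * c)"
    unfolding F_def
  proof (intro order_trans[OF norm_sum] sum_mono)
    fix k assume k: "k \<in> J"
    have "norm (coef k z) = d k / \<mu> k" using z by (simp add: norm_coef[OF k])
    then have "norm (coef k z * I k z) \<le> d k / \<mu> k * (\<mu> k * c)"
      unfolding norm_mult c_def using I_left[OF k z] d_pos[OF k] mu_pos[OF k] by (intro mult_mono) auto
    also have "\<dots> = d k * c" using mu_pos[OF k] by simp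
    finally show "norm (coef k z * I k z) \<le> d k * c" .
  qed
  also have "\<dots> = (\<Sum>k\<in>J. d k) * c" by (simp add: sum_distrib_right)
  also have "\<dots> \<le> 1 * c" using d_sum c by (intro mult_right_mono)
  also have "\<dots> \<le> interp_const \<tau>" using tau by (simp add: interp_const_def c_def)
  finally show ?thesis .
qed

text \<open>The kernel of the diagonal operator in the trace \<open>F z\<close>; \<open>Pi0\<close>
  is the kernel of the interpolated operator, and \<open>F z\<close> is the integral of their
  product, to be bounded by Cauchy--Schwarz.\<close>

definition Psi :: "complex \<Rightarrow> (real \<times> real) \<times> (real \<times> real) \<Rightarrow> complex" where
  "Psi z \<zeta> = (\<Sum>k\<in>J. coef k z * ((of_real (sqrt (V (pX \<zeta>))) * cnj (u k (pX \<zeta>))) * (of_real (sqrt (V (pY \<zeta>))) * u k (pY \<zeta>))))"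

definition Pi0 :: "complex \<Rightarrow> (real \<times> real) \<times> (real \<times> real) \<Rightarrow> complex" where
  "Pi0 z \<zeta> = exp (z * of_real (phase \<zeta>)) * of_real (tdist (fst \<zeta>) powr (- \<tau> / 2)
      * (sqrt (v (fst (pX \<zeta>))) * sqrt (v (fst (pY \<zeta>))))) * Ker \<zeta>"

lemma bounded_sqrt_V: "bounded_borel (borel \<Otimes>\<^sub>M borel) (\<lambda>z. sqrt (V z))"
  by (rule bounded_borelI[of _ _ "sqrt M"]) (use V_pos V_bounds in \<open>auto simp: less_imp_le\<close>)

lemma bounded_Psi: "bounded_borel prod_measure (Psi z)"
  unfolding Psi_def
  by (intro bounded_borel_sum bounded_borel_mult bounded_borel_const bounded_borel_pX[of "\<lambda>w. of_real (sqrt (V w))"] bounded_borel_pX[of "\<lambda>w. cnj (u _ w)"]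
      bounded_borel_pY[of "\<lambda>w. of_real (sqrt (V w))"] bounded_borel_pY[of "u _"] bounded_borel_cnj bounded_borel_of_real bounded_sqrt_V bounded_u)

lemma Pi0_measurable [measurable]: "Pi0 z \<in> borel_measurable prod_measure"
  unfolding Pi0_def by measurable

text \<open>Expanding the square yields products of two orthogonality integrals, so only the
  diagonal survives. There each term is
  \<open>(norm (coef k z))^2 * (\<mu> k)^2 = d k\<close>.\<close>

lemma Psi_norm:
  assumes z: "Re z = 1"
  shows "(\<integral>\<^sup>+ \<zeta>. ennreal (norm (Psi z \<zeta>)) ^ 2 \<partial>prod_measure) \<le> 1"
proof -
  define a where "a k l w = of_real (V w) * (cnj (u k w) * u l w)" for k l w
  define b where "b k l w = of_real (V w) * (u k w * cnj (u l w))" for k l w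
  have ab: "bounded_borel (borel \<Otimes>\<^sub>M borel) (a k l)" "bounded_borel (borel \<Otimes>\<^sub>M borel) (b k l)" for k l
    unfolding a_def b_def by (intro bounded_borel_mult bounded_borel_of_real bounded_borel_cnj bounded_V bounded_u)+
  have iab: "integrable prod_measure (\<lambda>\<zeta>. a k l (pX \<zeta>) * b k l (pY \<zeta>))" for k l
    by (intro bounded_borel_integrable[OF finite_pairs(3)] bounded_borel_mult bounded_borel_pX bounded_borel_pY ab)
  have eq: "complex_of_real ((norm (Psi z \<zeta>))\<^sup>2) = (\<Sum>k\<in>J. \<Sum>l\<in>J. (coef k z * cnj (coef l z)) * (a k l (pX \<zeta>) * b k l (pY \<zeta>)))" for \<zeta>
  proof -
    have sV: "complex_of_real (sqrt (V w)) * complex_of_real (sqrt (V w)) = of_real (V w)" for w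
      using V_pos[of w] by (simp flip: of_real_mult)
    have "coef k z * ((of_real (sqrt (V X)) * cnj (u k X)) * (of_real (sqrt (V Y)) * u k Y)) * cnj (coef l z * ((of_real (sqrt (V X)) * cnj (u l X)) * (of_real (sqrt (V Y)) * u l Y)))
      = (coef k z * cnj (coef l z)) * (((of_real (sqrt (V X)) * of_real (sqrt (V X))) * (cnj (u k X) * u l X)) * ((of_real (sqrt (V Y)) * of_real (sqrt (V Y))) * (u k Y * cnj (u l Y))))" for k l X Y
      by (simp add: mult_ac)
    then show ?thesis
      unfolding complex_norm_square Psi_def cnj_sum sum_product a_def b_def sV by (simp only:)
  qed
  have "complex_of_real (\<integral>\<zeta>. (norm (Psi z \<zeta>))\<^sup>2 \<partial>prod_measure) = (\<integral>\<zeta>. complex_of_real ((norm (Psi z \<zeta>))\<^sup>2) \<partial>prod_measure)"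
    by (rule integral_complex_of_real[symmetric])
  also have "\<dots> = (\<Sum>k\<in>J. \<Sum>l\<in>J. (coef k z * cnj (coef l z)) * (dint (a k l) * dint (b k l)))"
    unfolding eq using iab by (simp add: integral_prod_measure_product[OF ab])
  also have "\<dots> = (\<Sum>k\<in>J. \<Sum>l\<in>J. if k = l then of_real (d k) else 0)"
  proof (intro sum.cong refl)
    fix k l assume kl: "k \<in> J" "l \<in> J"
    have bb: "dint (b k l) = (if k = l then of_real (\<mu> k) else 0)" using orth[OF kl] by (simp add: b_def[abs_def] u_def)
    have "a k l = (\<lambda>w. cnj (b k l w))" by (simp add: a_def b_def fun_eq_iff)
    then have aa: "dint (a k l) = (if k = l then of_real (\<mu> k) else 0)" using dint_cnj[of "b k l"] bb by simp
    have "coef k z * cnj (coef k z) * (of_real (\<mu> k) * of_real (\<mu> k)) = of_real (d k)"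
    proof -
      have n: "norm (coef k z) = exp (- (ln (d k) / 2)) * (d k / \<mu> k)"
        using z by (simp add: norm_coef[OF kl(1)])
      have "(norm (coef k z))\<^sup>2 * (\<mu> k * \<mu> k) = (exp (- (ln (d k) / 2)))\<^sup>2 * (d k)\<^sup>2"
        unfolding n using mu_pos[OF kl(1)] by (simp add: power_mult_distrib power_divide power2_eq_square)
      also have "(exp (- (ln (d k) / 2)))\<^sup>2 = inverse (d k)"
      proof -
        have "(exp (- (ln (d k) / 2)))\<^sup>2 = exp (2 * (- (ln (d k) / 2)))" by (rule exp_double[symmetric])
        also have "2 * (- (ln (d k) / 2)) = - ln (d k)" by simp
        finally show ?thesis using d_pos[OF kl(1)] by (simp add: exp_minus)
      qed
      finally have "(norm (coef k z))\<^sup>2 * (\<mu> k * \<mu> k) = d k" using d_pos[OF kl(1)] by (simp add: power2_eq_square)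
      then show ?thesis unfolding complex_norm_square[symmetric] of_real_mult[symmetric] by simp
    qed
    then show "(coef k z * cnj (coef l z)) * (dint (a k l) * dint (b k l)) = (if k = l then of_real (d k) else 0)"
      unfolding aa bb by auto
  qed
  also have "\<dots> = of_real (\<Sum>k\<in>J. d k)" using J by simp
  finally have "(\<integral>\<zeta>. (norm (Psi z \<zeta>))\<^sup>2 \<partial>prod_measure) = (\<Sum>k\<in>J. d k)" by (simp only: of_real_eq_iff)
  moreover have "integrable prod_measure (\<lambda>\<zeta>. (norm (Psi z \<zeta>))\<^sup>2)"
    unfolding power2_eq_square by (intro bounded_borel_integrable[OF finite_pairs(3)] bounded_borel_mult bounded_borel_norm bounded_Psi)
  ultimately have "(\<integral>\<^sup>+ \<zeta>. ennreal ((norm (Psi z \<zeta>))\<^sup>2) \<partial>prod_measure) = ennreal (\<Sum>k\<in>J. d k)"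
    by (subst nn_integral_eq_integral) auto
  then show ?thesis using d_sum by (simp add: ennreal_power)
qed

text \<open>Count of powers of \<open>tdist\<close>: 1 from the phase, \<open>- \<tau>\<close> from
  the amplitude, and \<open>- 1\<close> from the squared dispersive bound. What remains is
  \<open>- \<tau>\<close>, the spatial densities \<open>E\<close> integrate to 1, and
  \<open>slab_HLS\<close> with \<open>b = \<tau>\<close> meets the normalisation of
  \<open>v\<close>.\<close>

lemma Pi0_norm:
  assumes z: "Re z = 1"
  shows "(\<integral>\<^sup>+ \<zeta>. ennreal (norm (Pi0 z \<zeta>)) ^ 2 \<partial>prod_measure) \<le> ennreal (2025 * (4 / (1 - \<tau>) + 6))"
proof -
  let ?T = torus_measure
  define E where "E w = (V w / v (fst w)) powr (1 / \<tau>)" for w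
  have [measurable]: "E \<in> borel_measurable (borel \<Otimes>\<^sub>M borel)" unfolding E_def[abs_def] by measurable
  have E1: "(\<integral>\<^sup>+ x. ennreal (E (t, x)) \<partial>?T) = 1" for t
  proof -
    \<comment> \<open>A non-integrable function has integral 0 by convention, so the value 1 in
      \<open>V_norm\<close> forces integrability.\<close>
    have "integrable ?T (\<lambda>x. E (t, x))"
      using V_norm[of t] not_integrable_integral_eq[of ?T "\<lambda>x. E (t, x)"] by (auto simp: E_def)
    then show ?thesis using V_norm[of t] by (subst nn_integral_eq_integral) (auto simp: E_def)
  qed
  have EE: "(\<integral>\<^sup>+ r. ennreal (E (t, fst r)) * ennreal (E (s, snd r)) \<partial>(?T \<Otimes>\<^sub>M ?T)) = 1" for t s
  proof -
    have "(\<integral>\<^sup>+ r. ennreal (E (t, fst r)) * ennreal (E (s, snd r)) \<partial>(?T \<Otimes>\<^sub>M ?T)) = (\<integral>\<^sup>+ x. \<integral>\<^sup>+ y. ennreal (E (t, x)) * ennreal (E (s, y)) \<partial>?T \<partial>?T)"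
      by (subst sigma_finite_measure.nn_integral_fst[OF sigma_finite(2), symmetric]) auto
    also have "\<dots> = 1" by (simp add: nn_integral_cmult E1)
    finally show ?thesis .
  qed
  have sq: "(norm (Pi0 z \<zeta>))\<^sup>2 = E (pX \<zeta>) * E (pY \<zeta>) * (v (fst (pX \<zeta>)) * v (fst (pY \<zeta>))) * (tdist (fst \<zeta>) * tdist (fst \<zeta>) powr (- \<tau>) * (norm (Ker \<zeta>))\<^sup>2)" for \<zeta>
  proof -
    define w where "w = tdist (fst \<zeta>)"
    have w: "w > 0" using tdist_bounds by (simp add: w_def)
    have n: "norm (Pi0 z \<zeta>) = exp (phase \<zeta>) * (w powr (- \<tau> / 2) * (sqrt (v (fst (pX \<zeta>))) * sqrt (v (fst (pY \<zeta>))))) * norm (Ker \<zeta>)"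
      using z v_pos by (simp add: Pi0_def norm_mult w_def abs_mult less_imp_le)
    have "(exp (phase \<zeta>))\<^sup>2 = exp (2 * phase \<zeta>)" by (simp add: power2_eq_square mult_exp_exp)
    also have "\<dots> = exp (2 * lr (pX \<zeta>)) * exp (2 * lr (pY \<zeta>)) * w"
    proof -
      have "2 * phase \<zeta> = 2 * lr (pX \<zeta>) + 2 * lr (pY \<zeta>) + ln w" by (simp add: phase_def w_def)
      then show ?thesis using w by (simp add: exp_add)
    qed
    finally have e: "(exp (phase \<zeta>))\<^sup>2 = E (pX \<zeta>) * E (pY \<zeta>) * w" by (simp only: exp_lr E_def)
    have p: "(w powr (- \<tau> / 2))\<^sup>2 = w powr (- \<tau>)" using w by (simp add: power2_eq_square powr_add[symmetric])
    have s: "(sqrt (v t))\<^sup>2 = v t" for t using v_pos[of t] by simp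
    show ?thesis unfolding n power_mult_distrib e p s w_def[symmetric] by (simp only: mult_ac)
  qed
  have [measurable]: "(\<lambda>p. ennreal (2025 * (v (fst p) * v (snd p) * tdist p powr - \<tau>))) \<in> borel_measurable (borel \<Otimes>\<^sub>M borel)" by measurable
  have [measurable]: "(\<lambda>\<zeta>. ennreal ((norm (Pi0 z \<zeta>))\<^sup>2)) \<in> borel_measurable ((tm \<Otimes>\<^sub>M tm) \<Otimes>\<^sub>M (?T \<Otimes>\<^sub>M ?T))"
    using Pi0_measurable[of z] unfolding prod_measure_def by measurable
  have "(\<integral>\<^sup>+ \<zeta>. ennreal (norm (Pi0 z \<zeta>)) ^ 2 \<partial>prod_measure) = (\<integral>\<^sup>+ p. \<integral>\<^sup>+ r. ennreal ((norm (Pi0 z (p, r)))\<^sup>2) \<partial>(?T \<Otimes>\<^sub>M ?T) \<partial>(tm \<Otimes>\<^sub>M tm))"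
    unfolding prod_measure_def
    by (subst sigma_finite_measure.nn_integral_fst[OF sigma_finite(4)]) (auto simp: ennreal_power)
  also have "\<dots> \<le> (\<integral>\<^sup>+ p. ennreal (2025 * (v (fst p) * v (snd p) * tdist p powr - \<tau>)) \<partial>(tm \<Otimes>\<^sub>M tm))"
  proof (rule nn_integral_tm_pair_mono)
    have "(\<lambda>p. \<integral>\<^sup>+ r. ennreal ((norm (Pi0 z (p, r)))\<^sup>2) \<partial>(?T \<Otimes>\<^sub>M ?T)) \<in> borel_measurable (tm \<Otimes>\<^sub>M tm)"
      by (rule sigma_finite_measure.borel_measurable_nn_integral_fst[OF sigma_finite(4)]) measurable
    moreover have "sets (tm \<Otimes>\<^sub>M tm) = sets (borel \<Otimes>\<^sub>M borel)" by (intro sets_pair_measure_cong) auto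
    ultimately show "(\<lambda>p. \<integral>\<^sup>+ r. ennreal ((norm (Pi0 z (p, r)))\<^sup>2) \<partial>(?T \<Otimes>\<^sub>M ?T)) \<in> borel_measurable (borel \<Otimes>\<^sub>M borel)"
      using measurable_cong_sets by blast
    fix t s assume ts: "t \<in> slab" "s \<in> slab"
    define c where "c = 2025 * (v t * v s * tdist (t, s) powr - \<tau>)"
    have c: "0 \<le> c" using v_pos by (simp add: c_def less_imp_le)
    have "(norm (Pi0 z ((t, s), r)))\<^sup>2 \<le> c * (E (t, fst r) * E (s, snd r))" for r
    proof -
      define w where "w = tdist (t, s)"
      have w: "w > 0" using tdist_bounds by (simp add: w_def)
      have K: "(norm (Ker ((t, s), r)))\<^sup>2 \<le> 2025 / w"
        using kernel_tdist_bound[OF ts] by (simp add: Ker_def pX_def pY_def w_def)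
      have "w * w powr - \<tau> * (norm (Ker ((t, s), r)))\<^sup>2 \<le> w * w powr - \<tau> * (2025 / w)"
        using K w by (intro mult_left_mono) auto
      also have "\<dots> = 2025 * w powr - \<tau>" using w by simp
      finally have "E (t, fst r) * E (s, snd r) * (v t * v s) * (w * w powr - \<tau> * (norm (Ker ((t, s), r)))\<^sup>2)
         \<le> E (t, fst r) * E (s, snd r) * (v t * v s) * (2025 * w powr - \<tau>)"
        using v_pos by (intro mult_left_mono) (auto simp: E_def less_imp_le)
      then show ?thesis by (simp add: sq pX_def pY_def c_def w_def mult_ac)
    qed
    then have "(\<integral>\<^sup>+ r. ennreal ((norm (Pi0 z ((t, s), r)))\<^sup>2) \<partial>(?T \<Otimes>\<^sub>M ?T)) \<le> (\<integral>\<^sup>+ r. ennreal c * (ennreal (E (t, fst r)) * ennreal (E (s, snd r))) \<partial>(?T \<Otimes>\<^sub>M ?T))"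
      using c by (intro nn_integral_mono) (simp add: ennreal_mult[symmetric] E_def ennreal_leI)
    also have "\<dots> = ennreal c * (\<integral>\<^sup>+ r. ennreal (E (t, fst r)) * ennreal (E (s, snd r)) \<partial>(?T \<Otimes>\<^sub>M ?T))"
      by (rule nn_integral_cmult) measurable
    finally show "(\<integral>\<^sup>+ r. ennreal ((norm (Pi0 z ((t, s), r)))\<^sup>2) \<partial>(?T \<Otimes>\<^sub>M ?T)) \<le> ennreal (2025 * (v (fst (t, s)) * v (snd (t, s)) * tdist (t, s) powr - \<tau>))"
      by (simp add: EE c_def)
  qed measurable
  also have "\<dots> = ennreal 2025 * (\<integral>\<^sup>+ p. ennreal (v (fst p) * v (snd p) * tdist p powr - \<tau>) \<partial>(tm \<Otimes>\<^sub>M tm))"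
    by (subst nn_integral_cmult[symmetric]) (auto simp: ennreal_mult')
  also have "\<dots> \<le> ennreal 2025 * ennreal (4 / (1 - \<tau>) + 6)"
    using tau v_norm v_pos by (intro mult_left_mono slab_HLS) (auto simp: less_imp_le)
  also have "\<dots> = ennreal (2025 * (4 / (1 - \<tau>) + 6))" using tau by (subst ennreal_mult[symmetric]) auto
  finally show ?thesis .
qed

lemma F_right:
  assumes z: "Re z = 1"
  shows "norm (F z) \<le> interp_const \<tau>"
proof -
  define \<Phi> where "\<Phi> k \<zeta> = (of_real (sqrt (V (pX \<zeta>))) * cnj (u k (pX \<zeta>))) * (of_real (sqrt (V (pY \<zeta>))) * u k (pY \<zeta>))" for k \<zeta>
  have eq: "(\<lambda>\<zeta>. Pi0 z \<zeta> * (coef k z * \<Phi> k \<zeta>)) = (\<lambda>\<zeta>. coef k z * (exp (z * of_real (phase \<zeta>)) * Amp k \<zeta>))" for k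
    unfolding Amp_def Pi0_def amp_def of_real_mult \<Phi>_def by (simp only: mult_ac)
  have i: "integrable prod_measure (\<lambda>\<zeta>. Pi0 z \<zeta> * (coef k z * \<Phi> k \<zeta>))" for k
    unfolding eq by (intro integrable_mult_right I_exp(2))
  have "F z = (\<Sum>k\<in>J. \<integral>\<zeta>. Pi0 z \<zeta> * (coef k z * \<Phi> k \<zeta>) \<partial>prod_measure)"
    unfolding F_def eq I_def by simp
  also have "\<dots> = (\<integral>\<zeta>. (\<Sum>k\<in>J. Pi0 z \<zeta> * (coef k z * \<Phi> k \<zeta>)) \<partial>prod_measure)"
    by (rule Bochner_Integration.integral_sum[symmetric]) (rule i)
  also have "\<dots> = (\<integral>\<zeta>. Pi0 z \<zeta> * Psi z \<zeta> \<partial>prod_measure)" by (simp only: Psi_def sum_distrib_left \<Phi>_def)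
  finally have F: "F z = (\<integral>\<zeta>. Pi0 z \<zeta> * Psi z \<zeta> \<partial>prod_measure)" .
  have int: "integrable prod_measure (\<lambda>\<zeta>. Pi0 z \<zeta> * Psi z \<zeta>)"
    unfolding Psi_def sum_distrib_left \<Phi>_def[symmetric] by (intro Bochner_Integration.integrable_sum i)
  have [measurable]: "Psi z \<in> borel_measurable prod_measure" using bounded_Psi by (rule bounded_borel_measurable)
  define C where "C = 2025 * (4 / (1 - \<tau>) + 6)"
  have C: "0 \<le> C" using tau by (simp add: C_def)
  have "ennreal (norm (F z)) \<le> (\<integral>\<^sup>+ \<zeta>. ennreal (norm (Pi0 z \<zeta> * Psi z \<zeta>)) \<partial>prod_measure)"
    unfolding F by (rule integral_norm_bound_ennreal[OF int])
  also have "\<dots> = (\<integral>\<^sup>+ \<zeta>. ennreal (norm (Pi0 z \<zeta>)) * ennreal (norm (Psi z \<zeta>)) \<partial>prod_measure)"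
    by (simp add: norm_mult ennreal_mult)
  finally have "ennreal (norm (F z)) ^ 2 \<le> (\<integral>\<^sup>+ \<zeta>. ennreal (norm (Pi0 z \<zeta>)) * ennreal (norm (Psi z \<zeta>)) \<partial>prod_measure) ^ 2"
    by (intro power_mono) auto
  also have "\<dots> \<le> (\<integral>\<^sup>+ \<zeta>. ennreal (norm (Pi0 z \<zeta>)) ^ 2 \<partial>prod_measure) * (\<integral>\<^sup>+ \<zeta>. ennreal (norm (Psi z \<zeta>)) ^ 2 \<partial>prod_measure)"
    by (rule Cauchy_Schwarz_nn_integral) measurable
  also have "\<dots> \<le> ennreal C * 1"
    unfolding C_def by (intro mult_mono Pi0_norm[OF z] Psi_norm[OF z]) auto
  finally have "ennreal ((norm (F z))\<^sup>2) \<le> ennreal C" by (simp add: ennreal_power)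
  then have "(norm (F z))\<^sup>2 \<le> C" using C by simp
  then have "norm (F z) \<le> sqrt C" by (rule real_le_rsqrt)
  also have "sqrt C = 45 * sqrt (4 / (1 - \<tau>) + 6)"
  proof -
    have "sqrt 2025 = (45::real)" by (rule real_sqrt_unique) auto
    then show ?thesis by (simp only: C_def real_sqrt_mult)
  qed
  also have "\<dots> \<le> interp_const \<tau>" using tau by (simp add: interp_const_def)
  finally show ?thesis .
qed

theorem weighted_eigenvalue_sum: "(\<Sum>k\<in>J. d k powr (1 - \<tau> / 2) * \<mu> k) \<le> interp_const \<tau>"
proof -
  obtain B where B: "\<And>z. 0 \<le> Re z \<Longrightarrow> Re z \<le> 1 \<Longrightarrow> norm (F z) \<le> B" using F_bounded by blast
  have pos: "0 < interp_const \<tau>"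
    unfolding interp_const_def using tau by (intro add_pos_nonneg mult_pos_pos) auto
  have "norm (F (of_real \<tau>)) \<le> interp_const \<tau>"
    by (rule strip_maximum_principle[OF F_holomorphic B F_left F_right pos]) (use tau in auto)
  then show ?thesis unfolding F_tau norm_of_real by linarith
qed

end

section \<open>Duality\<close>

text \<open>What is left of orthonormality after truncation to frequencies up to \<open>N\<close>:
  short coefficient vectors and Bessel's inequality. Against an orthonormal basis the two conditions
  make the squared moduli of the coefficients doubly substochastic.\<close>

definition contractive_family :: "nat \<Rightarrow> (nat \<Rightarrow> int \<Rightarrow> complex) \<Rightarrow> bool" where
  "contractive_family N a \<longleftrightarrow>
     (\<forall>j. (\<Sum>n\<in>{- int N..int N}. (norm (a j n))\<^sup>2) \<le> 1) \<and>
     (\<forall>b A. finite A \<longrightarrow> (\<Sum>j\<in>A. (norm (\<Sum>n\<in>{- int N..int N}. a j n * b n))\<^sup>2) \<le> (\<Sum>n\<in>{- int N..int N}. (norm (b n))\<^sup>2))"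

lemma contractive_familyD:
  assumes "contractive_family N a"
  shows "(\<Sum>n\<in>{- int N..int N}. (norm (a j n))\<^sup>2) \<le> 1"
    and "finite A \<Longrightarrow> (\<Sum>j\<in>A. (norm (\<Sum>n\<in>{- int N..int N}. a j n * b n))\<^sup>2) \<le> (\<Sum>n\<in>{- int N..int N}. (norm (b n))\<^sup>2)"
  using assms by (auto simp: contractive_family_def)

definition wave_packet :: "nat \<Rightarrow> (int \<Rightarrow> complex) \<Rightarrow> real \<times> real \<Rightarrow> complex" where
  "wave_packet N b z = (\<Sum>n\<in>{- int N..int N}. b n * wave n z)"

lemma bounded_wave_packet: "bounded_borel (borel \<Otimes>\<^sub>M borel) (wave_packet N b)"
  unfolding wave_packet_def by (intro bounded_borel_sum bounded_borel_mult bounded_borel_const bounded_borel_wave)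

lemma wave_packet_measurable [measurable]: "wave_packet N b \<in> borel_measurable (borel \<Otimes>\<^sub>M borel)"
  using bounded_wave_packet by (rule bounded_borel_measurable)

context weighted_slab
begin

definition Gram :: "int \<Rightarrow> int \<Rightarrow> complex" where
  "Gram n l = dint (\<lambda>z. of_real (V z) * (wave l z * cnj (wave n z)))"

lemma Gram_hermitian: "Gram l n = cnj (Gram n l)"
  unfolding Gram_def dint_cnj[symmetric] by (simp add: mult_ac)

lemma dint_wave_packet:
  "dint (\<lambda>z. of_real (V z) * (wave_packet N b z * cnj (wave n z))) = mat_app {- int N..int N} Gram b n"
proof -
  have "(\<lambda>z. of_real (V z) * (wave_packet N b z * cnj (wave n z))) = (\<lambda>z. \<Sum>m\<in>{- int N..int N}. b m * (of_real (V z) * (wave m z * cnj (wave n z))))"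
    by (simp add: fun_eq_iff wave_packet_def sum_distrib_left sum_distrib_right mult_ac)
  then have "dint (\<lambda>z. of_real (V z) * (wave_packet N b z * cnj (wave n z))) = (\<Sum>m\<in>{- int N..int N}. b m * Gram n m)"
    by (simp add: dint_sum dint_cmult Gram_def bounded_borel_mult bounded_borel_const bounded_borel_of_real bounded_borel_cnj bounded_V bounded_borel_wave)
  then show ?thesis by (simp add: mat_app_def mult.commute)
qed

lemma dint_wave_packet2:
  "dint (\<lambda>z. of_real (V z) * (wave_packet N b z * cnj (wave_packet N c z))) = ip {- int N..int N} (mat_app {- int N..int N} Gram b) c"
proof -
  have "(\<lambda>z. of_real (V z) * (wave_packet N b z * cnj (wave_packet N c z))) = (\<lambda>z. \<Sum>n\<in>{- int N..int N}. cnj (c n) * (of_real (V z) * (wave_packet N b z * cnj (wave n z))))"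
    unfolding wave_packet_def[of N c] by (simp add: fun_eq_iff sum_distrib_left mult_ac)
  then have "dint (\<lambda>z. of_real (V z) * (wave_packet N b z * cnj (wave_packet N c z))) = (\<Sum>n\<in>{- int N..int N}. cnj (c n) * mat_app {- int N..int N} Gram b n)"
    by (simp add: dint_sum dint_cmult dint_wave_packet bounded_borel_mult bounded_borel_const bounded_borel_of_real bounded_borel_cnj bounded_V bounded_borel_wave bounded_wave_packet)
  then show ?thesis by (simp add: ip_def mult.commute)
qed

lemma dint_energy:
  "dint (\<lambda>z. of_real (V z) * (wave_packet N b z * cnj (wave_packet N b z))) = of_real (\<integral>t. \<integral>x. V (t, x) * (norm (wave_packet N b (t, x)))\<^sup>2 \<partial>torus_measure \<partial>tm)"
proof -
  have "(\<lambda>z. of_real (V z) * (wave_packet N b z * cnj (wave_packet N b z))) = (\<lambda>z. complex_of_real (V z * (norm (wave_packet N b z))\<^sup>2))"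
    by (simp add: fun_eq_iff complex_norm_square[symmetric])
  then show ?thesis using dint_of_real[of "\<lambda>z. V z * (norm (wave_packet N b z))\<^sup>2"] by simp
qed

text \<open>The last conclusion is the Schatten bound of order \<open>2 / \<tau>\<close>; the others
  express the weighted energy of a wave packet in the eigenbasis.\<close>

lemma Gram_eigenvalues:
  obtains K :: nat and e :: "nat \<Rightarrow> int \<Rightarrow> complex" and \<mu> :: "nat \<Rightarrow> real"
  where "\<And>k l. k < K \<Longrightarrow> l < K \<Longrightarrow> ip {- int N..int N} (e k) (e l) = (if k = l then 1 else 0)"
    and "\<And>k. k < K \<Longrightarrow> 0 \<le> \<mu> k"
    and "\<And>b. (\<integral>t. \<integral>x. V (t, x) * (norm (wave_packet N b (t, x)))\<^sup>2 \<partial>torus_measure \<partial>tm)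
          = (\<Sum>k<K. \<mu> k * (norm (ip {- int N..int N} b (e k)))\<^sup>2)"
    and "\<And>b. (\<Sum>k<K. (norm (ip {- int N..int N} b (e k)))\<^sup>2) = (\<Sum>n\<in>{- int N..int N}. (norm (b n))\<^sup>2)"
    and "(\<Sum>k<K. \<mu> k powr (2 / \<tau>)) \<le> interp_const \<tau> powr (2 / \<tau>)"
proof -
  let ?S = "{- int N..int N}"
  obtain K :: nat and e :: "nat \<Rightarrow> int \<Rightarrow> complex" and \<mu> :: "nat \<Rightarrow> real"
    where on: "\<And>k l. k < K \<Longrightarrow> l < K \<Longrightarrow> ip ?S (e k) (e l) = (if k = l then 1 else 0)"
    and ev: "\<And>k n. k < K \<Longrightarrow> n \<in> ?S \<Longrightarrow> mat_app ?S Gram (e k) n = \<mu> k * e k n"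
    and comp: "\<And>n m. n \<in> ?S \<Longrightarrow> m \<in> ?S \<Longrightarrow> (\<Sum>k<K. e k n * cnj (e k m)) = (if n = m then 1 else 0)"
    by (rule hermitian_spectral_decomposition[where g = Gram and S = "{- int N..int N}"])
       (rule finite_atLeastAtMost_int, rule Gram_hermitian, blast)
  have expand: "b n = (\<Sum>k<K. ip ?S b (e k) * e k n)" if n: "n \<in> ?S" for b n
  proof -
    have "(\<Sum>k<K. ip ?S b (e k) * e k n) = (\<Sum>k<K. \<Sum>m\<in>?S. b m * (e k n * cnj (e k m)))"
      unfolding ip_def sum_distrib_right by (intro sum.cong refl) (simp add: mult_ac)
    also have "\<dots> = (\<Sum>m\<in>?S. b m * (\<Sum>k<K. e k n * cnj (e k m)))"
      by (subst sum.swap) (simp add: sum_distrib_left)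
    also have "\<dots> = (\<Sum>m\<in>?S. if m = n then b m else 0)"
    proof (intro sum.cong refl)
      fix l assume "l \<in> ?S"
      then show "b l * (\<Sum>k<K. e k n * cnj (e k l)) = (if l = n then b l else 0)" using comp[OF n, of l] by auto
    qed
    also have "\<dots> = b n" using n by (simp add: sum.delta)
    finally show ?thesis by simp
  qed
  have ipexp: "ip ?S b c = (\<Sum>k<K. ip ?S b (e k) * ip ?S (e k) c)" for b c
  proof -
    have "ip ?S b c = ip ?S (\<lambda>n. \<Sum>k<K. ip ?S b (e k) * e k n) c"
      unfolding ip_def[of _ _ c] by (intro sum.cong refl) (simp add: expand[symmetric])
    then show ?thesis by (simp add: ip_sum_left ip_scale_left)
  qed
  have energy: "ip ?S (mat_app ?S Gram b) b = of_real (\<Sum>k<K. \<mu> k * (norm (ip ?S b (e k)))\<^sup>2)" for b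
  proof -
    have "ip ?S (mat_app ?S Gram b) (e k) = of_real (\<mu> k) * ip ?S b (e k)" if k: "k < K" for k
    proof -
      have "ip ?S (mat_app ?S Gram b) (e k) = ip ?S b (mat_app ?S Gram (e k))"
        by (rule ip_mat_app_hermitian) (rule Gram_hermitian)
      also have "\<dots> = ip ?S b (\<lambda>n. of_real (\<mu> k) * e k n)"
        unfolding ip_def by (intro sum.cong refl) (simp add: ev[OF k])
      finally show ?thesis by (simp add: ip_scale_right)
    qed
    then have "ip ?S (mat_app ?S Gram b) b = (\<Sum>k<K. of_real (\<mu> k) * ip ?S b (e k) * ip ?S (e k) b)"
      unfolding ipexp[of "mat_app ?S Gram b" b] by (intro sum.cong refl) simp
    also have "\<dots> = (\<Sum>k<K. of_real (\<mu> k * (norm (ip ?S b (e k)))\<^sup>2))"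
      unfolding of_real_mult complex_norm_square ip_cnj by (simp add: mult_ac)
    finally show ?thesis by simp
  qed
  have en: "(\<integral>t. \<integral>x. V (t, x) * (norm (wave_packet N b (t, x)))\<^sup>2 \<partial>torus_measure \<partial>tm) = (\<Sum>k<K. \<mu> k * (norm (ip ?S b (e k)))\<^sup>2)" for b
  proof -
    have "complex_of_real (\<integral>t. \<integral>x. V (t, x) * (norm (wave_packet N b (t, x)))\<^sup>2 \<partial>torus_measure \<partial>tm) = of_real (\<Sum>k<K. \<mu> k * (norm (ip ?S b (e k)))\<^sup>2)"
      unfolding dint_energy[symmetric] dint_wave_packet2 energy ..
    then show ?thesis by (simp only: of_real_eq_iff)
  qed
  have nonneg: "0 \<le> \<mu> k" if k: "k < K" for k
  proof -
    have "(\<Sum>l<K. \<mu> l * (norm (ip ?S (e k) (e l)))\<^sup>2) = (\<Sum>l<K. if l = k then \<mu> l else 0)"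
      by (intro sum.cong refl) (use on k in auto)
    also have "\<dots> = \<mu> k" using k by (simp add: sum.delta)
    finally have "\<mu> k = (\<integral>t. \<integral>x. V (t, x) * (norm (wave_packet N (e k) (t, x)))\<^sup>2 \<partial>torus_measure \<partial>tm)" using en by simp
    also have "\<dots> \<ge> 0" using V_pos by (intro Bochner_Integration.integral_nonneg mult_nonneg_nonneg) (auto simp: less_imp_le)
    finally show ?thesis .
  qed
  have parseval: "(\<Sum>k<K. (norm (ip ?S b (e k)))\<^sup>2) = (\<Sum>n\<in>?S. (norm (b n))\<^sup>2)" for b
  proof -
    have "complex_of_real (\<Sum>n\<in>?S. (norm (b n))\<^sup>2) = (\<Sum>k<K. ip ?S b (e k) * ip ?S (e k) b)"
      unfolding ip_self[symmetric] by (rule ipexp)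
    also have "\<dots> = complex_of_real (\<Sum>k<K. (norm (ip ?S b (e k)))\<^sup>2)"
      unfolding of_real_sum complex_norm_square ip_cnj ..
    finally show ?thesis by (simp only: of_real_eq_iff)
  qed
  \<comment> \<open>Zero eigenvalues are removed because \<open>coef\<close> divides by
    \<open>\<mu> k\<close> and takes the logarithm of \<open>d k\<close>; they contribute nothing to
    the power sum.\<close>
  define J where "J = {k. k < K \<and> 0 < \<mu> k}"
  have J: "finite J" by (simp add: J_def)
  have sumJ: "(\<Sum>k<K. \<mu> k powr (2 / \<tau>)) = (\<Sum>k\<in>J. \<mu> k powr (2 / \<tau>))"
    using nonneg by (intro sum.mono_neutral_right) (auto simp: J_def order_less_le)
  have "(\<Sum>k\<in>J. \<mu> k powr (2 / \<tau>)) \<le> interp_const \<tau> powr (2 / \<tau>)"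
  proof (cases "J = {}")
    case False
    define Z where "Z = (\<Sum>k\<in>J. \<mu> k powr (2 / \<tau>))"
    have Z: "Z > 0" unfolding Z_def using J False by (intro sum_pos) (auto simp: J_def)
    \<comment> \<open>The case of equality in duality: the bounded sum becomes
      \<open>Z / Z powr (1 - \<tau> / 2) = Z powr (\<tau> / 2)\<close>, the Schatten norm
      itself.\<close>
    define d where "d k = \<mu> k powr (2 / \<tau>) / Z" for k
    interpret eigen_slab N t0 \<tau> m M V v J e \<mu> d
    proof
      show "finite J" by (rule J)
      show "0 < \<mu> k" if "k \<in> J" for k using that by (simp add: J_def)
      show "0 < d k" if "k \<in> J" for k using that Z by (simp add: J_def d_def)
      show "(\<Sum>k\<in>J. d k) \<le> 1" using Z by (simp add: d_def sum_divide_distrib[symmetric] Z_def)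
      fix k assume k: "k \<in> J"
      then have kK: "k < K" by (simp add: J_def)
      show "dint (\<lambda>z. of_real (V z) * ((\<Sum>n\<in>?S. e k n * wave n z) * cnj (\<Sum>n\<in>?S. e l n * wave n z))) = (if k = l then of_real (\<mu> k) else 0)"
        if "l \<in> J" for l
      proof -
        have l: "l < K" using that by (simp add: J_def)
        have "ip ?S (mat_app ?S Gram (e k)) (e l) = ip ?S (\<lambda>n. of_real (\<mu> k) * e k n) (e l)"
          unfolding ip_def by (intro sum.cong refl) (simp add: ev[OF kK])
        also have "\<dots> = (if k = l then of_real (\<mu> k) else 0)" by (simp add: ip_scale_left on kK l)
        finally show ?thesis using dint_wave_packet2[of "e k" "e l"] by (simp add: wave_packet_def)
      qed
      show "dint (\<lambda>z. of_real (V z) * ((\<Sum>n\<in>?S. e k n * wave n z) * cnj (wave n z))) = of_real (\<mu> k) * e k n" if "n \<in> ?S" for n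
        using dint_wave_packet[of "e k" n] ev[OF kK that] by (simp add: wave_packet_def)
      have "complex_of_real (\<Sum>n\<in>?S. (norm (e k n))\<^sup>2) = of_real 1" using on[OF kK kK] unfolding ip_self by simp
      then show "(\<Sum>n\<in>?S. (norm (e k n))\<^sup>2) = 1" by (simp only: of_real_eq_iff)
    qed
    have "d k powr (1 - \<tau> / 2) * \<mu> k = \<mu> k powr (2 / \<tau>) / Z powr (1 - \<tau> / 2)" if k: "k \<in> J" for k
    proof -
      have mk: "\<mu> k > 0" using k by (simp add: J_def)
      have "d k powr (1 - \<tau> / 2) = (\<mu> k powr (2 / \<tau>)) powr (1 - \<tau> / 2) / Z powr (1 - \<tau> / 2)"
        unfolding d_def using Z by (intro powr_divide)
      also have "(\<mu> k powr (2 / \<tau>)) powr (1 - \<tau> / 2) = \<mu> k powr (2 / \<tau> - 1)"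
      proof -
        have "2 / \<tau> * (1 - \<tau> / 2) = 2 / \<tau> - 1" using tau by (simp add: right_diff_distrib)
        then show ?thesis by (simp only: powr_powr)
      qed
      finally show ?thesis using mk by (simp add: powr_diff)
    qed
    then have "(\<Sum>k\<in>J. d k powr (1 - \<tau> / 2) * \<mu> k) = Z / Z powr (1 - \<tau> / 2)"
      by (simp add: sum_divide_distrib[symmetric] Z_def)
    also have "\<dots> = Z powr (\<tau> / 2)" using Z by (simp add: powr_diff)
    finally have "Z powr (\<tau> / 2) \<le> interp_const \<tau>" using weighted_eigenvalue_sum by simp
    then have "(Z powr (\<tau> / 2)) powr (2 / \<tau>) \<le> interp_const \<tau> powr (2 / \<tau>)" using tau by (intro powr_mono2) auto
    then show ?thesis using Z tau by (simp add: powr_powr Z_def)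
  qed simp
  then show ?thesis using that[of K e \<mu>] on nonneg en parseval sumJ by simp
qed

text \<open>Young's inequality for \<open>lam j / \<Lambda>\<close> and \<open>\<mu> k / C\<close>
  with the conjugate exponents \<open>2 / (2 - \<tau>)\<close> and \<open>2 / \<tau>\<close>,
  averaged against the doubly substochastic \<open>P\<close>. The row sums dispose of the first
  term, the column sums of the second.\<close>

lemma weighted_density_finite:
  assumes a: "contractive_family N a" and lam: "\<And>j. 0 \<le> lam j" and A: "finite A" and Lam: "0 < \<Lambda>"
    and bnd: "(\<Sum>j\<in>A. lam j powr (2 / (2 - \<tau>))) \<le> \<Lambda> powr (2 / (2 - \<tau>))"
  shows "(\<Sum>j\<in>A. lam j * (\<integral>t. \<integral>x. V (t, x) * (norm (wave_packet N (a j) (t, x)))\<^sup>2 \<partial>torus_measure \<partial>tm)) \<le> interp_const \<tau> * \<Lambda>"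
proof -
  let ?S = "{- int N..int N}"
  define C where "C = interp_const \<tau>"
  have C: "0 < C" unfolding C_def interp_const_def using tau by (intro add_pos_nonneg mult_pos_pos) auto
  obtain K :: nat and e :: "nat \<Rightarrow> int \<Rightarrow> complex" and \<mu> :: "nat \<Rightarrow> real"
    where on: "\<And>k l. k < K \<Longrightarrow> l < K \<Longrightarrow> ip ?S (e k) (e l) = (if k = l then 1 else 0)"
    and nonneg: "\<And>k. k < K \<Longrightarrow> 0 \<le> \<mu> k"
    and en: "\<And>b. (\<integral>t. \<integral>x. V (t, x) * (norm (wave_packet N b (t, x)))\<^sup>2 \<partial>torus_measure \<partial>tm) = (\<Sum>k<K. \<mu> k * (norm (ip ?S b (e k)))\<^sup>2)"
    and parseval: "\<And>b. (\<Sum>k<K. (norm (ip ?S b (e k)))\<^sup>2) = (\<Sum>n\<in>?S. (norm (b n))\<^sup>2)"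
    and sch: "(\<Sum>k<K. \<mu> k powr (2 / \<tau>)) \<le> C powr (2 / \<tau>)"
    unfolding C_def using Gram_eigenvalues by blast
  define P where "P j k = (norm (ip ?S (a j) (e k)))\<^sup>2" for j k
  have P0: "0 \<le> P j k" for j k by (simp add: P_def)
  have Pk: "(\<Sum>k<K. P j k) \<le> 1" for j using a parseval[of "a j"] by (simp add: P_def contractive_family_def)
  have Pj: "(\<Sum>j\<in>A. P j k) \<le> 1" if "k < K" for k
  proof -
    have "(\<Sum>j\<in>A. P j k) \<le> (\<Sum>n\<in>?S. (norm (cnj (e k n)))\<^sup>2)"
      using contractive_familyD(2)[OF a A, of "\<lambda>n. cnj (e k n)"] by (simp add: P_def ip_def)
    also have "\<dots> = 1"
    proof -
      have "complex_of_real (\<Sum>n\<in>?S. (norm (e k n))\<^sup>2) = of_real 1" using on[OF that that] unfolding ip_self by simp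
      then show ?thesis by (simp only: of_real_eq_iff complex_mod_cnj)
    qed
    finally show ?thesis .
  qed
  define p1 p2 where "p1 = 2 / (2 - \<tau>)" and "p2 = 2 / \<tau>"
  have p12: "p1 > 1" "p2 > 1" "1 / p1 + 1 / p2 = 1" using tau by (auto simp: p1_def p2_def field_simps)
  have young: "lam j / \<Lambda> * (\<mu> k / C) \<le> (lam j / \<Lambda>) powr p1 / p1 + (\<mu> k / C) powr p2 / p2" if "k < K" for j k
    using p12 lam[of j] Lam nonneg[OF that] C by (intro Youngs_inequality) auto
  have "(\<Sum>j\<in>A. lam j * (\<Sum>k<K. \<mu> k * P j k)) = (\<Lambda> * C) * (\<Sum>j\<in>A. \<Sum>k<K. (lam j / \<Lambda> * (\<mu> k / C)) * P j k)"
    using Lam C by (simp add: sum_distrib_left mult_ac)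
  also have "\<dots> \<le> (\<Lambda> * C) * (\<Sum>j\<in>A. \<Sum>k<K. ((lam j / \<Lambda>) powr p1 / p1 + (\<mu> k / C) powr p2 / p2) * P j k)"
    using Lam C young P0 by (intro mult_left_mono sum_mono mult_right_mono) auto
  also have "(\<Sum>j\<in>A. \<Sum>k<K. ((lam j / \<Lambda>) powr p1 / p1 + (\<mu> k / C) powr p2 / p2) * P j k)
      = (\<Sum>j\<in>A. (lam j / \<Lambda>) powr p1 / p1 * (\<Sum>k<K. P j k)) + (\<Sum>k<K. (\<mu> k / C) powr p2 / p2 * (\<Sum>j\<in>A. P j k))"
    unfolding distrib_right sum.distrib sum_distrib_left by (subst (2) sum.swap) simp
  also have "(\<Lambda> * C) * \<dots> \<le> (\<Lambda> * C) * ((\<Sum>j\<in>A. (lam j / \<Lambda>) powr p1 / p1 * 1) + (\<Sum>k<K. (\<mu> k / C) powr p2 / p2 * 1))"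
    using Lam C p12 Pk Pj by (intro mult_left_mono add_mono sum_mono) auto
  also have "\<dots> \<le> (\<Lambda> * C) * (1 / p1 + 1 / p2)"
  proof -
    have "(\<Sum>j\<in>A. (lam j / \<Lambda>) powr p1) = (\<Sum>j\<in>A. lam j powr p1) / \<Lambda> powr p1"
      using lam Lam by (simp add: powr_divide sum_divide_distrib)
    also have "\<dots> \<le> 1" using bnd Lam by (simp add: p1_def)
    finally have 1: "(\<Sum>j\<in>A. (lam j / \<Lambda>) powr p1 / p1 * 1) \<le> 1 / p1"
      using p12 by (simp add: sum_divide_distrib[symmetric] divide_right_mono)
    have "(\<Sum>k<K. (\<mu> k / C) powr p2) = (\<Sum>k<K. \<mu> k powr p2) / C powr p2"
      using nonneg C by (simp add: powr_divide sum_divide_distrib)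
    also have "\<dots> \<le> 1" using sch C by (simp add: p2_def)
    finally have 2: "(\<Sum>k<K. (\<mu> k / C) powr p2 / p2 * 1) \<le> 1 / p2"
      using p12 by (simp add: sum_divide_distrib[symmetric] divide_right_mono)
    show ?thesis using 1 2 Lam C by (intro mult_left_mono add_mono) auto
  qed
  finally show ?thesis unfolding en p12(3) P_def C_def by (simp add: mult.commute)
qed

end

section \<open>Extremal weights and the bound for the density on one slab\<close>

definition pos_bounded :: "('a \<Rightarrow> real) \<Rightarrow> bool" where
  "pos_bounded f \<longleftrightarrow> (\<exists>m M. 0 < m \<and> (\<forall>z. m \<le> f z \<and> f z \<le> M))"

lemma pos_boundedI: "0 < m \<Longrightarrow> (\<And>z. m \<le> f z) \<Longrightarrow> (\<And>z. f z \<le> M) \<Longrightarrow> pos_bounded f"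
  unfolding pos_bounded_def by blast

lemma pos_bounded_pos: "pos_bounded f \<Longrightarrow> 0 < f z"
  unfolding pos_bounded_def by (metis less_le_trans)

lemma pos_bounded_mult: "pos_bounded f \<Longrightarrow> pos_bounded g \<Longrightarrow> pos_bounded (\<lambda>z. f z * g z)"
proof -
  assume f: "pos_bounded f" and g: "pos_bounded g"
  then obtain m M m' M' where b: "0 < m" "\<And>z. m \<le> f z" "\<And>z. f z \<le> M" "0 < m'" "\<And>z. m' \<le> g z" "\<And>z. g z \<le> M'"
    unfolding pos_bounded_def by blast
  show ?thesis
  proof (rule pos_boundedI[of "m * m'" _ "M * M'"])
    fix z
    show "m * m' \<le> f z * g z" using b less_imp_le[OF pos_bounded_pos[OF f, of z]] by (intro mult_mono) auto
    show "f z * g z \<le> M * M'" using b(3)[of z] b(6)[of z] pos_bounded_pos[OF f, of z] pos_bounded_pos[OF g, of z] by (intro mult_mono) linarith+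
  qed (use b in auto)
qed

text \<open>Two-sided bounds allow exponents of either sign; the exponent \<open>p - q\<close> of
  the extremal weight can be negative.\<close>

lemma pos_bounded_powr: "pos_bounded f \<Longrightarrow> pos_bounded (\<lambda>z. f z powr e)"
proof -
  assume f: "pos_bounded f"
  then obtain m M where b: "0 < m" "\<And>z. m \<le> f z" "\<And>z. f z \<le> M" unfolding pos_bounded_def by blast
  have M: "0 < M" using b(1) b(2)[of undefined] b(3)[of undefined] by linarith
  have p: "0 < f z" for z using pos_bounded_pos[OF f] .
  show ?thesis
  proof (cases "0 \<le> e")
    case True
    show ?thesis by (rule pos_boundedI[of "m powr e" _ "M powr e"]) (use b p True in \<open>auto intro!: powr_mono2 simp: less_imp_le\<close>)
  next
    case False
    show ?thesis by (rule pos_boundedI[of "M powr e" _ "m powr e"]) (use b p M False in \<open>auto intro!: powr_mono2'\<close>)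
  qed
qed

lemma pos_bounded_const: "0 < c \<Longrightarrow> pos_bounded (\<lambda>z. c)"
  by (rule pos_boundedI[of c _ c]) auto

lemma pos_bounded_compose: "pos_bounded f \<Longrightarrow> pos_bounded (\<lambda>z. f (h z))"
  unfolding pos_bounded_def by blast

lemma pos_bounded_bounded_borel: "pos_bounded f \<Longrightarrow> f \<in> borel_measurable M \<Longrightarrow> bounded_borel M f"
proof -
  assume f: "pos_bounded f" "f \<in> borel_measurable M"
  then obtain m C where "0 < m" "\<And>z. m \<le> f z" "\<And>z. f z \<le> C" unfolding pos_bounded_def by blast
  then show ?thesis using f(2) pos_bounded_pos[OF f(1)] by (intro bounded_borelI[of f M C]) (auto simp: less_imp_le)
qed

lemma measure_torus: "measure torus_measure UNIV = 2 * pi"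
  by (simp add: measure_def emeasure_interval_measure_on emeasure_torus)

lemma emeasure_torus_measure: "emeasure torus_measure UNIV = ennreal (2 * pi)"
  by (simp add: emeasure_interval_measure_on emeasure_torus)

definition wave_density :: "nat \<Rightarrow> (nat \<Rightarrow> real) \<Rightarrow> (nat \<Rightarrow> int \<Rightarrow> complex) \<Rightarrow> real \<times> real \<Rightarrow> real" where
  "wave_density N lam a z = (\<Sum>j. lam j * (norm (wave_packet N (a j) z))\<^sup>2)"

text \<open>Bessel's inequality for the vector of the unimodular values \<open>wave n z\<close>. Its
  dependence on \<open>N\<close> is harmless, since it only provides boundedness.\<close>

lemma wave_density_partial_sum_le:
  assumes a: "contractive_family N a" and lam: "\<And>j. 0 \<le> lam j" "\<And>j. lam j \<le> L"
  shows "(\<Sum>j<n. lam j * (norm (wave_packet N (a j) z))\<^sup>2) \<le> L * (2 * real N + 1)"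
proof -
  have "(\<Sum>j<n. lam j * (norm (wave_packet N (a j) z))\<^sup>2) \<le> (\<Sum>j<n. L * (norm (wave_packet N (a j) z))\<^sup>2)"
    using lam by (intro sum_mono mult_right_mono) auto
  also have "\<dots> = L * (\<Sum>j<n. (norm (wave_packet N (a j) z))\<^sup>2)" by (simp add: sum_distrib_left)
  also have "\<dots> \<le> L * (\<Sum>n\<in>{- int N..int N}. (norm (wave n z))\<^sup>2)"
    unfolding wave_packet_def using lam(1)[of 0] lam(2)[of 0] by (intro mult_left_mono contractive_familyD(2)[OF a]) auto
  finally show ?thesis by simp
qed

lemma wave_density_summable:
  assumes a: "contractive_family N a" and lam: "\<And>j. 0 \<le> lam j" "\<And>j. lam j \<le> L"
  shows "summable (\<lambda>j. lam j * (norm (wave_packet N (a j) z))\<^sup>2)"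
  by (rule summableI_nonneg_bounded[OF _ wave_density_partial_sum_le[OF a lam]]) (simp add: lam)

lemma wave_density_bounds:
  assumes a: "contractive_family N a" and lam: "\<And>j. 0 \<le> lam j" "\<And>j. lam j \<le> L"
  shows "0 \<le> wave_density N lam a z" "wave_density N lam a z \<le> L * (2 * real N + 1)"
proof -
  have s: "summable (\<lambda>j. lam j * (norm (wave_packet N (a j) z))\<^sup>2)" by (rule wave_density_summable[OF a lam])
  show "0 \<le> wave_density N lam a z" unfolding wave_density_def using lam(1) by (intro suminf_nonneg[OF s]) simp
  show "wave_density N lam a z \<le> L * (2 * real N + 1)"
    unfolding wave_density_def by (intro suminf_le_const[OF s] wave_density_partial_sum_le[OF a lam])
qed

lemma wave_density_measurable [measurable]: "wave_density N lam a \<in> borel_measurable (borel \<Otimes>\<^sub>M borel)"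
  unfolding wave_density_def[abs_def] by measurable

context time_slab
begin

lemma measure_tm: "emeasure tm UNIV = ennreal (1 / real N)"
  by (simp add: tm_def emeasure_interval_measure_on slab_def)

lemma pos_bounded_integral_torus:
  assumes f: "pos_bounded f" and [measurable]: "f \<in> borel_measurable (borel \<Otimes>\<^sub>M borel)"
  shows "pos_bounded (\<lambda>t. \<integral>x. f (t, x) \<partial>torus_measure)"
proof -
  obtain m M where b: "0 < m" "\<And>z. m \<le> f z" "\<And>z. f z \<le> M" using f unfolding pos_bounded_def by blast
  have i: "integrable torus_measure (\<lambda>x. f (t, x))" for t
    by (intro bounded_borel_integrable[OF finite_torus_measure] bounded_borel_section pos_bounded_bounded_borel f) measurable
  have ic: "integrable torus_measure (\<lambda>x. c)" for c :: real
    by (intro bounded_borel_integrable[OF finite_torus_measure] bounded_borel_const)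
  show ?thesis
  proof (rule pos_boundedI[of "2 * pi * m" _ "2 * pi * M"])
    fix t
    show "2 * pi * m \<le> (\<integral>x. f (t, x) \<partial>torus_measure)"
      using integral_mono[OF ic i, of m t] b by (simp add: measure_torus mult_ac)
    show "(\<integral>x. f (t, x) \<partial>torus_measure) \<le> 2 * pi * M"
      using integral_mono[OF i ic, of t M] b by (simp add: measure_torus mult_ac)
  qed (use b in auto)
qed

lemma nn_integral_double_eq:
  assumes f: "bounded_borel (borel \<Otimes>\<^sub>M borel) f" and f0: "\<And>z. 0 \<le> f z"
  shows "(\<integral>\<^sup>+ t. \<integral>\<^sup>+ x. ennreal (f (t, x)) \<partial>torus_measure \<partial>tm) = ennreal (\<integral>t. \<integral>x. f (t, x) \<partial>torus_measure \<partial>tm)"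
proof -
  have "(\<integral>\<^sup>+ x. ennreal (f (t, x)) \<partial>torus_measure) = ennreal (\<integral>x. f (t, x) \<partial>torus_measure)" for t
    using f0 by (intro nn_integral_eq_integral bounded_borel_integrable[OF finite_torus_measure] bounded_borel_section f) auto
  then have "(\<integral>\<^sup>+ t. \<integral>\<^sup>+ x. ennreal (f (t, x)) \<partial>torus_measure \<partial>tm) = (\<integral>\<^sup>+ t. ennreal (\<integral>x. f (t, x) \<partial>torus_measure) \<partial>tm)" by simp
  also have "\<dots> = ennreal (\<integral>t. \<integral>x. f (t, x) \<partial>torus_measure \<partial>tm)"
    using f0 by (intro nn_integral_eq_integral bounded_borel_integrable[OF finite_tm] bounded_borel_tm bounded_borel_inner_integral f) auto
  finally show ?thesis .
qed

end

context weighted_slab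
begin

lemma weighted_density:
  assumes a: "contractive_family N a" and lam: "\<And>j. 0 \<le> lam j" "\<And>j. lam j \<le> \<Lambda>" and Lam: "0 < \<Lambda>"
    and bnd: "\<And>n. (\<Sum>j<n. lam j powr (2 / (2 - \<tau>))) \<le> \<Lambda> powr (2 / (2 - \<tau>))"
  shows "(\<integral>\<^sup>+ t. \<integral>\<^sup>+ x. ennreal (V (t, x) * wave_density N lam a (t, x)) \<partial>torus_measure \<partial>tm) \<le> ennreal (interp_const \<tau> * \<Lambda>)"
proof -
  define g where "g j z = lam j * (V z * (norm (wave_packet N (a j) z))\<^sup>2)" for j z
  have gm: "bounded_borel (borel \<Otimes>\<^sub>M borel) (g j)" for j
    unfolding g_def power2_eq_square by (intro bounded_borel_mult bounded_borel_const bounded_borel_norm bounded_V bounded_wave_packet)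
  have [measurable]: "g j \<in> borel_measurable (borel \<Otimes>\<^sub>M borel)" for j using gm by (rule bounded_borel_measurable)
  have g0: "0 \<le> g j z" for j z using lam(1)[of j] V_pos[of z] by (simp add: g_def)
  have "ennreal (V z * wave_density N lam a z) = (\<Sum>j. ennreal (g j z))" for z
  proof -
    have s: "summable (\<lambda>j. lam j * (norm (wave_packet N (a j) z))\<^sup>2)" by (rule wave_density_summable[OF a lam])
    have "V z * wave_density N lam a z = (\<Sum>j. g j z)"
      unfolding wave_density_def suminf_mult[OF s, symmetric] by (simp add: g_def mult_ac)
    moreover have "summable (\<lambda>j. g j z)" using summable_mult[OF s, of "V z"] by (simp add: g_def mult_ac)
    ultimately show ?thesis using g0 by (simp add: suminf_ennreal2)
  qed
  then have "(\<integral>\<^sup>+ t. \<integral>\<^sup>+ x. ennreal (V (t, x) * wave_density N lam a (t, x)) \<partial>torus_measure \<partial>tm) = (\<integral>\<^sup>+ t. \<integral>\<^sup>+ x. (\<Sum>j. ennreal (g j (t, x))) \<partial>torus_measure \<partial>tm)" by simp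
  also have "\<dots> = (\<integral>\<^sup>+ t. (\<Sum>j. \<integral>\<^sup>+ x. ennreal (g j (t, x)) \<partial>torus_measure) \<partial>tm)"
    by (intro nn_integral_cong nn_integral_suminf) measurable
  also have "\<dots> = (\<Sum>j. \<integral>\<^sup>+ t. \<integral>\<^sup>+ x. ennreal (g j (t, x)) \<partial>torus_measure \<partial>tm)"
  proof (rule nn_integral_suminf)
    fix j
    have "(\<lambda>t. \<integral>\<^sup>+ x. ennreal (g j (t, x)) \<partial>torus_measure) \<in> borel_measurable borel"
      by (rule sigma_finite_measure.borel_measurable_nn_integral[OF sigma_finite(2)]) (simp add: case_prod_unfold)
    then show "(\<lambda>t. \<integral>\<^sup>+ x. ennreal (g j (t, x)) \<partial>torus_measure) \<in> borel_measurable tm" by measurable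
  qed
  also have "\<dots> \<le> ennreal (interp_const \<tau> * \<Lambda>)"
  proof (rule suminf_le_const)
    fix n
    have "(\<Sum>j<n. \<integral>\<^sup>+ t. \<integral>\<^sup>+ x. ennreal (g j (t, x)) \<partial>torus_measure \<partial>tm) = (\<Sum>j<n. ennreal (\<integral>t. \<integral>x. g j (t, x) \<partial>torus_measure \<partial>tm))"
      by (intro sum.cong refl nn_integral_double_eq gm g0)
    also have "\<dots> = ennreal (\<Sum>j<n. \<integral>t. \<integral>x. g j (t, x) \<partial>torus_measure \<partial>tm)"
      using g0 by (intro sum_ennreal Bochner_Integration.integral_nonneg)
    also have "\<dots> \<le> ennreal (interp_const \<tau> * \<Lambda>)"
    proof (rule ennreal_leI)
      have "(\<integral>t. \<integral>x. g j (t, x) \<partial>torus_measure \<partial>tm) = lam j * (\<integral>t. \<integral>x. V (t, x) * (norm (wave_packet N (a j) (t, x)))\<^sup>2 \<partial>torus_measure \<partial>tm)" for j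
        unfolding g_def by simp
      then show "(\<Sum>j<n. \<integral>t. \<integral>x. g j (t, x) \<partial>torus_measure \<partial>tm) \<le> interp_const \<tau> * \<Lambda>"
        using weighted_density_finite[OF a lam(1) finite_lessThan Lam bnd] by simp
    qed
    finally show "(\<Sum>j<n. \<integral>\<^sup>+ t. \<integral>\<^sup>+ x. ennreal (g j (t, x)) \<partial>torus_measure \<partial>tm) \<le> ennreal (interp_const \<tau> * \<Lambda>)" .
  qed simp
  finally show ?thesis .
qed

text \<open>Controls the error caused by the shift \<open>\<eta>\<close>. Since
  \<open>y \<le> 1 + y powr e\<close> for \<open>e \<ge> 1\<close>, the normalised norms bound the
  plain integrals: \<open>2 * pi + 1\<close> in space, and 2 in time because the slab has length at
  most 1.\<close>

lemma total_weight: "(\<integral>\<^sup>+ t. \<integral>\<^sup>+ x. ennreal (V (t, x)) \<partial>torus_measure \<partial>tm) \<le> ennreal (2 * (2 * pi + 1))"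
proof -
  define E where "E z = (V z / v (fst z)) powr (1 / \<tau>)" for z
  have [measurable]: "E \<in> borel_measurable (borel \<Otimes>\<^sub>M borel)" unfolding E_def[abs_def] by measurable
  have E1: "(\<integral>\<^sup>+ x. ennreal (E (t, x)) \<partial>torus_measure) = 1" for t
  proof -
    have "integrable torus_measure (\<lambda>x. E (t, x))"
      using V_norm[of t] not_integrable_integral_eq[of torus_measure "\<lambda>x. E (t, x)"] by (auto simp: E_def)
    then show ?thesis using V_norm[of t] by (subst nn_integral_eq_integral) (auto simp: E_def)
  qed
  have le: "y \<le> 1 + y powr e" if "0 < y" "1 \<le> e" for y e :: real
  proof (cases "y \<le> 1")
    case False
    then have "y powr 1 \<le> y powr e" using that by (intro powr_mono) auto
    then show ?thesis using that by simp
  qed (simp add: add_increasing2)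
  have inner: "(\<integral>\<^sup>+ x. ennreal (V (t, x)) \<partial>torus_measure) \<le> ennreal (2 * pi + 1) * ennreal (v t)" for t
  proof -
    have "(\<integral>\<^sup>+ x. ennreal (V (t, x)) \<partial>torus_measure) \<le> (\<integral>\<^sup>+ x. ennreal (v t) * (1 + ennreal (E (t, x))) \<partial>torus_measure)"
    proof (rule nn_integral_mono)
      fix x
      have "V (t, x) / v t \<le> 1 + E (t, x)" unfolding E_def using V_pos[of "(t, x)"] v_pos[of t] tau by (simp add: le)
      then have "V (t, x) \<le> v t * (1 + E (t, x))" using v_pos[of t] by (simp add: field_simps)
      then show "ennreal (V (t, x)) \<le> ennreal (v t) * (1 + ennreal (E (t, x)))"
        using v_pos[of t] by (simp add: ennreal_leI ennreal_mult[symmetric] ennreal_plus[symmetric] E_def del: ennreal_plus flip: ennreal_1)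
    qed
    also have "\<dots> = ennreal (v t) * (\<integral>\<^sup>+ x. 1 + ennreal (E (t, x)) \<partial>torus_measure)" by (rule nn_integral_cmult) measurable
    also have "(\<integral>\<^sup>+ x. 1 + ennreal (E (t, x)) \<partial>torus_measure) = ennreal (2 * pi) + 1"
      by (subst nn_integral_add) (auto simp: E1 emeasure_torus_measure)
    finally show ?thesis by (simp add: mult.commute)
  qed
  have "(\<integral>\<^sup>+ t. ennreal (v t) \<partial>tm) \<le> (\<integral>\<^sup>+ t. 1 + ennreal (v t powr (2 / (2 - \<tau>))) \<partial>tm)"
  proof (rule nn_integral_mono)
    fix t
    have "v t \<le> 1 + v t powr (2 / (2 - \<tau>))" using v_pos[of t] tau by (intro le) auto
    then show "ennreal (v t) \<le> 1 + ennreal (v t powr (2 / (2 - \<tau>)))"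
      by (simp add: ennreal_leI ennreal_plus[symmetric] del: ennreal_plus flip: ennreal_1)
  qed
  also have "\<dots> = ennreal (1 / real N) + (\<integral>\<^sup>+ t. ennreal (v t powr (2 / (2 - \<tau>))) \<partial>tm)"
    by (subst nn_integral_add) (auto simp: measure_tm)
  also have "\<dots> \<le> 1 + 1" using v_norm N by (intro add_mono) (auto intro!: ennreal_le_1[THEN iffD2])
  finally have v2: "(\<integral>\<^sup>+ t. ennreal (v t) \<partial>tm) \<le> 2" by simp
  have "(\<integral>\<^sup>+ t. \<integral>\<^sup>+ x. ennreal (V (t, x)) \<partial>torus_measure \<partial>tm) \<le> (\<integral>\<^sup>+ t. ennreal (2 * pi + 1) * ennreal (v t) \<partial>tm)"
    by (intro nn_integral_mono inner)
  also have "\<dots> = ennreal (2 * pi + 1) * (\<integral>\<^sup>+ t. ennreal (v t) \<partial>tm)" by (rule nn_integral_cmult) measurable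
  also have "\<dots> \<le> ennreal (2 * pi + 1) * ennreal 2" using v2 by (intro mult_left_mono) auto
  also have "\<dots> = ennreal (2 * (2 * pi + 1))" by (subst ennreal_mult[symmetric]) (auto simp: mult.commute)
  finally show ?thesis .
qed

end

context time_slab
begin

text \<open>The weight \<open>V\<close> is the extremal one for the duality of mixed norms, applied to \<open>R = \<rho> + \<eta>\<close>; the shift by \<open>\<eta>\<close> keeps \<open>ln V\<close> bounded.\<close>

lemma slab_density_bound_aux:
  assumes q: "1 < q" and tau_eq: "\<tau> = 1 - 1 / q" and p_eq: "p = 2 / \<tau>"
    and a: "contractive_family N a" and lam: "\<And>j. 0 \<le> lam j" "\<And>j. lam j \<le> \<Lambda>" and Lam: "0 < \<Lambda>"
    and bnd: "\<And>n. (\<Sum>j<n. lam j powr (2 / (2 - \<tau>))) \<le> \<Lambda> powr (2 / (2 - \<tau>))"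
    and eta: "0 < \<eta>"
  shows "(\<integral>\<^sup>+ t. ennreal ((\<integral>x. wave_density N lam a (t, x) powr q \<partial>torus_measure) powr (p / q)) \<partial>tm)
      \<le> ennreal ((interp_const \<tau> * \<Lambda> + \<eta> * (2 * (2 * pi + 1))) powr p)"
proof -
  let ?T = torus_measure
  have tau: "0 < \<tau>" "\<tau> < 1" using q by (auto simp: tau_eq)
  have p: "2 < p" using tau by (simp add: p_eq field_simps)
  define \<rho> where "\<rho> = wave_density N lam a"
  have [measurable]: "\<rho> \<in> borel_measurable (borel \<Otimes>\<^sub>M borel)" unfolding \<rho>_def by measurable
  have \<rho>: "0 \<le> \<rho> z" "\<rho> z \<le> \<Lambda> * (2 * real N + 1)" for z
    unfolding \<rho>_def by (rule wave_density_bounds[OF a lam])+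
  define R where "R z = \<rho> z + \<eta>" for z
  have Rm[measurable]: "R \<in> borel_measurable (borel \<Otimes>\<^sub>M borel)" unfolding R_def[abs_def] by measurable
  have Rb: "pos_bounded R" by (rule pos_boundedI[of \<eta> _ "\<Lambda> * (2 * real N + 1) + \<eta>"]) (use eta \<rho> in \<open>auto simp: R_def\<close>)
  note Rpos = pos_bounded_pos[OF Rb]
  define S where "S t = (\<integral>x. R (t, x) powr q \<partial>?T)" for t
  have Sb: "pos_bounded S" unfolding S_def by (rule pos_bounded_integral_torus[OF pos_bounded_powr[OF Rb]]) measurable
  have Rqb: "bounded_borel (borel \<Otimes>\<^sub>M borel) (\<lambda>z. R z powr q)"
    by (rule pos_bounded_bounded_borel[OF pos_bounded_powr[OF Rb]]) measurable
  have Sm[measurable]: "S \<in> borel_measurable borel"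
    using bounded_borel_measurable[OF bounded_borel_inner_integral[OF Rqb]] by (simp add: S_def[abs_def])
  note Spos = pos_bounded_pos[OF Sb]
  define r where "r t = S t powr (1 / q)" for t
  have rm[measurable]: "r \<in> borel_measurable borel" unfolding r_def[abs_def] by measurable
  have rb: "pos_bounded r" unfolding r_def by (rule pos_bounded_powr[OF Sb])
  note rpos = pos_bounded_pos[OF rb]
  have rq: "r t powr q = S t" for t using q Spos[of t] by (simp add: r_def powr_powr)
  define Z where "Z = (\<integral>t. r t powr p \<partial>tm)"
  have rpb: "bounded_borel borel (\<lambda>t. r t powr p)" by (rule pos_bounded_bounded_borel[OF pos_bounded_powr[OF rb]]) measurable
  have rpi: "integrable tm (\<lambda>t. r t powr p)" by (rule bounded_borel_integrable[OF finite_tm bounded_borel_tm[OF rpb]])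
  have Znn: "(\<integral>\<^sup>+ t. ennreal (r t powr p) \<partial>tm) = ennreal Z"
    unfolding Z_def by (rule nn_integral_eq_integral[OF rpi]) simp
  have Zpos: "0 < Z"
  proof -
    obtain m M where mM: "0 < m" "\<And>t. m \<le> r t powr p" "\<And>t. r t powr p \<le> M"
      using pos_bounded_powr[OF rb, of p] unfolding pos_bounded_def by blast
    have "0 < m * (1 / real N)" using mM N by simp
    also have "\<dots> = (\<integral>t. m \<partial>tm)" by (simp add: measure_def measure_tm)
    also have "\<dots> \<le> Z" unfolding Z_def
      by (intro integral_mono rpi mM(2) bounded_borel_integrable[OF finite_tm bounded_borel_const])
    finally show ?thesis .
  qed
  \<comment> \<open>Since \<open>1 - \<tau> / 2\<close> is the reciprocal of
    \<open>2 / (2 - \<tau>)\<close>, this factor normalises \<open>v\<close> exactly.\<close>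
  define Zc where "Zc = Z powr (\<tau> / 2 - 1)"
  have Zc: "0 < Zc" using Zpos by (simp add: Zc_def)
  define V where "V z = R z powr (q - 1) * r (fst z) powr (p - q) * Zc" for z
  define v where "v t = r t powr (p - 1) * Zc" for t
  have Vm[measurable]: "V \<in> borel_measurable (borel \<Otimes>\<^sub>M borel)" unfolding V_def[abs_def] by measurable
  have vm[measurable]: "v \<in> borel_measurable borel" unfolding v_def[abs_def] by measurable
  have Vb: "pos_bounded V" unfolding V_def
    by (intro pos_bounded_mult pos_bounded_powr Rb pos_bounded_const Zc pos_bounded_compose[OF rb])
  have vb: "pos_bounded v" unfolding v_def by (intro pos_bounded_mult pos_bounded_powr rb pos_bounded_const Zc)
  obtain m1 M1 where 1: "0 < m1" "\<And>z. m1 \<le> V z" "\<And>z. V z \<le> M1" using Vb unfolding pos_bounded_def by blast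
  obtain m2 M2 where 2: "0 < m2" "\<And>t. m2 \<le> v t" "\<And>t. v t \<le> M2" using vb unfolding pos_bounded_def by blast
  \<comment> \<open>\<open>V / v\<close> is \<open>(R / r)\<close> to the power
    \<open>q - 1\<close>, and \<open>(q - 1) / \<tau> = q\<close>, so \<open>V_norm\<close> reduces
    to the definition of \<open>S\<close>.\<close>
  have Vv: "(V (t, x) / v t) powr (1 / \<tau>) = R (t, x) powr q / S t" for t x
  proof -
    have "V (t, x) / v t = R (t, x) powr (q - 1) * (r t powr (p - q) / r t powr (p - 1))"
      using Zc by (simp add: V_def v_def)
    also have "r t powr (p - q) / r t powr (p - 1) = r t powr (- (q - 1))" by (simp add: powr_diff[symmetric])
    also have "\<dots> = 1 / r t powr (q - 1)" by (rule powr_minus_divide)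
    finally have "V (t, x) / v t = (R (t, x) / r t) powr (q - 1)"
      using Rpos[of "(t, x)"] rpos[of t] by (simp add: powr_divide)
    moreover have "(q - 1) * (1 / \<tau>) = q" using q by (simp add: tau_eq field_simps)
    ultimately have "(V (t, x) / v t) powr (1 / \<tau>) = (R (t, x) / r t) powr q" by (simp only: powr_powr)
    then show ?thesis using Rpos[of "(t, x)"] rpos[of t] by (simp add: powr_divide rq)
  qed
  have vp: "v t powr (2 / (2 - \<tau>)) = r t powr p / Z" for t
  proof -
    have "v t powr (2 / (2 - \<tau>)) = (r t powr (p - 1)) powr (2 / (2 - \<tau>)) * Zc powr (2 / (2 - \<tau>))"
      unfolding v_def by (intro powr_mult)
    also have "(r t powr (p - 1)) powr (2 / (2 - \<tau>)) = r t powr p"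
    proof -
      have "(p - 1) * (2 / (2 - \<tau>)) = p"
      proof -
        have "p - 1 = (2 - \<tau>) / \<tau>" using tau by (simp add: p_eq diff_divide_distrib)
        moreover have "x / y * (2 / x) = 2 / y" if "x \<noteq> 0" for x y :: real using that by simp
        ultimately show ?thesis using tau by (simp only: p_eq)
      qed
      then show ?thesis by (simp only: powr_powr)
    qed
    also have "Zc powr (2 / (2 - \<tau>)) = Z powr (- 1)"
    proof -
      have "(\<tau> / 2 - 1) * (2 / (2 - \<tau>)) = - 1"
      proof -
        have "\<tau> / 2 - 1 = - ((2 - \<tau>) / 2)" by (simp add: diff_divide_distrib)
        moreover have "- (x / 2) * (2 / x) = - 1" if "x \<noteq> 0" for x :: real using that by simp
        ultimately show ?thesis using tau by (simp only:)
      qed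
      then show ?thesis unfolding Zc_def by (simp only: powr_powr)
    qed
    finally show ?thesis using Zpos by (simp add: powr_minus_divide)
  qed
  interpret weighted_slab N t0 \<tau> "min m1 m2" "max M1 M2" V v
  proof
    show "0 < min m1 m2" using 1 2 by simp
    show "min m1 m2 \<le> V z" "V z \<le> max M1 M2" for z using 1(2)[of z] 1(3)[of z] by auto
    show "min m1 m2 \<le> v t" "v t \<le> max M1 M2" for t using 2(2)[of t] 2(3)[of t] by auto
    show "(\<integral>x. (V (t, x) / v t) powr (1 / \<tau>) \<partial>?T) = 1" for t
      unfolding Vv using Spos[of t] by (simp add: S_def[symmetric])
    have "(\<integral>\<^sup>+ t. ennreal (v t powr (2 / (2 - \<tau>))) \<partial>tm) = (\<integral>\<^sup>+ t. ennreal (1 / Z) * ennreal (r t powr p) \<partial>tm)"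
      using Zpos by (simp add: vp ennreal_mult[symmetric])
    also have "\<dots> = ennreal (1 / Z) * ennreal Z" by (subst nn_integral_cmult) (auto simp: Znn)
    also have "\<dots> = 1" using Zpos by (simp add: ennreal_mult[symmetric])
    finally show "(\<integral>\<^sup>+ t. ennreal (v t powr (2 / (2 - \<tau>))) \<partial>tm) \<le> 1" by simp
  qed (use tau in measurable)
  \<comment> \<open>Equality in Hoelder's inequality: \<open>V * R\<close> integrates to
    \<open>Zc * Z\<close>, and \<open>\<tau> / 2 = 1 / p\<close> makes this the mixed norm of
    \<open>R\<close>.\<close>
  have "ennreal (Z powr (\<tau> / 2)) = (\<integral>\<^sup>+ t. \<integral>\<^sup>+ x. ennreal (V (t, x) * R (t, x)) \<partial>?T \<partial>tm)"
  proof -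
    have "(\<integral>\<^sup>+ x. ennreal (V (t, x) * R (t, x)) \<partial>?T) = ennreal Zc * ennreal (r t powr p)" for t
    proof -
      have "V (t, x) * R (t, x) = r t powr (p - q) * Zc * R (t, x) powr q" for x
        using Rpos[of "(t, x)"] by (simp add: V_def powr_diff)
      then have "(\<integral>\<^sup>+ x. ennreal (V (t, x) * R (t, x)) \<partial>?T) = (\<integral>\<^sup>+ x. ennreal (r t powr (p - q) * Zc) * ennreal (R (t, x) powr q) \<partial>?T)"
        using Zc by (simp add: ennreal_mult[symmetric])
      also have "\<dots> = ennreal (r t powr (p - q) * Zc) * (\<integral>\<^sup>+ x. ennreal (R (t, x) powr q) \<partial>?T)"
        by (rule nn_integral_cmult) measurable
      also have "(\<integral>\<^sup>+ x. ennreal (R (t, x) powr q) \<partial>?T) = ennreal (S t)"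
        unfolding S_def by (intro nn_integral_eq_integral bounded_borel_integrable[OF finite_torus_measure] bounded_borel_section[OF Rqb]) simp
      also have "ennreal (r t powr (p - q) * Zc) * ennreal (S t) = ennreal (Zc * (r t powr (p - q) * r t powr q))"
        using Zc Spos[of t] by (simp add: ennreal_mult[symmetric] rq mult_ac)
      also have "r t powr (p - q) * r t powr q = r t powr p" by (simp add: powr_add[symmetric])
      finally show ?thesis using Zc by (simp add: ennreal_mult)
    qed
    then have "(\<integral>\<^sup>+ t. \<integral>\<^sup>+ x. ennreal (V (t, x) * R (t, x)) \<partial>?T \<partial>tm) = ennreal Zc * ennreal Z"
      by (simp add: nn_integral_cmult Znn)
    also have "\<dots> = ennreal (Z powr (\<tau> / 2 - 1) * Z powr 1)" using Zpos by (simp add: Zc_def ennreal_mult)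
    also have "Z powr (\<tau> / 2 - 1) * Z powr 1 = Z powr (\<tau> / 2)" unfolding powr_add[symmetric] by simp
    finally show ?thesis by simp
  qed
  also have "\<dots> = (\<integral>\<^sup>+ t. (\<integral>\<^sup>+ x. ennreal (V (t, x) * \<rho> (t, x)) \<partial>?T) + ennreal \<eta> * (\<integral>\<^sup>+ x. ennreal (V (t, x)) \<partial>?T) \<partial>tm)"
  proof (rule nn_integral_cong)
    fix t
    have "(\<integral>\<^sup>+ x. ennreal (V (t, x) * R (t, x)) \<partial>?T) = (\<integral>\<^sup>+ x. ennreal (V (t, x) * \<rho> (t, x)) + ennreal \<eta> * ennreal (V (t, x)) \<partial>?T)"
    proof (rule nn_integral_cong)
      fix x
      have "0 \<le> V (t, x)" "0 \<le> \<rho> (t, x)" using V_pos \<rho> by (auto simp: less_imp_le)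
      then show "ennreal (V (t, x) * R (t, x)) = ennreal (V (t, x) * \<rho> (t, x)) + ennreal \<eta> * ennreal (V (t, x))"
        using eta by (simp add: R_def ennreal_mult[symmetric] ennreal_plus[symmetric] distrib_left mult.commute del: ennreal_plus)
    qed
    also have "\<dots> = (\<integral>\<^sup>+ x. ennreal (V (t, x) * \<rho> (t, x)) \<partial>?T) + ennreal \<eta> * (\<integral>\<^sup>+ x. ennreal (V (t, x)) \<partial>?T)"
      by (subst nn_integral_add) (auto simp: nn_integral_cmult)
    finally show "(\<integral>\<^sup>+ x. ennreal (V (t, x) * R (t, x)) \<partial>?T) = \<dots>" .
  qed
  also have "\<dots> = (\<integral>\<^sup>+ t. \<integral>\<^sup>+ x. ennreal (V (t, x) * \<rho> (t, x)) \<partial>?T \<partial>tm) + ennreal \<eta> * (\<integral>\<^sup>+ t. \<integral>\<^sup>+ x. ennreal (V (t, x)) \<partial>?T \<partial>tm)"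
  proof -
    have m: "(\<lambda>t. \<integral>\<^sup>+ x. f (t, x) \<partial>?T) \<in> borel_measurable tm" if "f \<in> borel_measurable (borel \<Otimes>\<^sub>M borel)" for f :: "real \<times> real \<Rightarrow> ennreal"
    proof -
      have "(\<lambda>t. \<integral>\<^sup>+ x. f (t, x) \<partial>?T) \<in> borel_measurable borel"
        using that by (intro sigma_finite_measure.borel_measurable_nn_integral[OF sigma_finite(2)]) (simp add: case_prod_unfold)
      then show ?thesis by measurable
    qed
    have [measurable]: "(\<lambda>t. \<integral>\<^sup>+ x. ennreal (V (t, x) * \<rho> (t, x)) \<partial>?T) \<in> borel_measurable tm"
      by (rule m[of "\<lambda>z. ennreal (V z * \<rho> z)"]) measurable
    have [measurable]: "(\<lambda>t. \<integral>\<^sup>+ x. ennreal (V (t, x)) \<partial>?T) \<in> borel_measurable tm"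
      by (rule m[of "\<lambda>z. ennreal (V z)"]) measurable
    show ?thesis by (subst nn_integral_add) (auto simp: nn_integral_cmult)
  qed
  also have "\<dots> \<le> ennreal (interp_const \<tau> * \<Lambda>) + ennreal \<eta> * ennreal (2 * (2 * pi + 1))"
    unfolding \<rho>_def by (intro add_mono mult_left_mono weighted_density[OF a lam Lam bnd] total_weight) auto
  also have "\<dots> = ennreal (interp_const \<tau> * \<Lambda> + \<eta> * (2 * (2 * pi + 1)))"
  proof -
    have "0 \<le> interp_const \<tau> * \<Lambda>" unfolding interp_const_def using tau Lam by (intro mult_nonneg_nonneg add_nonneg_nonneg) auto
    then show ?thesis using eta by (simp add: ennreal_mult[symmetric] ennreal_plus[symmetric] del: ennreal_plus)
  qed
  finally have Zle: "Z powr (\<tau> / 2) \<le> interp_const \<tau> * \<Lambda> + \<eta> * (2 * (2 * pi + 1))" (is "_ \<le> ?B")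
  proof -
    assume "ennreal (Z powr (\<tau> / 2)) \<le> ennreal ?B"
    moreover have "0 \<le> ?B" unfolding interp_const_def using tau Lam eta by (intro mult_nonneg_nonneg add_nonneg_nonneg) auto
    ultimately show ?thesis by simp
  qed
  have "Z = (Z powr (\<tau> / 2)) powr p" using tau Zpos by (simp add: powr_powr p_eq)
  also have "\<dots> \<le> ?B powr p" using Zle p by (intro powr_mono2) auto
  finally have ZB: "Z \<le> ?B powr p" .
  have "(\<integral>\<^sup>+ t. ennreal ((\<integral>x. \<rho> (t, x) powr q \<partial>?T) powr (p / q)) \<partial>tm) \<le> (\<integral>\<^sup>+ t. ennreal (r t powr p) \<partial>tm)"
  proof (intro nn_integral_mono ennreal_leI)
    fix t
    have b\<rho>: "bounded_borel (borel \<Otimes>\<^sub>M borel) (\<lambda>z. \<rho> z powr q)"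
    proof (rule bounded_borelI[of _ _ "(\<Lambda> * (2 * real N + 1)) powr q"])
      show "norm (\<rho> z powr q) \<le> (\<Lambda> * (2 * real N + 1)) powr q" for z using \<rho>[of z] q by (auto intro!: powr_mono2)
    qed measurable
    have "(\<integral>x. \<rho> (t, x) powr q \<partial>?T) \<le> S t" unfolding S_def
      using \<rho> eta q by (intro integral_mono bounded_borel_integrable[OF finite_torus_measure] bounded_borel_section b\<rho> Rqb powr_mono2) (auto simp: R_def)
    then have "(\<integral>x. \<rho> (t, x) powr q \<partial>?T) powr (p / q) \<le> S t powr (p / q)"
      using p q by (intro powr_mono2) auto
    also have "\<dots> = r t powr p" by (simp add: r_def powr_powr)
    finally show "(\<integral>x. \<rho> (t, x) powr q \<partial>?T) powr (p / q) \<le> r t powr p" .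
  qed
  also have "\<dots> \<le> ennreal (?B powr p)" unfolding Znn by (rule ennreal_leI[OF ZB])
  finally show ?thesis by (simp add: \<rho>_def)
qed

text \<open>The shift is removed along \<open>\<eta> = 1 / Suc n\<close>; the left side does not
  contain it.\<close>

theorem slab_density_bound:
  assumes q: "1 < q" and tau_eq: "\<tau> = 1 - 1 / q" and p_eq: "p = 2 / \<tau>"
    and a: "contractive_family N a" and lam: "\<And>j. 0 \<le> lam j" "\<And>j. lam j \<le> \<Lambda>" and Lam: "0 < \<Lambda>"
    and bnd: "\<And>n. (\<Sum>j<n. lam j powr (2 / (2 - \<tau>))) \<le> \<Lambda> powr (2 / (2 - \<tau>))"
  shows "(\<integral>\<^sup>+ t. ennreal ((\<integral>x. wave_density N lam a (t, x) powr q \<partial>torus_measure) powr (p / q)) \<partial>tm)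
      \<le> ennreal ((interp_const \<tau> * \<Lambda>) powr p)"
proof -
  have tau: "0 < \<tau>" "\<tau> < 1" using q by (auto simp: tau_eq)
  have C: "0 < interp_const \<tau> * \<Lambda>" unfolding interp_const_def using tau Lam by (intro mult_pos_pos add_pos_nonneg) auto
  have "(\<lambda>n. (interp_const \<tau> * \<Lambda> + 1 / real (Suc n) * (2 * (2 * pi + 1))) powr p) \<longlonglongrightarrow> (interp_const \<tau> * \<Lambda> + 0 * (2 * (2 * pi + 1))) powr p"
    using C by (intro tendsto_intros lim_1_over_n[THEN LIMSEQ_Suc]) auto
  then have "(\<lambda>n. ennreal ((interp_const \<tau> * \<Lambda> + 1 / real (Suc n) * (2 * (2 * pi + 1))) powr p)) \<longlonglongrightarrow> ennreal ((interp_const \<tau> * \<Lambda> + 0 * (2 * (2 * pi + 1))) powr p)"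
    by (rule tendsto_ennrealI)
  then have "(\<integral>\<^sup>+ t. ennreal ((\<integral>x. wave_density N lam a (t, x) powr q \<partial>torus_measure) powr (p / q)) \<partial>tm)
      \<le> ennreal ((interp_const \<tau> * \<Lambda> + 0 * (2 * (2 * pi + 1))) powr p)"
    by (rule LIMSEQ_le_const, intro exI allI impI, intro slab_density_bound_aux[OF q tau_eq p_eq a lam Lam bnd]) simp
  then show ?thesis by simp
qed

end

section \<open>Orthonormal systems and the final estimate\<close>

lemma torus_Parseval:
  assumes S: "finite S"
  shows "(\<integral>x. (norm (\<Sum>n\<in>S. b n * cis (x * of_int n)))\<^sup>2 \<partial>torus_measure) = 2 * pi * (\<Sum>n\<in>S. (norm (b n))\<^sup>2)"
proof -
  have i: "integrable torus_measure (\<lambda>x. cis (x * of_int k))" for k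
    by (intro bounded_borel_integrable[OF finite_torus_measure] bounded_borel_cis) measurable
  have "complex_of_real (\<integral>x. (norm (\<Sum>n\<in>S. b n * cis (x * of_int n)))\<^sup>2 \<partial>torus_measure)
      = (\<integral>x. complex_of_real ((norm (\<Sum>n\<in>S. b n * cis (x * of_int n)))\<^sup>2) \<partial>torus_measure)"
    by (rule integral_complex_of_real[symmetric])
  also have "\<dots> = (\<integral>x. (\<Sum>n\<in>S. \<Sum>m\<in>S. (b n * cnj (b m)) * cis (x * of_int (n - m))) \<partial>torus_measure)"
  proof (rule Bochner_Integration.integral_cong[OF refl])
    fix x :: real
    have "b n * cis (x * of_int n) * cnj (b m * cis (x * of_int m)) = (b n * cnj (b m)) * cis (x * of_int (n - m))" for n m
    proof -
      have "cis (x * of_int (n - m)) = cis (x * of_int n) * cis (- (x * of_int m))" by (simp add: cis_mult algebra_simps)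
      then show ?thesis by (simp add: cis_cnj)
    qed
    then show "complex_of_real ((norm (\<Sum>n\<in>S. b n * cis (x * of_int n)))\<^sup>2) = (\<Sum>n\<in>S. \<Sum>m\<in>S. (b n * cnj (b m)) * cis (x * of_int (n - m)))"
      unfolding complex_norm_square cnj_sum sum_product by (simp only:)
  qed
  also have "\<dots> = (\<Sum>n\<in>S. \<Sum>m\<in>S. (b n * cnj (b m)) * (if n - m = 0 then 2 * pi else 0))"
    using i by (simp add: integral_torus_cis del: of_int_diff)
  also have "\<dots> = (\<Sum>n\<in>S. of_real (2 * pi * (norm (b n))\<^sup>2))"
  proof (rule sum.cong[OF refl])
    fix n assume "n \<in> S"
    have "(\<Sum>m\<in>S. (b n * cnj (b m)) * complex_of_real (if n - m = 0 then 2 * pi else 0)) = (\<Sum>m\<in>S. if m = n then (b n * cnj (b n)) * of_real (2 * pi) else 0)"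
      by (intro sum.cong) auto
    also have "\<dots> = (b n * cnj (b n)) * of_real (2 * pi)" using S \<open>n \<in> S\<close> by (simp add: sum.delta)
    finally show "(\<Sum>m\<in>S. (b n * cnj (b m)) * complex_of_real (if n - m = 0 then 2 * pi else 0)) = of_real (2 * pi * (norm (b n))\<^sup>2)"
      unfolding of_real_mult complex_norm_square by (simp add: mult_ac)
  qed
  also have "\<dots> = of_real (2 * pi * (\<Sum>n\<in>S. (norm (b n))\<^sup>2))" by (simp add: sum_distrib_left)
  finally show ?thesis by (simp only: of_real_eq_iff)
qed

text \<open>The functions of an orthonormal system are only measurable on the torus, hence the extension by zero.\<close>

definition restricted :: "(real \<Rightarrow> complex) \<Rightarrow> real \<Rightarrow> complex" where
  "restricted f x = indicator torus x *\<^sub>R f x"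

lemma L2T_restricted:
  assumes "L2T f"
  shows "restricted f \<in> borel_measurable borel" "square_integrable torus_measure (restricted f)"
proof -
  show m[measurable]: "restricted f \<in> borel_measurable borel"
    using assms unfolding L2T_def set_borel_measurable_def restricted_def[abs_def] by simp
  have "integrable lborel (\<lambda>x. indicator torus x *\<^sub>R (cmod (f x))\<^sup>2)"
    using assms unfolding L2T_def set_integrable_def by simp
  moreover have "(\<lambda>x. indicator torus x *\<^sub>R (cmod (f x))\<^sup>2) = (\<lambda>x. indicator torus x *\<^sub>R (cmod (restricted f x))\<^sup>2)"
    by (auto simp: restricted_def indicator_def fun_eq_iff)
  ultimately have "integrable lborel (\<lambda>x. indicator torus x *\<^sub>R (cmod (restricted f x))\<^sup>2)" by simp
  moreover have "interval_measure_on torus = density lborel (\<lambda>x. ennreal (indicator torus x))"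
    by (simp add: interval_measure_on_def ennreal_indicator)
  ultimately have "integrable torus_measure (\<lambda>x. (cmod (restricted f x))\<^sup>2)" by (simp add: integrable_density)
  then show "square_integrable torus_measure (restricted f)" by (simp add: square_integrable_def)
qed

lemma fourier_coeff_restricted:
  assumes "L2T f"
  shows "fourier_coeff f n = of_real (1 / (2 * pi)) * (\<integral>x. restricted f x * cis (- (x * of_int n)) \<partial>torus_measure)"
proof -
  note [measurable] = L2T_restricted(1)[OF assms]
  have "(\<integral>x. restricted f x * cis (- (x * of_int n)) \<partial>torus_measure) = (\<integral>x. indicator torus x *\<^sub>R (restricted f x * cis (- (x * of_int n))) \<partial>lborel)"
    by (rule integral_interval_measure_on) measurable
  also have "\<dots> = (LINT x:torus|lborel. cis (- (x * of_int n)) * f x)"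
    unfolding set_lebesgue_integral_def by (intro Bochner_Integration.integral_cong refl) (auto simp: restricted_def indicator_def)
  finally show ?thesis by (simp add: fourier_coeff_def)
qed

lemma orthonormal_restricted:
  assumes "orthonormal_system f"
  shows "(\<integral>x. restricted (f j) x * cnj (restricted (f k) x) \<partial>torus_measure) = (if j = k then 1 else 0)"
proof -
  have L: "L2T (f j)" for j using assms by (simp add: orthonormal_system_def)
  note [measurable] = L2T_restricted(1)[OF L]
  have "(\<integral>x. restricted (f j) x * cnj (restricted (f k) x) \<partial>torus_measure) = (\<integral>x. indicator torus x *\<^sub>R (restricted (f j) x * cnj (restricted (f k) x)) \<partial>lborel)"
    by (rule integral_interval_measure_on) measurable
  also have "\<dots> = L2T_inner (f j) (f k)"
    unfolding set_lebesgue_integral_def L2T_inner_def by (intro Bochner_Integration.integral_cong refl) (auto simp: restricted_def indicator_def)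
  finally show ?thesis using assms by (simp add: orthonormal_system_def)
qed

lemma integrable_restricted_mult:
  assumes "L2T f" and h: "bounded_borel torus_measure h"
  shows "integrable torus_measure (\<lambda>x. restricted f x * h x)"
proof -
  have "square_integrable torus_measure (\<lambda>x. cnj (h x))"
    unfolding square_integrable_def power2_eq_square
    by (intro conjI bounded_borel_measurable[of torus_measure] bounded_borel_integrable[OF finite_torus_measure] bounded_borel_mult bounded_borel_norm bounded_borel_cnj h)
  from square_integrable_mult_cnj[OF L2T_restricted(2)[OF assms(1)] this] show ?thesis by simp
qed

text \<open>The factor \<open>sqrt (2 * pi)\<close> turns \<open>fourier_coeff\<close> into the
  coefficient with respect to the normalised exponentials. The first condition is Bessel's
  inequality for these, the second is Bessel's inequality for the \<open>f j\<close>.\<close>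

lemma contractive_fourier_coeffs:
  assumes f: "orthonormal_system f"
  shows "contractive_family N (\<lambda>j n. of_real (sqrt (2 * pi)) * fourier_coeff (f j) n)"
proof -
  let ?S = "{- int N..int N}"
  let ?T = torus_measure
  have L: "L2T (f j)" for j using f by (simp add: orthonormal_system_def)
  define c where "c = 1 / sqrt (2 * pi)"
  have c: "c > 0" "c\<^sup>2 * (2 * pi) = 1" by (auto simp: c_def power_divide)
  have c2: "sqrt (2 * pi) * (1 / (2 * pi)) = c"
    by (simp add: c_def real_div_sqrt field_simps)
  have coeff: "of_real (sqrt (2 * pi)) * fourier_coeff (f j) n = of_real c * (\<integral>x. restricted (f j) x * cis (- (x * of_int n)) \<partial>?T)" for j n
    unfolding fourier_coeff_restricted[OF L] c2[symmetric] of_real_mult by (simp only: mult.assoc)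
  have n1: "(\<integral>x. (norm (restricted (f j) x))\<^sup>2 \<partial>?T) = 1" for j
  proof -
    have "complex_of_real (\<integral>x. (norm (restricted (f j) x))\<^sup>2 \<partial>?T) = of_real 1"
      unfolding integral_complex_of_real[symmetric] complex_norm_square using orthonormal_restricted[OF f, of j j] by simp
    then show ?thesis by (simp only: of_real_eq_iff)
  qed
  show ?thesis
    unfolding contractive_family_def
  proof (intro conjI allI impI)
    fix j
    have sq: "square_integrable ?T (\<lambda>x. cnj (restricted (f j) x))"
      using L2T_restricted(2)[OF L, of j] by (auto simp: square_integrable_def)
    have "norm (of_real (sqrt (2 * pi)) * fourier_coeff (f j) n) = c * norm (\<integral>x. cnj (restricted (f j) x) * cis (x * of_int n) \<partial>?T)" for n
    proof -
      have "(\<integral>x. restricted (f j) x * cis (- (x * of_int n)) \<partial>?T) = (\<integral>x. cnj (cnj (restricted (f j) x) * cis (x * of_int n)) \<partial>?T)"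
        by (simp add: cis_cnj)
      then show ?thesis unfolding coeff Bochner_Integration.integral_cnj using c by (simp add: norm_mult)
    qed
    then have "(\<Sum>n\<in>?S. (norm (of_real (sqrt (2 * pi)) * fourier_coeff (f j) n))\<^sup>2) = c\<^sup>2 * (\<Sum>n\<in>?S. (norm (\<integral>x. cnj (restricted (f j) x) * cis (x * of_int n) \<partial>?T))\<^sup>2)"
      by (simp add: power_mult_distrib sum_distrib_left)
    also have "\<dots> \<le> c\<^sup>2 * (2 * pi * (\<integral>x. (norm (cnj (restricted (f j) x)))\<^sup>2 \<partial>?T))"
      by (intro mult_left_mono torus_Bessel sq) auto
    also have "\<dots> = 1" using c n1[of j] by simp
    finally show "(\<Sum>n\<in>?S. (norm (of_real (sqrt (2 * pi)) * fourier_coeff (f j) n))\<^sup>2) \<le> 1" .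
  next
    fix b :: "int \<Rightarrow> complex" and A :: "nat set" assume A: "finite A"
    \<comment> \<open>The trigonometric polynomial whose inner products with the \<open>f j\<close>
      are the conjugates of the sums in question; \<open>torus_Parseval\<close> gives its
      norm.\<close>
    define h where "h x = of_real c * (\<Sum>n\<in>?S. cnj (b n) * cis (x * of_int n))" for x :: real
    have hb: "bounded_borel ?T h"
      unfolding h_def by (intro bounded_borel_mult bounded_borel_const bounded_borel_sum bounded_borel_cis) measurable
    have hs: "square_integrable ?T h" unfolding square_integrable_def power2_eq_square
      by (intro conjI bounded_borel_measurable[of ?T] bounded_borel_integrable[OF finite_torus_measure] bounded_borel_mult bounded_borel_norm hb)
    have "norm (\<Sum>n\<in>?S. of_real (sqrt (2 * pi)) * fourier_coeff (f j) n * b n) = norm (\<integral>x. h x * cnj (restricted (f j) x) \<partial>?T)" for j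
    proof -
      have i: "integrable ?T (\<lambda>x. restricted (f j) x * cis (- (x * of_int n)))" for n
        by (intro integrable_restricted_mult L bounded_borel_cis) measurable
      have "(\<Sum>n\<in>?S. of_real (sqrt (2 * pi)) * fourier_coeff (f j) n * b n)
         = (\<integral>x. (\<Sum>n\<in>?S. of_real c * b n * (restricted (f j) x * cis (- (x * of_int n)))) \<partial>?T)"
        unfolding coeff using i by (simp add: mult_ac)
      also have "\<dots> = (\<integral>x. cnj (h x * cnj (restricted (f j) x)) \<partial>?T)"
        by (intro Bochner_Integration.integral_cong refl) (simp add: h_def cis_cnj sum_distrib_left sum_distrib_right mult_ac)
      finally show ?thesis unfolding Bochner_Integration.integral_cnj by simp
    qed
    then have "(\<Sum>j\<in>A. (norm (\<Sum>n\<in>?S. of_real (sqrt (2 * pi)) * fourier_coeff (f j) n * b n))\<^sup>2) = (\<Sum>j\<in>A. (norm (\<integral>x. h x * cnj (restricted (f j) x) \<partial>?T))\<^sup>2)" by simp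
    also have "\<dots> \<le> (\<integral>x. (norm (h x))\<^sup>2 \<partial>?T)"
      by (rule Bessel_inequality[OF A L2T_restricted(2)[OF L] hs orthonormal_restricted[OF f]])
    also have "\<dots> = (\<integral>x. c\<^sup>2 * (norm (\<Sum>n\<in>?S. cnj (b n) * cis (x * of_int n)))\<^sup>2 \<partial>?T)"
      by (simp add: h_def norm_mult power_mult_distrib)
    also have "\<dots> = c\<^sup>2 * (2 * pi * (\<Sum>n\<in>?S. (norm (b n))\<^sup>2))"
      using torus_Parseval[of ?S "\<lambda>n. cnj (b n)"] by simp
    also have "\<dots> = (\<Sum>n\<in>?S. (norm (b n))\<^sup>2)" using c by (simp add: mult.assoc[symmetric])
    finally show "(\<Sum>j\<in>A. (norm (\<Sum>n\<in>?S. of_real (sqrt (2 * pi)) * fourier_coeff (f j) n * b n))\<^sup>2) \<le> (\<Sum>n\<in>?S. (norm (b n))\<^sup>2)" .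
  qed
qed

lemma DN_wave_packet:
  "DN N f t x = of_real (1 / (2 * pi) * (1 / sqrt (2 * pi))) * wave_packet N (\<lambda>n. of_real (sqrt (2 * pi)) * fourier_coeff f n) (t, x)"
proof -
  have "complex_of_real (1 / sqrt (2 * pi)) * (complex_of_real (sqrt (2 * pi)) * w) = w" for w
    by (simp flip: mult.assoc of_real_mult)
  then have "of_real (1 / sqrt (2 * pi)) * wave_packet N (\<lambda>n. of_real (sqrt (2 * pi)) * fourier_coeff f n) (t, x)
     = (\<Sum>n\<in>{- int N..int N}. fourier_coeff f n * wave n (t, x))"
    unfolding wave_packet_def sum_distrib_left by (simp add: mult.assoc)
  then show ?thesis unfolding of_real_mult mult.assoc by (simp add: DN_def wave_def dispersion_def)
qed

text \<open>The prefactor of \<open>DN_wave_packet\<close> is at most 1 and is dropped; this affects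
  only the constant.\<close>

lemma norm_DN_le: "(norm (DN N f t x))\<^sup>2 \<le> (norm (wave_packet N (\<lambda>n. of_real (sqrt (2 * pi)) * fourier_coeff f n) (t, x)))\<^sup>2"
proof (rule power_mono)
  have "1 \<le> 2 * pi" using pi_ge_two by linarith
  then have "1 / (2 * pi) \<le> 1" "1 / sqrt (2 * pi) \<le> 1" by auto
  then have "1 / (2 * pi) * (1 / sqrt (2 * pi)) \<le> 1 * 1" by (intro mult_mono) auto
  then show "norm (DN N f t x) \<le> norm (wave_packet N (\<lambda>n. of_real (sqrt (2 * pi)) * fourier_coeff f n) (t, x))"
    unfolding DN_wave_packet norm_mult norm_of_real by (intro mult_left_le_one_le) auto
qed simp

lemma DN_density_le:
  assumes f: "orthonormal_system f" and L: "\<And>j. norm (lam j) \<le> L"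
  shows "norm (DN_density N lam f t x) \<le> wave_density N (\<lambda>j. norm (lam j)) (\<lambda>j n. of_real (sqrt (2 * pi)) * fourier_coeff (f j) n) (t, x)"
proof -
  define a where "a = (\<lambda>j n. complex_of_real (sqrt (2 * pi)) * fourier_coeff (f j) n)"
  have ac: "contractive_family N a" unfolding a_def by (rule contractive_fourier_coeffs[OF f])
  have le: "norm (lam j * complex_of_real ((norm (DN N (f j) t x))\<^sup>2)) \<le> norm (lam j) * (norm (wave_packet N (a j) (t, x)))\<^sup>2" for j
    unfolding norm_mult norm_of_real abs_of_nonneg[OF zero_le_power2] a_def by (intro mult_left_mono norm_DN_le) simp
  have s: "summable (\<lambda>j. norm (lam j) * (norm (wave_packet N (a j) (t, x)))\<^sup>2)"
    by (rule wave_density_summable[OF ac]) (use L in auto)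
  have s2: "summable (\<lambda>j. norm (lam j * complex_of_real ((norm (DN N (f j) t x))\<^sup>2)))"
    by (rule summable_comparison_test'[OF s, of 0]) (use le in auto)
  have "norm (DN_density N lam f t x) \<le> (\<Sum>j. norm (lam j * complex_of_real ((norm (DN N (f j) t x))\<^sup>2)))"
    unfolding DN_density_def by (rule summable_norm[OF s2])
  also have "\<dots> \<le> (\<Sum>j. norm (lam j) * (norm (wave_packet N (a j) (t, x)))\<^sup>2)"
    by (rule suminf_le[OF le s2 s])
  finally show ?thesis by (simp add: wave_density_def a_def)
qed

section \<open>From densities to mixed norms on the whole torus\<close>

lemma enn_powr_mono: "a \<le> b \<Longrightarrow> 0 \<le> r \<Longrightarrow> enn_powr a r \<le> enn_powr b r"
  unfolding enn_powr_def
  by (auto simp: less_top top_unique intro!: ennreal_leI powr_mono2 enn2real_mono)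

lemma enn_powr_ennreal: "0 \<le> x \<Longrightarrow> enn_powr (ennreal x) r = ennreal (x powr r)"
  by (simp add: enn_powr_def)

text \<open>Monotonicity of sequence norms in the exponent: each entry is at most the norm
  \<open>L\<close>, so the surplus power \<open>\<beta>' - \<beta>\<close> is bounded by that of
  \<open>L\<close>. This reduces every admissible \<open>\<beta>\<close> to the largest one.\<close>

lemma lbeta_bounds:
  assumes lam: "in_lbeta \<beta> lam" and b: "0 < \<beta>" "\<beta> \<le> \<beta>'"
  shows "norm (lam j) \<le> lbeta_norm \<beta> lam"
    and "(\<Sum>j<n. norm (lam j) powr \<beta>') \<le> lbeta_norm \<beta> lam powr \<beta>'"
proof -
  define s where "s = (\<Sum>j. norm (lam j) powr \<beta>)"
  have sm: "summable (\<lambda>j. norm (lam j) powr \<beta>)" using lam by (simp add: in_lbeta_def)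
  have part: "(\<Sum>j<n. norm (lam j) powr \<beta>) \<le> s" for n
    unfolding s_def by (rule sum_le_suminf[OF sm]) auto
  have s0: "0 \<le> s" unfolding s_def by (rule suminf_nonneg[OF sm]) simp
  define L where "L = lbeta_norm \<beta> lam"
  have L: "L = s powr (1 / \<beta>)" "0 \<le> L" by (auto simp: L_def lbeta_norm_def s_def)
  have Lb: "L powr \<beta> = s" using s0 b by (simp add: L powr_powr)
  have le: "norm (lam j) \<le> L" for j
  proof -
    have "norm (lam j) powr \<beta> \<le> (\<Sum>i<Suc j. norm (lam i) powr \<beta>)" by (simp add: sum_nonneg)
    also have "\<dots> \<le> s" by (rule part)
    finally have "(norm (lam j) powr \<beta>) powr (1 / \<beta>) \<le> s powr (1 / \<beta>)" using b by (intro powr_mono2) auto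
    then show ?thesis using b by (simp add: powr_powr L)
  qed
  then show "norm (lam j) \<le> lbeta_norm \<beta> lam" by (simp add: L_def)
  have "(\<Sum>j<n. norm (lam j) powr \<beta>') \<le> (\<Sum>j<n. norm (lam j) powr \<beta> * L powr (\<beta>' - \<beta>))"
  proof (rule sum_mono)
    fix j
    have "norm (lam j) powr \<beta>' = norm (lam j) powr \<beta> * norm (lam j) powr (\<beta>' - \<beta>)" by (simp add: powr_add[symmetric])
    also have "\<dots> \<le> norm (lam j) powr \<beta> * L powr (\<beta>' - \<beta>)" using le b by (intro mult_left_mono powr_mono2) auto
    finally show "norm (lam j) powr \<beta>' \<le> norm (lam j) powr \<beta> * L powr (\<beta>' - \<beta>)" .
  qed
  also have "\<dots> = (\<Sum>j<n. norm (lam j) powr \<beta>) * L powr (\<beta>' - \<beta>)" by (simp add: sum_distrib_right)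
  also have "\<dots> \<le> s * L powr (\<beta>' - \<beta>)" using part by (intro mult_right_mono) auto
  also have "\<dots> = L powr \<beta>'" unfolding Lb[symmetric] by (simp add: powr_add[symmetric])
  finally show "(\<Sum>j<n. norm (lam j) powr \<beta>') \<le> lbeta_norm \<beta> lam powr \<beta>'" by (simp add: L_def)
qed

lemma Lq_x_le:
  assumes q: "0 < q" and le: "\<And>x. norm (F t x) \<le> \<rho> (t, x)" and \<rho>: "bounded_borel (borel \<Otimes>\<^sub>M borel) \<rho>"
  shows "Lq_x q F t \<le> ennreal ((\<integral>x. \<rho> (t, x) powr q \<partial>torus_measure) powr (1 / q))"
proof -
  note [measurable] = bounded_borel_measurable[OF \<rho>]
  obtain C where C: "\<And>z. norm (\<rho> z) \<le> C" using \<rho> by (auto simp: bounded_borel_def)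
  have i: "integrable torus_measure (\<lambda>x. \<rho> (t, x) powr q)"
  proof (rule bounded_borel_integrable[OF finite_torus_measure], rule bounded_borelI[of _ _ "C powr q"])
    fix x
    have "0 \<le> \<rho> (t, x)" using le[of x] norm_ge_zero order_trans by blast
    then show "norm (\<rho> (t, x) powr q) \<le> C powr q" using C[of "(t, x)"] q by (auto intro!: powr_mono2)
  qed measurable
  have "(\<integral>\<^sup>+ x\<in>torus. ennreal (norm (F t x) powr q) \<partial>lborel) \<le> (\<integral>\<^sup>+ x\<in>torus. ennreal (\<rho> (t, x) powr q) \<partial>lborel)"
    using le q by (intro nn_integral_mono mult_right_mono ennreal_leI powr_mono2) auto
  also have "\<dots> = (\<integral>\<^sup>+ x. ennreal (\<rho> (t, x) powr q) \<partial>torus_measure)"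
    by (subst nn_integral_interval_measure_on) auto
  also have "\<dots> = ennreal (\<integral>x. \<rho> (t, x) powr q \<partial>torus_measure)"
    by (rule nn_integral_eq_integral[OF i]) simp
  finally have "Lq_x q F t \<le> enn_powr (ennreal (\<integral>x. \<rho> (t, x) powr q \<partial>torus_measure)) (1 / q)"
    unfolding Lq_x_def using q by (intro enn_powr_mono) auto
  then show ?thesis by (simp add: enn_powr_ennreal)
qed

text \<open>The 7 is an integer above \<open>2 * pi\<close>; the last slabs may lie beyond the
  torus.\<close>

lemma torus_cover: "1 \<le> N \<Longrightarrow> torus \<subseteq> (\<Union>k<7 * N. {real k / real N..<real k / real N + 1 / real N})"
proof
  fix t assume N: "1 \<le> N" and t: "t \<in> torus"
  define k where "k = nat \<lfloor>t * real N\<rfloor>"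
  have t0: "0 \<le> t" "t < 2 * pi" using t by (auto simp: torus_def)
  have k: "real k \<le> t * real N" "t * real N < real k + 1"
    using t0 by (auto simp: k_def)
  have "2 * pi < 7" using pi_less_4 pi_approx by (simp)
  then have "t * real N < 7 * real N" using t0 N by (intro mult_strict_right_mono) auto
  then have "real k < real (7 * N)" using k by simp
  then have "k < 7 * N" by (simp only: of_nat_less_iff)
  moreover have "real k / real N \<le> t" "t < real k / real N + 1 / real N"
    using k N by (simp_all add: divide_le_eq less_divide_eq flip: add_divide_distrib)
  ultimately show "t \<in> (\<Union>k<7 * N. {real k / real N..<real k / real N + 1 / real N})" by auto
qed

lemma torus_density_bound:
  assumes N: "1 \<le> N" and q: "1 < q" and tau_eq: "\<tau> = 1 - 1 / q" and p_eq: "p = 2 / \<tau>"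
    and a: "contractive_family N a" and lam: "\<And>j. 0 \<le> lam j" "\<And>j. lam j \<le> \<Lambda>" and Lam: "0 < \<Lambda>"
    and bnd: "\<And>n. (\<Sum>j<n. lam j powr (2 / (2 - \<tau>))) \<le> \<Lambda> powr (2 / (2 - \<tau>))"
  shows "(\<integral>\<^sup>+ t\<in>torus. ennreal ((\<integral>x. wave_density N lam a (t, x) powr q \<partial>torus_measure) powr (p / q)) \<partial>lborel)
      \<le> ennreal (7 * real N * (interp_const \<tau> * \<Lambda>) powr p)"
proof -
  define I where "I k = {real k / real N..<real k / real N + 1 / real N}" for k :: nat
  define g where "g t = ennreal ((\<integral>x. wave_density N lam a (t, x) powr q \<partial>torus_measure) powr (p / q))" for t
  have gm[measurable]: "g \<in> borel_measurable borel"
  proof -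
    have "(\<lambda>t. \<integral>x. wave_density N lam a (t, x) powr q \<partial>torus_measure) \<in> borel_measurable borel"
      by (rule sigma_finite_measure.borel_measurable_lebesgue_integral[OF finite_measure.axioms(1)[OF finite_torus_measure]]) (simp add: case_prod_unfold)
    then show ?thesis unfolding g_def by measurable
  qed
  have Im[measurable]: "I k \<in> sets borel" for k by (simp add: I_def)
  have piece: "(\<integral>\<^sup>+ t. g t * indicator (I k) t \<partial>lborel) \<le> ennreal ((interp_const \<tau> * \<Lambda>) powr p)" for k
  proof -
    interpret time_slab N "real k / real N" by unfold_locales (rule N)
    have "tm = interval_measure_on (I k)" by (simp add: tm_def slab_def I_def)
    then have "(\<integral>\<^sup>+ t. g t * indicator (I k) t \<partial>lborel) = (\<integral>\<^sup>+ t. g t \<partial>tm)" by (simp add: nn_integral_interval_measure_on)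
    then show ?thesis using slab_density_bound[OF q tau_eq p_eq a lam Lam bnd] by (simp add: g_def)
  qed
  have "(\<integral>\<^sup>+ t\<in>torus. g t \<partial>lborel) \<le> (\<integral>\<^sup>+ t. (\<Sum>k<7 * N. g t * indicator (I k) t) \<partial>lborel)"
  proof (rule nn_integral_mono)
    fix t
    show "g t * indicator torus t \<le> (\<Sum>k<7 * N. g t * indicator (I k) t)"
    proof (cases "t \<in> torus")
      case True
      then obtain k where k: "k < 7 * N" "t \<in> I k" using torus_cover[OF N] unfolding I_def by blast
      have "g t * indicator torus t = g t * indicator (I k) t" using True k by simp
      also have "\<dots> \<le> (\<Sum>k<7 * N. g t * indicator (I k) t)" using k by (intro member_le_sum) auto
      finally show ?thesis .
    qed simp
  qed
  also have "\<dots> = (\<Sum>k<7 * N. \<integral>\<^sup>+ t. g t * indicator (I k) t \<partial>lborel)" by (rule nn_integral_sum) measurable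
  also have "\<dots> \<le> (\<Sum>k<7 * N. ennreal ((interp_const \<tau> * \<Lambda>) powr p))" by (intro sum_mono piece)
  also have "\<dots> = ennreal (7 * real N * (interp_const \<tau> * \<Lambda>) powr p)"
    by (simp add: ennreal_of_nat_eq_real_of_nat ennreal_mult[symmetric] flip: ennreal_numeral)
  finally show ?thesis by (simp add: g_def)
qed

text \<open>Split off because the slab bounds divide by the norm of \<open>lam\<close>.\<close>

lemma DN_density_zero:
  assumes "lbeta_norm \<beta> lam = 0" "in_lbeta \<beta> lam" "0 < \<beta>"
  shows "DN_density N lam f = (\<lambda>t x. 0)"
proof -
  have "norm (lam j) \<le> 0" for j using lbeta_bounds(1)[OF assms(2,3) order_refl, of j] assms(1) by simp
  then show ?thesis by (auto simp: DN_density_def fun_eq_iff)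
qed

lemma Lq_x_zero: "0 < q \<Longrightarrow> Lq_x q (\<lambda>t x. 0) t = 0"
  by (simp add: Lq_x_def enn_powr_def)

lemma mixed_norm_zero:
  assumes "0 < q" "0 < p"
  shows "mixed_norm p q (\<lambda>t x. 0) = 0"
proof (cases "p = \<infinity>")
  case True
  have "esssup (restrict_space lborel torus) (\<lambda>t. 0 :: ennreal) \<le> 0" by (rule esssup_I) auto
  moreover have "Lq_x q (\<lambda>t x. 0) = (\<lambda>t. 0)" using Lq_x_zero[OF assms(1)] by auto
  ultimately show ?thesis using True by (simp add: mixed_norm_def)
next
  case False
  then show ?thesis using assms by (simp add: mixed_norm_def Lq_x_zero enn_powr_def)
qed

lemma mixed_norm_bound_finite:
  assumes N: "1 \<le> N" and q: "1 < q" and tau_eq: "\<tau> = 1 - 1 / q" and p_eq: "p = 2 / \<tau>"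
    and b: "0 < \<beta>" "\<beta> \<le> 2 / (2 - \<tau>)" and lam: "in_lbeta \<beta> lam" and f: "orthonormal_system f"
  shows "mixed_norm (ereal p) q (DN_density N lam f)
     \<le> ennreal (7 powr (1 / p) * interp_const \<tau> * real N powr (1 / p) * lbeta_norm \<beta> lam)"
proof -
  define \<Lambda> where "\<Lambda> = lbeta_norm \<beta> lam"
  have tau: "0 < \<tau>" "\<tau> < 1" using q by (auto simp: tau_eq)
  have p: "2 < p" using tau by (simp add: p_eq field_simps)
  show ?thesis
  proof (cases "\<Lambda> = 0")
    case True
    then show ?thesis using DN_density_zero[of \<beta> lam N f] lam b p q mixed_norm_zero[of q "ereal p"] by (simp add: \<Lambda>_def)
  next
    case False
    then have Lam: "0 < \<Lambda>" by (simp add: \<Lambda>_def lbeta_norm_def)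
    define a where "a = (\<lambda>j n. complex_of_real (sqrt (2 * pi)) * fourier_coeff (f j) n)"
    have ac: "contractive_family N a" unfolding a_def by (rule contractive_fourier_coeffs[OF f])
    have L: "norm (lam j) \<le> \<Lambda>" for j unfolding \<Lambda>_def by (rule lbeta_bounds(1)[OF lam b])
    define \<rho> where "\<rho> = wave_density N (\<lambda>j. norm (lam j)) a"
    have rb: "bounded_borel (borel \<Otimes>\<^sub>M borel) \<rho>"
    proof (rule bounded_borelI[of _ _ "\<Lambda> * (2 * real N + 1)"])
      show "norm (\<rho> z) \<le> \<Lambda> * (2 * real N + 1)" for z
        unfolding \<rho>_def using wave_density_bounds[OF ac, of "\<lambda>j. norm (lam j)" \<Lambda> z] L by simp
    qed (simp add: \<rho>_def)
    define A where "A t = (\<integral>x. \<rho> (t, x) powr q \<partial>torus_measure)" for t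
    have A0: "0 \<le> A t" for t unfolding A_def by simp
    have Lq: "Lq_x q (DN_density N lam f) t \<le> ennreal (A t powr (1 / q))" for t
      unfolding A_def by (rule Lq_x_le[OF _ _ rb]) (use q DN_density_le[OF f L] in \<open>auto simp: \<rho>_def a_def\<close>)
    have "enn_powr (Lq_x q (DN_density N lam f) t) p \<le> ennreal (A t powr (p / q))" for t
    proof -
      have "enn_powr (Lq_x q (DN_density N lam f) t) p \<le> enn_powr (ennreal (A t powr (1 / q))) p"
        using p by (intro enn_powr_mono Lq) auto
      also have "\<dots> = ennreal (A t powr (p / q))" by (simp add: enn_powr_ennreal powr_powr)
      finally show ?thesis .
    qed
    then have "(\<integral>\<^sup>+ t\<in>torus. enn_powr (Lq_x q (DN_density N lam f) t) p \<partial>lborel) \<le> (\<integral>\<^sup>+ t\<in>torus. ennreal (A t powr (p / q)) \<partial>lborel)"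
      by (intro nn_integral_mono mult_right_mono) auto
    also have "\<dots> \<le> ennreal (7 * real N * (interp_const \<tau> * \<Lambda>) powr p)"
      unfolding A_def \<rho>_def
      by (rule torus_density_bound[OF N q tau_eq p_eq ac _ _ Lam]) (use L lbeta_bounds(2)[OF lam b] in \<open>auto simp: \<Lambda>_def\<close>)
    finally have "mixed_norm (ereal p) q (DN_density N lam f) \<le> enn_powr (ennreal (7 * real N * (interp_const \<tau> * \<Lambda>) powr p)) (1 / p)"
      unfolding mixed_norm_def using p by (auto intro!: enn_powr_mono)
    also have "\<dots> = ennreal ((7 * real N * (interp_const \<tau> * \<Lambda>) powr p) powr (1 / p))"
      by (rule enn_powr_ennreal) simp
    also have "(7 * real N * (interp_const \<tau> * \<Lambda>) powr p) powr (1 / p) = 7 powr (1 / p) * interp_const \<tau> * real N powr (1 / p) * \<Lambda>"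
    proof -
      have "0 \<le> interp_const \<tau> * \<Lambda>" unfolding interp_const_def using tau Lam by (intro mult_nonneg_nonneg add_nonneg_nonneg) auto
      then have "((interp_const \<tau> * \<Lambda>) powr p) powr (1 / p) = interp_const \<tau> * \<Lambda>" using p by (simp add: powr_powr)
      then show ?thesis by (simp add: powr_mult)
    qed
    finally show ?thesis by (simp add: \<Lambda>_def)
  qed
qed

text \<open>Conservation of mass: the time phases are unimodular, so the value does not depend on
  \<open>t\<close>.\<close>

lemma integral_wave_packet: "(\<integral>x. (norm (wave_packet N b (t, x)))\<^sup>2 \<partial>torus_measure) = 2 * pi * (\<Sum>n\<in>{- int N..int N}. (norm (b n))\<^sup>2)"
proof -
  have "wave_packet N b (t, x) = (\<Sum>n\<in>{- int N..int N}. (b n * cis (t * dispersion n)) * cis (x * of_int n))" for x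
    unfolding wave_packet_def wave_def by (intro sum.cong refl) (simp add: cis_mult[symmetric] mult_ac)
  then show ?thesis using torus_Parseval[of "{- int N..int N}" "\<lambda>n. b n * cis (t * dispersion n)"] by (simp add: norm_mult)
qed

text \<open>Here \<open>\<tau>\<close> would be 0. At every single time each term has mass at most
  \<open>2 * pi * norm (lam j)\<close>, so no slabs and no power of \<open>N\<close> are
  needed.\<close>

lemma mixed_norm_bound_infinite:
  assumes b: "0 < \<beta>" "\<beta> \<le> 1" and lam: "in_lbeta \<beta> lam" and f: "orthonormal_system f"
  shows "mixed_norm \<infinity> 1 (DN_density N lam f) \<le> ennreal (2 * pi * lbeta_norm \<beta> lam)"
proof -
  define \<Lambda> where "\<Lambda> = lbeta_norm \<beta> lam"
  define a where "a = (\<lambda>j n. complex_of_real (sqrt (2 * pi)) * fourier_coeff (f j) n)"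
  have ac: "contractive_family N a" unfolding a_def by (rule contractive_fourier_coeffs[OF f])
  have L: "norm (lam j) \<le> \<Lambda>" for j unfolding \<Lambda>_def by (rule lbeta_bounds(1)[OF lam b])
  have L0: "0 \<le> \<Lambda>" using L[of 0] norm_ge_zero order_trans by blast
  define \<rho> where "\<rho> = wave_density N (\<lambda>j. norm (lam j)) a"
  have Lq: "Lq_x 1 (DN_density N lam f) t \<le> ennreal (2 * pi * \<Lambda>)" for t
  proof -
    have sm: "summable (\<lambda>j. norm (lam j) * (norm (wave_packet N (a j) (t, x)))\<^sup>2)" for x
      by (rule wave_density_summable[OF ac]) (use L in auto)
    have "(\<integral>\<^sup>+ x\<in>torus. ennreal (norm (DN_density N lam f t x) powr 1) \<partial>lborel) \<le> (\<integral>\<^sup>+ x\<in>torus. ennreal (\<rho> (t, x)) \<partial>lborel)"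
      using DN_density_le[OF f L] by (intro nn_integral_mono mult_right_mono ennreal_leI) (auto simp: \<rho>_def a_def)
    also have "\<dots> = (\<integral>\<^sup>+ x. ennreal (\<rho> (t, x)) \<partial>torus_measure)"
      unfolding \<rho>_def by (subst nn_integral_interval_measure_on) auto
    also have "\<dots> = (\<integral>\<^sup>+ x. (\<Sum>j. ennreal (norm (lam j) * (norm (wave_packet N (a j) (t, x)))\<^sup>2)) \<partial>torus_measure)"
      unfolding \<rho>_def wave_density_def using sm by (intro nn_integral_cong) (simp add: suminf_ennreal2)
    also have "\<dots> = (\<Sum>j. \<integral>\<^sup>+ x. ennreal (norm (lam j) * (norm (wave_packet N (a j) (t, x)))\<^sup>2) \<partial>torus_measure)"
      by (rule nn_integral_suminf) measurable
    also have "\<dots> \<le> ennreal (2 * pi * \<Lambda>)"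
    proof (rule suminf_le_const)
      fix n
      have j: "(\<integral>\<^sup>+ x. ennreal (norm (lam j) * (norm (wave_packet N (a j) (t, x)))\<^sup>2) \<partial>torus_measure) \<le> ennreal (2 * pi * norm (lam j))" for j
      proof -
        have bb: "bounded_borel torus_measure (\<lambda>x. norm (lam j) * (norm (wave_packet N (a j) (t, x)))\<^sup>2)"
          unfolding power2_eq_square
          by (intro bounded_borel_mult bounded_borel_const bounded_borel_norm bounded_borel_compose[OF bounded_wave_packet]) measurable
        have "(\<integral>\<^sup>+ x. ennreal (norm (lam j) * (norm (wave_packet N (a j) (t, x)))\<^sup>2) \<partial>torus_measure)
            = ennreal (norm (lam j) * (2 * pi * (\<Sum>n\<in>{- int N..int N}. (norm (a j n))\<^sup>2)))"
          by (subst nn_integral_eq_integral[OF bounded_borel_integrable[OF finite_torus_measure bb]]) (auto simp: integral_wave_packet)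
        also have "\<dots> \<le> ennreal (norm (lam j) * (2 * pi * 1))"
          using contractive_familyD(1)[OF ac, of j] by (intro ennreal_leI mult_left_mono) auto
        finally show ?thesis by (simp add: mult_ac)
      qed
      have "(\<Sum>j<n. \<integral>\<^sup>+ x. ennreal (norm (lam j) * (norm (wave_packet N (a j) (t, x)))\<^sup>2) \<partial>torus_measure) \<le> (\<Sum>j<n. ennreal (2 * pi * norm (lam j)))"
        by (intro sum_mono j)
      also have "\<dots> = ennreal (2 * pi * (\<Sum>j<n. norm (lam j)))" by (simp add: sum_distrib_left sum_ennreal)
      also have "\<dots> \<le> ennreal (2 * pi * \<Lambda>)"
        using lbeta_bounds(2)[OF lam b, of n] L0 by (intro ennreal_leI mult_left_mono) (auto simp: \<Lambda>_def)
      finally show "(\<Sum>j<n. \<integral>\<^sup>+ x. ennreal (norm (lam j) * (norm (wave_packet N (a j) (t, x)))\<^sup>2) \<partial>torus_measure) \<le> ennreal (2 * pi * \<Lambda>)" .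
    qed simp
    finally have "Lq_x 1 (DN_density N lam f) t \<le> enn_powr (ennreal (2 * pi * \<Lambda>)) (1 / 1)"
      unfolding Lq_x_def by (intro enn_powr_mono) auto
    then show ?thesis using L0 by (simp add: enn_powr_ennreal)
  qed
  \<comment> \<open>Needed because \<open>esssup\<close> of a non-measurable function is the top
    element.\<close>
  have m: "Lq_x 1 (DN_density N lam f) \<in> borel_measurable (restrict_space lborel torus)"
  proof (rule measurable_restrict_space1)
    have [measurable]: "(\<lambda>z. DN_density N lam f (fst z) (snd z)) \<in> borel_measurable (borel \<Otimes>\<^sub>M borel)"
      unfolding DN_density_def DN_wave_packet by measurable
    have "(\<lambda>t. \<integral>\<^sup>+ x\<in>torus. ennreal (norm (DN_density N lam f t x) powr 1) \<partial>lborel) \<in> borel_measurable borel"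
      by (rule lborel.borel_measurable_nn_integral) (simp add: case_prod_unfold)
    then show "Lq_x 1 (DN_density N lam f) \<in> borel_measurable lborel"
      unfolding Lq_x_def[abs_def] enn_powr_def[abs_def] by measurable
  qed
  have "esssup (restrict_space lborel torus) (Lq_x 1 (DN_density N lam f)) \<le> ennreal (2 * pi * \<Lambda>)"
    by (rule esssup_I[OF m]) (simp add: Lq)
  then show ?thesis by (simp add: mixed_norm_def \<Lambda>_def)
qed

theorem theorem1p5:
  fixes p :: ereal and q \<beta> :: real
  assumes "0 < p" and "1 \<le> q" and "2 * inverse p + ereal (1 / q) = 1"
    and "0 < \<beta>" and "\<beta> \<le> 2 * q / (q + 1)"
  shows "\<exists>C. \<forall>(N::nat) (lam::nat \<Rightarrow> complex) (f::nat \<Rightarrow> real \<Rightarrow> complex).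
           1 \<le> N \<longrightarrow> in_lbeta \<beta> lam \<longrightarrow> orthonormal_system f \<longrightarrow>
           mixed_norm p q (DN_density N lam f)
             \<le> ennreal (C * real N powr real_of_ereal (inverse p) * lbeta_norm \<beta> lam)"
proof (cases p)
  case PInf
  then have "q = 1" using assms by (simp add: one_ereal_def)
  then have "\<beta> \<le> 1" using assms by simp
  show ?thesis
  \<comment> \<open>As \<open>inverse \<infinity> = 0\<close> and \<open>N \<ge> 1\<close>, the
    power of \<open>N\<close> in the claim is 1.\<close>
  proof (intro exI[of _ "2 * pi"] allI impI)
    fix N :: nat and lam f assume "1 \<le> N" "in_lbeta \<beta> lam" "orthonormal_system f"
    then show "mixed_norm p q (DN_density N lam f) \<le> ennreal (2 * pi * real N powr real_of_ereal (inverse p) * lbeta_norm \<beta> lam)"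
      using mixed_norm_bound_infinite[OF \<open>0 < \<beta>\<close> \<open>\<beta> \<le> 1\<close>, of lam f N] by (simp add: PInf \<open>q = 1\<close>)
  qed
next
  case (real P)
  then have P: "0 < P" using assms by simp
  have eq: "2 / P + 1 / q = 1"
    using assms(3) P unfolding real by (simp add: one_ereal_def divide_inverse)
  define \<tau> where "\<tau> = 1 - 1 / q"
  have tau: "\<tau> = 2 / P" using eq by (simp add: \<tau>_def)
  have "q \<noteq> 1" using eq P by auto
  then have q: "1 < q" using assms(2) by simp
  have p_eq: "P = 2 / \<tau>" using P by (simp add: tau)
  \<comment> \<open>The admissible range of \<open>\<beta>\<close> ends exactly at the conjugate of
    the Schatten exponent \<open>2 / \<tau>\<close>.\<close>
  have b: "\<beta> \<le> 2 / (2 - \<tau>)"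
  proof -
    have "2 - \<tau> = (q + 1) / q" using q by (simp add: \<tau>_def field_simps)
    then have "2 / (2 - \<tau>) = 2 * q / (q + 1)" using q by simp
    then show ?thesis using assms(5) by simp
  qed
  show ?thesis
  proof (intro exI[of _ "7 powr (1 / P) * interp_const \<tau>"] allI impI)
    fix N :: nat and lam f assume "1 \<le> N" "in_lbeta \<beta> lam" "orthonormal_system f"
    then show "mixed_norm p q (DN_density N lam f) \<le> ennreal (7 powr (1 / P) * interp_const \<tau> * real N powr real_of_ereal (inverse p) * lbeta_norm \<beta> lam)"
      using mixed_norm_bound_finite[OF _ q \<tau>_def p_eq assms(4) b, of N lam f] P by (simp add: real divide_inverse)
  qed
next
  case MInf
  then show ?thesis using assms by simp
qed

end
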